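(* There is an absolute constant $c_1>0$ such that the following holds. Let $Q,N\in\mathbb{N}$ with $Q\ge16$, $N=Q^{1+\delta}/16$ and $0<\delta<1$, and let $(a_n)_{n\in\mathbb{Z}[i]}$ be any sequence of complex numbers. Then $$\sum_{\mathcal{N}(p)\le Q}\ \sum_{\substack{a\bmod p\\ (a,p)=1}}\Big|\sum_{\substack{n\in\mathbb{Z}[i]\\ \mathcal{N}(n)\le N}}a_n\, e\Big(\Re\Big(\frac{na}{p}\Big)\Big)\Big|^2\le\frac{c_1}{1-\delta}\cdot\frac{Q^2\log\log Q}{\log Q}\,Z,$$ where $p$ runs over the Gaussian primes with $\mathcal{N}(p)\le Q$ and $Z=\sum_{n\in\mathbb{Z}[i],\ \mathcal{N}(n)\le N}|a_n|^2$.
   Context: $e(x)=e^{2\pi i x}$. $\mathbb{Z}[i]$ denotes the Gaussian integers and $\mathcal{N}(q)=\Re(q)^2+\Im(q)^2$. "$a\bmod p$, $(a,p)=1$" means $a$ runs over a complete system of nonzero residues modulo $p$ in $\mathbb{Z}[i]$. *)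

theory Defs
  imports Complex_Main
begin

definition gauss_ints :: "complex set" where
  "gauss_ints = {z. Re z \<in> \<int> \<and> Im z \<in> \<int>}"

definition gnorm :: "complex \<Rightarrow> real" where
  "gnorm q = (Re q)^2 + (Im q)^2"

definition gdvd :: "complex \<Rightarrow> complex \<Rightarrow> bool" where
  "gdvd d a \<longleftrightarrow> (\<exists>k\<in>gauss_ints. a = d * k)"

definition gunit :: "complex \<Rightarrow> bool" where
  "gunit u \<longleftrightarrow> u \<in> gauss_ints \<and> gdvd u 1"

definition gprime :: "complex \<Rightarrow> bool" where
  "gprime p \<longleftrightarrow> p \<in> gauss_ints \<and> p \<noteq> 0 \<and> \<not> gunit p \<and>
     (\<forall>a\<in>gauss_ints. \<forall>b\<in>gauss_ints. gdvd p (a * b) \<longrightarrow> gdvd p a \<or> gdvd p b)"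

definition gcoprime :: "complex \<Rightarrow> complex \<Rightarrow> bool" where
  "gcoprime a p \<longleftrightarrow> (\<forall>d\<in>gauss_ints. gdvd d a \<and> gdvd d p \<longrightarrow> gunit d)"

definition reduced_residue_system :: "complex \<Rightarrow> complex set \<Rightarrow> bool" where
  "reduced_residue_system p S \<longleftrightarrow>
     S \<subseteq> gauss_ints \<and> (\<forall>s\<in>S. gcoprime s p) \<and>
     (\<forall>b\<in>gauss_ints. gcoprime b p \<longrightarrow> (\<exists>!s. s \<in> S \<and> gdvd p (b - s)))"

definition ee :: "real \<Rightarrow> complex" where
  "ee x = exp (2 * pi * \<i> * complex_of_real x)"

end

theory Submission
  imports Defs "HOL-Library.FuncSet"
begin

text \<open>
  By duality the inequality reduces to bounding, for every \<open>\<alpha>\<close>, the number of fractions \<open>c/q\<close> with \<open>q\<close>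
  prime, \<open>N(q) \<le> Q\<close> and \<open>\<bar>c/q - \<alpha>\<bar> \<le> 1/\<surd>N\<close>: if there are at most \<open>K\<close> of them, the sum is \<open>O(K N Z)\<close>,
  and \<open>K \<lless> Q\<^sup>2 ln ln Q / ((1 - \<delta>) N ln Q)\<close> is what is needed. The pairs \<open>(q, c)\<close> are points of the lattice
  \<open>\<int>[i]\<^sup>2\<close> in a thin region. Dirichlet's theorem provides a primitive vector \<open>(q\<^sub>1, c\<^sub>1)\<close> that is short relative to
  this region and cuts it into few lines, and on each line \<open>q\<close> lies in a progression modulo \<open>q\<^sub>1\<close> of length
  at least a power of \<open>Q\<^sup>1\<^sup>-\<^sup>\<delta>\<close>. An upper bound sieve, itself deduced from the dual large sieve, saves a
  factor \<open>(1 - \<delta>) ln Q \<sqdot> \<phi>(q\<^sub>1)/N(q\<^sub>1)\<close> there, and \<open>N(q\<^sub>1)/\<phi>(q\<^sub>1) \<lless> ln ln Q\<close> by a Mertens type estimate.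
\<close>

section \<open>Arithmetic of Gaussian integers\<close>

text \<open>Put \<open>T = sqrt Q\<close>. The pairs \<open>(q, c)\<close> lie in the region
  \<open>|q| <= T\<close>, \<open>|c - \<alpha> q| <= T / sqrt N\<close>; let \<open>\<mu>\<close>
  be the size of the short vector relative to it. Up to constants there are at most
  \<open>\<mu>^2 Q^2 / N\<close> lines with at most \<open>1 / \<mu>^2\<close> lattice points each,
  so \<open>\<mu>\<close> cancels, and the quality of the approximation to \<open>\<alpha>\<close>
  does not matter. Dirichlet's theorem only has to make \<open>\<mu>\<close> at most a constant
  times \<open>1 / D\<close>, where \<open>D = sqrt Q / N^(1/4)\<close>: every line is then long
  enough to be sieved by primes of norm up to \<open>D\<close>. Since
  \<open>(D / 2)^4 = Q^2 / (16 N) = Q powr (1 - \<delta>)\<close>, this is where the factor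
  \<open>1 - \<delta>\<close> originates. Along a line \<open>q\<close> is constant modulo every
  prime dividing \<open>q\<^sub>1\<close>, so these primes cannot be used for sieving; their absence
  is what costs \<open>ln (ln Q)\<close>. The density of the remaining primes is bounded from below
  through the harmonic sum over all Gaussian integers, each being a unit times a squarefree number
  times a square.\<close>

lemma gauss_ints_add: "a \<in> gauss_ints \<Longrightarrow> b \<in> gauss_ints \<Longrightarrow> a + b \<in> gauss_ints"
  and gauss_ints_diff: "a \<in> gauss_ints \<Longrightarrow> b \<in> gauss_ints \<Longrightarrow> a - b \<in> gauss_ints"
  and gauss_ints_uminus: "a \<in> gauss_ints \<Longrightarrow> - a \<in> gauss_ints"
  and gauss_ints_mult: "a \<in> gauss_ints \<Longrightarrow> b \<in> gauss_ints \<Longrightarrow> a * b \<in> gauss_ints"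
  and gauss_ints_0: "0 \<in> gauss_ints"
  and gauss_ints_1: "1 \<in> gauss_ints"
  and gauss_ints_i: "\<i> \<in> gauss_ints"
  and gauss_ints_of_int: "of_int k \<in> gauss_ints"
  by (auto simp: gauss_ints_def)

lemmas gauss_ints_closed = gauss_ints_add gauss_ints_diff gauss_ints_uminus gauss_ints_mult
  gauss_ints_0 gauss_ints_1 gauss_ints_i gauss_ints_of_int

lemma gauss_ints_Complex: "Complex (of_int x) (of_int y) \<in> gauss_ints"
  by (simp add: gauss_ints_def)

lemma gauss_intsE:
  assumes "z \<in> gauss_ints"
  obtains x y :: int where "z = Complex (of_int x) (of_int y)"
  using assms unfolding gauss_ints_def
  by (auto elim!: Ints_cases simp: complex_eq_iff)

lemma gauss_ints_prod: "(\<And>p. p \<in> S \<Longrightarrow> f p \<in> gauss_ints) \<Longrightarrow> prod f S \<in> gauss_ints"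
  by (induction S rule: infinite_finite_induct) (auto simp: gauss_ints_closed)

lemma gauss_ints_sum: "(\<And>p. p \<in> S \<Longrightarrow> f p \<in> gauss_ints) \<Longrightarrow> sum f S \<in> gauss_ints"
  by (induction S rule: infinite_finite_induct) (auto simp: gauss_ints_closed)

lemma gnorm_eq: "gnorm z = (cmod z)^2"
  by (simp add: gnorm_def cmod_power2)

lemma gnorm_mult: "gnorm (a * b) = gnorm a * gnorm b"
  by (simp add: gnorm_eq norm_mult power_mult_distrib)

lemma gnorm_prod: "gnorm (prod f S) = (\<Prod>p\<in>S. gnorm (f p))"
  by (simp add: gnorm_eq prod_norm[symmetric] prod_power_distrib)

lemma gnorm_nonneg: "gnorm z \<ge> 0"
  by (simp add: gnorm_def)

lemma gnorm_pos: "z \<noteq> 0 \<Longrightarrow> gnorm z > 0"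
  by (simp add: gnorm_eq)

lemma gnorm_0_iff [simp]: "gnorm z = 0 \<longleftrightarrow> z = 0"
  by (simp add: gnorm_eq)

lemma gnorm_1 [simp]: "gnorm 1 = 1"
  by (simp add: gnorm_def)

lemma gnorm_Ints: "z \<in> gauss_ints \<Longrightarrow> gnorm z \<in> \<int>"
  by (auto simp: gnorm_def gauss_ints_def)

lemma gnorm_ge_1:
  assumes "z \<in> gauss_ints" "z \<noteq> 0"
  shows "gnorm z \<ge> 1"
proof -
  obtain k :: int where k: "gnorm z = of_int k"
    using gnorm_Ints[OF assms(1)] by (elim Ints_cases)
  have "k > 0" using gnorm_pos[OF assms(2)] k by simp
  then show ?thesis using k by simp
qed

lemma norm_ge_1:
  assumes "z \<in> gauss_ints" "z \<noteq> 0"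
  shows "cmod z \<ge> 1"
  using gnorm_ge_1[OF assms] norm_ge_zero[of z] unfolding gnorm_eq
  by (metis abs_le_square_iff abs_norm_cancel norm_one one_power2 power2_abs)

lemma gauss_int_approx:
  obtains g where "g \<in> gauss_ints" "\<bar>Re (z - g)\<bar> \<le> 1/2" "\<bar>Im (z - g)\<bar> \<le> 1/2"
proof
  show "Complex (of_int (round (Re z))) (of_int (round (Im z))) \<in> gauss_ints"
    by (rule gauss_ints_Complex)
  show "\<bar>Re (z - Complex (of_int (round (Re z))) (of_int (round (Im z))))\<bar> \<le> 1/2"
    using of_int_round_abs_le[of "Re z"] by (simp add: abs_minus_commute)
  show "\<bar>Im (z - Complex (of_int (round (Re z))) (of_int (round (Im z))))\<bar> \<le> 1/2"
    using of_int_round_abs_le[of "Im z"] by (simp add: abs_minus_commute)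
qed

lemma gauss_division:
  assumes "a \<in> gauss_ints" "b \<in> gauss_ints" "b \<noteq> 0"
  obtains k where "k \<in> gauss_ints" "gnorm (a - b * k) < gnorm b"
proof -
  obtain k where k: "k \<in> gauss_ints" "\<bar>Re (a / b - k)\<bar> \<le> 1/2" "\<bar>Im (a / b - k)\<bar> \<le> 1/2"
    using gauss_int_approx .
  have "(Re (a / b - k))^2 \<le> 1/4" "(Im (a / b - k))^2 \<le> 1/4"
    using abs_le_square_iff[of _ "1/2::real"] k(2,3) by (auto simp: power2_eq_square)
  then have "gnorm (a / b - k) < 1" by (simp add: gnorm_def)
  moreover have "a - b * k = b * (a / b - k)" using assms(3) by (simp add: field_simps)
  ultimately have "gnorm (a - b * k) < gnorm b"
    using gnorm_pos[OF assms(3)] by (simp add: gnorm_mult)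
  then show ?thesis using that k(1) by blast
qed

section \<open>Divisibility and the Bezout identity\<close>

lemma gdvdI: "k \<in> gauss_ints \<Longrightarrow> a = d * k \<Longrightarrow> gdvd d a"
  unfolding gdvd_def by blast

lemma gdvd_refl [simp]: "gdvd a a"
  by (rule gdvdI[of 1]) (auto simp: gauss_ints_closed)

lemma gdvd_0 [simp]: "gdvd a 0"
  by (rule gdvdI[of 0]) (auto simp: gauss_ints_closed)

lemma gdvd_trans: "gdvd a b \<Longrightarrow> gdvd b c \<Longrightarrow> gdvd a c"
  unfolding gdvd_def by (metis gauss_ints_mult mult.assoc)

lemma gdvd_add: "gdvd a b \<Longrightarrow> gdvd a c \<Longrightarrow> gdvd a (b + c)"
  unfolding gdvd_def by (metis gauss_ints_add distrib_left)

lemma gdvd_diff: "gdvd a b \<Longrightarrow> gdvd a c \<Longrightarrow> gdvd a (b - c)"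
  unfolding gdvd_def by (metis gauss_ints_diff right_diff_distrib)

lemma gdvd_mult_left: "gdvd a b \<Longrightarrow> c \<in> gauss_ints \<Longrightarrow> gdvd a (c * b)"
  unfolding gdvd_def by (metis gauss_ints_mult mult.left_commute)

lemma gdvd_mult_right: "gdvd a b \<Longrightarrow> c \<in> gauss_ints \<Longrightarrow> gdvd a (b * c)"
  using gdvd_mult_left[of a b c] by (simp add: mult.commute)

lemma gdvd_imp_gnorm_le:
  assumes "gdvd a b" "b \<noteq> 0"
  shows "gnorm a \<le> gnorm b"
proof -
  obtain k where k: "k \<in> gauss_ints" "b = a * k" using assms(1) unfolding gdvd_def by blast
  then have "gnorm k \<ge> 1" using assms(2) by (intro gnorm_ge_1) auto
  then show ?thesis unfolding k(2) gnorm_mult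
    using gnorm_nonneg[of a] mult_left_mono[of 1 "gnorm k" "gnorm a"] by simp
qed

lemma gunit_iff: "gunit u \<longleftrightarrow> u \<in> gauss_ints \<and> gnorm u = 1"
proof
  assume u: "gunit u"
  then have "u \<noteq> 0" by (auto simp: gunit_def gdvd_def)
  then have "gnorm u \<ge> 1" using u by (intro gnorm_ge_1) (auto simp: gunit_def)
  moreover have "gnorm u \<le> gnorm 1" using u gdvd_imp_gnorm_le[of u 1] by (simp add: gunit_def)
  ultimately show "u \<in> gauss_ints \<and> gnorm u = 1" using u by (simp add: gunit_def)
next
  assume u: "u \<in> gauss_ints \<and> gnorm u = 1"
  have "1 = u * cnj u" using u by (simp add: complex_mult_cnj gnorm_def)
  moreover have "cnj u \<in> gauss_ints" using u by (auto simp: gauss_ints_def)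
  ultimately show "gunit u" using u unfolding gunit_def gdvd_def by blast
qed

lemma gunit_cases:
  assumes "gunit u"
  shows "u \<in> {1, -1, \<i>, -\<i>}"
proof -
  obtain x y :: int where u: "u = Complex (of_int x) (of_int y)"
    using assms gunit_def gauss_intsE by metis
  have "gnorm u = 1" using assms gunit_iff by blast
  then have *: "x^2 + y^2 = 1" unfolding u gnorm_def
    by simp (metis of_int_1 of_int_add of_int_eq_iff of_int_power)
  then have "x^2 \<le> 1" "y^2 \<le> 1" using zero_le_power2[of x] zero_le_power2[of y] by linarith+
  then have "\<bar>x\<bar> \<le> 1" "\<bar>y\<bar> \<le> 1" using abs_le_square_iff[of x 1] abs_le_square_iff[of y 1] by auto
  then have "x \<in> {-1,0,1}" "y \<in> {-1,0,1}" by auto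
  then show ?thesis using * u by (auto simp: complex_eq_iff)
qed

text \<open>An element of least norm among the nonzero elements of the ideal generated by
  \<open>a\<close> and \<open>b\<close> divides the whole ideal, because a nonzero remainder would
  lie in the ideal and have smaller norm.\<close>

lemma gauss_bezout:
  assumes "a \<in> gauss_ints" "b \<in> gauss_ints" "a \<noteq> 0"
  obtains g u v where "g \<in> gauss_ints" "u \<in> gauss_ints" "v \<in> gauss_ints" "g = a * u + b * v"
    "gdvd g a" "gdvd g b" "g \<noteq> 0"
proof -
  define I where "I = {z. z \<noteq> 0 \<and> (\<exists>u\<in>gauss_ints. \<exists>v\<in>gauss_ints. z = a * u + b * v)}"
  have IG: "z \<in> gauss_ints" if "z \<in> I" for z
    using that assms unfolding I_def by (auto intro!: gauss_ints_closed)
  have "a \<in> I" unfolding I_def using assms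
    using gauss_ints_0 gauss_ints_1 by (metis (mono_tags, lifting) add.right_neutral mem_Collect_eq mult.right_neutral mult_zero_right)
  then obtain g where g: "g \<in> I" "\<And>z. z \<in> I \<Longrightarrow> nat \<lfloor>gnorm g\<rfloor> \<le> nat \<lfloor>gnorm z\<rfloor>"
    using ex_has_least_nat[of "\<lambda>z. z \<in> I" a "\<lambda>z. nat \<lfloor>gnorm z\<rfloor>"] by auto
  have min: "gnorm g \<le> gnorm z" if "z \<in> I" for z
  proof -
    have "\<lfloor>gnorm g\<rfloor> \<le> \<lfloor>gnorm z\<rfloor>" using g(2)[OF that] gnorm_nonneg[of z] by (simp add: nat_le_iff)
    then show ?thesis using gnorm_Ints[OF IG[OF g(1)]] gnorm_Ints[OF IG[OF that]]
      by (auto elim!: Ints_cases)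
  qed
  obtain u v where uv: "u \<in> gauss_ints" "v \<in> gauss_ints" "g = a * u + b * v" "g \<noteq> 0"
    using g(1) unfolding I_def by blast
  have dvd: "gdvd g c" if c: "c = a * x + b * y" "x \<in> gauss_ints" "y \<in> gauss_ints" for c x y
  proof -
    have cG: "c \<in> gauss_ints" using c assms by (auto intro!: gauss_ints_closed)
    obtain k where k: "k \<in> gauss_ints" "gnorm (c - g * k) < gnorm g"
      using gauss_division[OF cG IG[OF g(1)] uv(4)] .
    have "c - g * k = a * (x - u * k) + b * (y - v * k)"
      unfolding c(1) uv(3) by (simp add: algebra_simps)
    moreover have "x - u * k \<in> gauss_ints" "y - v * k \<in> gauss_ints"
      using c uv k(1) by (auto intro!: gauss_ints_closed)
    ultimately have "c - g * k = 0" using min[of "c - g * k"] k(2) unfolding I_def by force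
    then show ?thesis using k(1) by (intro gdvdI[of k]) auto
  qed
  have "gdvd g a" using dvd[of a 1 0] by (simp add: gauss_ints_closed)
  moreover have "gdvd g b" using dvd[of b 0 1] by (simp add: gauss_ints_closed)
  ultimately show ?thesis using that IG[OF g(1)] uv by blast
qed

lemma gcoprime_bezout:
  assumes "a \<in> gauss_ints" "b \<in> gauss_ints" "b \<noteq> 0" "gcoprime a b"
  obtains u v where "u \<in> gauss_ints" "v \<in> gauss_ints" "a * u + b * v = 1"
proof -
  obtain g u v where g: "g \<in> gauss_ints" "u \<in> gauss_ints" "v \<in> gauss_ints" "g = b * u + a * v"
    "gdvd g b" "gdvd g a" "g \<noteq> 0"
    using gauss_bezout[OF assms(2,1,3)] .
  have "gunit g" using assms(4) g unfolding gcoprime_def by blast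
  then obtain k where k: "k \<in> gauss_ints" "1 = g * k" unfolding gunit_def gdvd_def by blast
  have "a * (v * k) + b * (u * k) = 1" unfolding k(2) g(4) by (simp add: algebra_simps)
  then show ?thesis using that[of "v * k" "u * k"] g k by (auto intro!: gauss_ints_closed)
qed

lemma gcoprime_gdvd_mult:
  assumes "a \<in> gauss_ints" "b \<in> gauss_ints" "b \<noteq> 0" "gcoprime a b" "c \<in> gauss_ints" "gdvd b (a * c)"
  shows "gdvd b c"
proof -
  obtain u v where uv: "u \<in> gauss_ints" "v \<in> gauss_ints" "a * u + b * v = 1"
    using gcoprime_bezout[OF assms(1-4)] .
  have "c = (a * c) * u + b * (v * c)"
    using arg_cong[OF uv(3), of "\<lambda>z. z * c"] by (simp add: algebra_simps)
  moreover have "gdvd b ((a * c) * u)" using gdvd_mult_right[OF assms(6) uv(1)] .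
  moreover have "gdvd b (b * (v * c))" using uv assms by (intro gdvdI[of "v * c"]) (auto intro!: gauss_ints_closed)
  ultimately show ?thesis using gdvd_add by metis
qed

section \<open>Gaussian primes and squarefree parts\<close>

lemma gprimeD:
  assumes "gprime p"
  shows "p \<in> gauss_ints" "p \<noteq> 0" "\<not> gunit p" "gnorm p \<ge> 2"
proof -
  show *: "p \<in> gauss_ints" "p \<noteq> 0" "\<not> gunit p" using assms by (auto simp: gprime_def)
  have "gnorm p \<ge> 1" "gnorm p \<noteq> 1" using * gnorm_ge_1 gunit_iff by blast+
  then show "gnorm p \<ge> 2" using gnorm_Ints[OF *(1)] by (auto elim!: Ints_cases)
qed

lemma gprime_gdvd_mult:
  "gprime p \<Longrightarrow> a \<in> gauss_ints \<Longrightarrow> b \<in> gauss_ints \<Longrightarrow> gdvd p (a * b) \<Longrightarrow> gdvd p a \<or> gdvd p b"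
  by (auto simp: gprime_def)

lemma gprime_not_gdvd_1: "gprime p \<Longrightarrow> \<not> gdvd p 1"
  by (auto simp: gprime_def gunit_def)

lemma gprime_gdvd_prod:
  assumes "gprime p" "finite S" "\<And>q. q \<in> S \<Longrightarrow> f q \<in> gauss_ints" "gdvd p (prod f S)"
  shows "\<exists>q\<in>S. gdvd p (f q)"
  using assms(2-) 
proof (induction S rule: finite_induct)
  case empty
  then show ?case using gprime_not_gdvd_1[OF assms(1)] by simp
next
  case (insert x F)
  then have "gdvd p (f x * prod f F)" by simp
  then have "gdvd p (f x) \<or> gdvd p (prod f F)"
    using gprime_gdvd_mult[OF assms(1)] gauss_ints_prod[of F f] insert.prems by auto
  then show ?case using insert by auto
qed

lemma gprime_gdvd_cases:
  assumes "gprime p" "d \<in> gauss_ints" "gdvd d p"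
  shows "gunit d \<or> gdvd p d"
proof -
  obtain k where k: "k \<in> gauss_ints" "p = d * k" using assms(3) unfolding gdvd_def by blast
  have "gdvd p d \<or> gdvd p k"
    using gprime_gdvd_mult[OF assms(1,2) k(1)] k(2) by (metis gdvd_refl)
  moreover have "gunit d" if "gdvd p k"
  proof -
    have "k \<noteq> 0" "d \<noteq> 0" using k gprimeD(2)[OF assms(1)] by auto
    then have "gnorm d * gnorm k \<le> 1 * gnorm k" using gdvd_imp_gnorm_le[OF that] k(2) by (simp add: gnorm_mult)
    then have "gnorm d \<le> 1" using gnorm_pos[OF \<open>k \<noteq> 0\<close>] by (simp only: mult_le_cancel_right)
    then show ?thesis using gnorm_ge_1[OF assms(2) \<open>d \<noteq> 0\<close>] assms(2) by (auto simp: gunit_iff)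
  qed
  ultimately show ?thesis by blast
qed

lemma gcoprime_gprime_iff:
  assumes "gprime p"
  shows "gcoprime a p \<longleftrightarrow> \<not> gdvd p a"
proof
  assume "gcoprime a p"
  then show "\<not> gdvd p a" using gprimeD[OF assms] unfolding gcoprime_def by auto
next
  assume "\<not> gdvd p a"
  then show "gcoprime a p" using gprime_gdvd_cases[OF assms] gdvd_trans unfolding gcoprime_def by blast
qed

lemma gprime_divisor_exists:
  assumes "n \<in> gauss_ints" "n \<noteq> 0" "\<not> gunit n"
  obtains p where "gprime p" "gdvd p n"
proof -
  have "\<exists>p. gprime p \<and> gdvd p n"
    using assms
  proof (induction "nat \<lfloor>gnorm n\<rfloor>" arbitrary: n rule: less_induct)
    case less
    show ?case
    proof (cases "\<exists>d\<in>gauss_ints. gdvd d n \<and> \<not> gunit d \<and> gnorm d < gnorm n")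
      case True
      then obtain d where d: "d \<in> gauss_ints" "gdvd d n" "\<not> gunit d" "gnorm d < gnorm n" by blast
      have "d \<noteq> 0" using d(2) less.prems(2) by (auto simp: gdvd_def)
      moreover have "nat \<lfloor>gnorm d\<rfloor> < nat \<lfloor>gnorm n\<rfloor>"
        using d(4) gnorm_Ints[OF d(1)] gnorm_Ints[OF less.prems(1)] gnorm_nonneg[of d] by (auto elim!: Ints_cases)
      ultimately obtain p where "gprime p" "gdvd p d" using less.hyps d by blast
      then show ?thesis using d(2) gdvd_trans by blast
    next
      \<comment> \<open>Without a nonunit divisor of smaller norm, the gcd \<open>g\<close> of
        \<open>n\<close> and \<open>a\<close> is either a unit, and then Euclid's lemma gives
        \<open>gdvd n b\<close>, or an associate of \<open>n\<close>, and then
        \<open>gdvd n a\<close>.\<close>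
      case False
      have "gdvd n a \<or> gdvd n b" if ab: "a \<in> gauss_ints" "b \<in> gauss_ints" "gdvd n (a * b)" for a b
      proof -
        obtain g u v where g: "g \<in> gauss_ints" "u \<in> gauss_ints" "v \<in> gauss_ints" "g = n * u + a * v"
          "gdvd g n" "gdvd g a" "g \<noteq> 0"
          using gauss_bezout[OF less.prems(1) ab(1) less.prems(2)] .
        show ?thesis
        proof (cases "gunit g")
          case True
          have "gcoprime a n" unfolding gcoprime_def
          proof (intro ballI impI)
            fix d assume d: "d \<in> gauss_ints" "gdvd d a \<and> gdvd d n"
            have "gdvd d g" unfolding g(4) using d g(2,3) by (auto intro!: gdvd_add gdvd_mult_right)
            then show "gunit d" using True d(1) gdvd_trans unfolding gunit_def by blast
          qed
          then show ?thesis using gcoprime_gdvd_mult[OF ab(1) less.prems(1,2) _ ab(2,3)] by blast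
        next
          case nu: False
          then have ge: "gnorm g \<ge> gnorm n" using False g by force
          obtain k where k: "k \<in> gauss_ints" "n = g * k" using g(5) unfolding gdvd_def by blast
          have "k \<noteq> 0" using k less.prems by auto
          have "gnorm g * gnorm k \<le> gnorm g * 1" using ge unfolding k(2) gnorm_mult by simp
          then have "gnorm k \<le> 1" using gnorm_pos[OF g(7)] by (simp only: mult_le_cancel_left)
          then have "gunit k" using gnorm_ge_1[OF k(1) \<open>k \<noteq> 0\<close>] k(1) by (auto simp: gunit_iff)
          then obtain l where l: "l \<in> gauss_ints" "1 = k * l" unfolding gunit_def gdvd_def by blast
          have "g = n * l" using k(2) l(2) by (metis mult.assoc mult.right_neutral)
          then have "gdvd n g" using l(1) gdvdI by blast
          then show ?thesis using g(6) gdvd_trans by blast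
        qed
      qed
      then have "gprime n" using less.prems by (auto simp: gprime_def)
      then show ?thesis by auto
    qed
  qed
  then show ?thesis using that by blast
qed

text \<open>The half-open quadrant contains exactly one of the four associates of a prime. Distinct
  members therefore do not divide each other, and finite subsets stand for squarefree numbers up to
  units.\<close>

definition prime_reps :: "complex set" where
  "prime_reps = {p. gprime p \<and> Re p > 0 \<and> Im p \<ge> 0}"

lemma prime_repsD: "p \<in> prime_reps \<Longrightarrow> gprime p"
  by (simp add: prime_reps_def)

lemma prime_reps_ge_2: "p \<in> prime_reps \<Longrightarrow> gnorm p \<ge> 2"
  by (simp add: prime_reps_def gprimeD)

lemma prime_reps_gauss: "p \<in> prime_reps \<Longrightarrow> p \<in> gauss_ints"
  by (simp add: prime_reps_def gprimeD)

lemma unit_to_quadrant: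
  assumes "z \<noteq> 0"
  obtains u where "gunit u" "Re (z * u) > 0" "Im (z * u) \<ge> 0"
proof -
  have u: "gunit 1" "gunit (-1)" "gunit \<i>" "gunit (-\<i>)"
    by (auto simp: gunit_iff gauss_ints_closed) (auto simp: gnorm_def)
  have "Re z \<noteq> 0 \<or> Im z \<noteq> 0" using assms by (simp add: complex_eq_iff)
  then consider "Re z > 0 \<and> Im z \<ge> 0" | "Re z \<le> 0 \<and> Im z > 0" | "Re z < 0 \<and> Im z \<le> 0" | "Re z \<ge> 0 \<and> Im z < 0"
    by linarith
  then show ?thesis
  proof cases
    case 1 then show ?thesis using that[of 1] u by simp
  next
    case 2 then show ?thesis using that[of "-\<i>"] u by simp
  next
    case 3 then show ?thesis using that[of "-1"] u by simp
  next
    case 4 then show ?thesis using that[of "\<i>"] u by simp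
  qed
qed

lemma gprime_mult_unit:
  assumes "gprime p" "gunit u"
  shows "gprime (p * u)"
proof -
  obtain w where w: "w \<in> gauss_ints" "1 = u * w" using assms(2) unfolding gunit_def gdvd_def by blast
  have u: "u \<in> gauss_ints" "u \<noteq> 0" using w assms(2) by (auto simp: gunit_def)
  have iff: "gdvd (p * u) a \<longleftrightarrow> gdvd p a" for a
  proof
    assume "gdvd p a"
    then obtain k where k: "k \<in> gauss_ints" "a = p * k" unfolding gdvd_def by blast
    have "a = p * u * (w * k)" using k(2) w(2) by (metis mult.assoc mult.right_neutral)
    then show "gdvd (p * u) a" using k(1) w(1) gauss_ints_mult gdvdI by blast
  next
    assume "gdvd (p * u) a"
    then show "gdvd p a" using u(1) by (meson gdvdI gdvd_trans)
  qed
  show ?thesis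
    unfolding gprime_def iff using assms u gprimeD[OF assms(1)] gprime_gdvd_mult[OF assms(1)]
    by (auto simp: gunit_iff gnorm_mult gauss_ints_mult)
qed

lemma prime_rep_exists:
  assumes "gprime p"
  obtains q u where "q \<in> prime_reps" "gunit u" "q = p * u"
  using unit_to_quadrant[OF gprimeD(2)[OF assms]] gprime_mult_unit[OF assms]
  unfolding prime_reps_def by blast

lemma prime_reps_gdvd_imp_eq:
  assumes p: "p \<in> prime_reps" and q: "q \<in> prime_reps" and "gdvd p q"
  shows "p = q"
proof -
  obtain u where u: "u \<in> gauss_ints" "q = p * u" using assms(3) unfolding gdvd_def by blast
  have "gdvd q p"
    using gprime_gdvd_cases[OF prime_repsD[OF q] prime_reps_gauss[OF p] assms(3)] gprimeD(3)[OF prime_repsD[OF p]] by blast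
  then have "gnorm q \<le> gnorm p" using gdvd_imp_gnorm_le gprimeD(2)[OF prime_repsD[OF p]] by blast
  moreover have "gnorm p \<le> gnorm q" using gdvd_imp_gnorm_le gprimeD(2)[OF prime_repsD[OF q]] assms(3) by blast
  ultimately have "gnorm p * gnorm u = gnorm p * 1" unfolding u(2) gnorm_mult by simp
  then have "gnorm u = 1" using gprimeD(2)[OF prime_repsD[OF p]] by (auto simp: mult_cancel_left)
  then have "u \<in> {1, -1, \<i>, -\<i>}" using u(1) by (intro gunit_cases) (auto simp: gunit_iff)
  then show ?thesis using p q unfolding u(2) prime_reps_def by auto
qed

lemma prod_prime_reps_gdvd:
  assumes "finite S" "S \<subseteq> prime_reps" "\<And>p. p \<in> S \<Longrightarrow> gdvd p n" "n \<in> gauss_ints"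
  shows "gdvd (\<Prod>S) n"
  using assms
proof (induction S rule: finite_induct)
  case empty
  then show ?case using gdvdI[of n n 1] by simp
next
  case (insert p S)
  have "gdvd (\<Prod>S) n" using insert by simp
  then obtain k where k: "k \<in> gauss_ints" "n = \<Prod>S * k" unfolding gdvd_def by blast
  have p: "gprime p" using insert.prems prime_repsD by blast
  have S: "\<Prod>S \<in> gauss_ints" using insert.prems prime_reps_gauss by (intro gauss_ints_prod) auto
  have "\<not> gdvd p (\<Prod>S)"
  proof
    assume "gdvd p (\<Prod>S)"
    then obtain q where "q \<in> S" "gdvd p q"
      using gprime_gdvd_prod[OF p insert.hyps(1), of "\<lambda>x. x"] insert.prems prime_reps_gauss by auto
    then show False using prime_reps_gdvd_imp_eq[of p q] insert by auto
  qed
  moreover have "gdvd p (\<Prod>S * k)" using insert.prems k by auto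
  ultimately have "gdvd p k" using gprime_gdvd_mult[OF p S k(1)] by blast
  then obtain l where "l \<in> gauss_ints" "k = p * l" unfolding gdvd_def by blast
  then show ?case using k insert.hyps by (intro gdvdI[of l]) (auto simp: mult_ac)
qed

text \<open>Unique factorisation of squarefree numbers: it converts sums over sets of primes into
  sums over Gaussian integers without multiplicity.\<close>

lemma prod_prime_reps_inj: "inj_on (\<lambda>S. \<Prod>S) {S. finite S \<and> S \<subseteq> prime_reps}"
proof (rule inj_onI, rule ccontr)
  have *: "S \<subseteq> T" if ST: "finite S" "finite T" "S \<subseteq> prime_reps" "T \<subseteq> prime_reps" "\<Prod>S = \<Prod>T" for S T
  proof
    fix p assume "p \<in> S"
    have "\<Prod>S = p * \<Prod>(S - {p})" using that \<open>p \<in> S\<close> by (simp add: prod.remove)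
    moreover have "\<Prod>(S - {p}) \<in> gauss_ints" using that prime_reps_gauss by (intro gauss_ints_prod) auto
    ultimately have "gdvd p (\<Prod>T)" using that gdvdI by metis
    moreover have "gprime p" using \<open>p \<in> S\<close> that prime_repsD by blast
    ultimately obtain q where "q \<in> T" "gdvd p q"
      using gprime_gdvd_prod[of p T "\<lambda>x. x"] ST prime_reps_gauss by blast
    then show "p \<in> T" using prime_reps_gdvd_imp_eq[of p q] \<open>p \<in> S\<close> that by auto
  qed
  fix S T assume "S \<in> {S. finite S \<and> S \<subseteq> prime_reps}" "T \<in> {S. finite S \<and> S \<subseteq> prime_reps}"
    "\<Prod>S = \<Prod>T" "S \<noteq> T"
  then show False using *[of S T] *[of T S] by auto
qed

text \<open>Primes are split off one at a time: a prime not yet in \<open>S\<close> joins it, a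
  prime already in \<open>S\<close> leaves it and enters \<open>m\<close>.\<close>

lemma squarefree_decomposition:
  assumes "n \<in> gauss_ints" "n \<noteq> 0"
  shows "\<exists>u S m. gunit u \<and> finite S \<and> S \<subseteq> {p \<in> prime_reps. gdvd p n} \<and> m \<in> gauss_ints \<and> m \<noteq> 0 \<and> n = u * \<Prod>S * m^2"
  using assms
proof (induction "nat \<lfloor>gnorm n\<rfloor>" arbitrary: n rule: less_induct)
  case less
  show ?case
  proof (cases "gunit n")
    case True
    then show ?thesis
      by (intro exI[of _ n] exI[of _ "{}"] exI[of _ 1]) (auto simp: gauss_ints_closed)
  next
    case False
    then obtain p0 where p0: "gprime p0" "gdvd p0 n" using gprime_divisor_exists less.prems by blast
    then obtain p v where p: "p \<in> prime_reps" "gunit v" "p = p0 * v" using prime_rep_exists by blast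
    obtain w where w: "w \<in> gauss_ints" "1 = v * w" using p(2) unfolding gunit_def gdvd_def by blast
    obtain k0 where k0: "k0 \<in> gauss_ints" "n = p0 * k0" using p0(2) unfolding gdvd_def by blast
    define k where "k = w * k0"
    have k: "k \<in> gauss_ints" "n = p * k"
      using k0 w p(3) unfolding k_def
      by (blast intro: gauss_ints_mult) (metis mult.assoc mult.right_neutral k0(2) w(2) p(3))
    have k_nz: "k \<noteq> 0" using k less.prems by auto
    have "gnorm p * gnorm k \<ge> 2 * gnorm k"
      using prime_reps_ge_2[OF p(1)] gnorm_nonneg[of k] by (intro mult_right_mono) auto
    then have "gnorm k < gnorm n" using gnorm_pos[OF k_nz] unfolding k(2) gnorm_mult by linarith
    then have "nat \<lfloor>gnorm k\<rfloor> < nat \<lfloor>gnorm n\<rfloor>"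
      using gnorm_Ints[OF k(1)] gnorm_Ints[OF less.prems(1)] gnorm_nonneg[of k] by (auto elim!: Ints_cases)
    then obtain u S m where IH: "gunit u" "finite S" "S \<subseteq> {p \<in> prime_reps. gdvd p k}" "m \<in> gauss_ints" "m \<noteq> 0"
      "k = u * \<Prod>S * m^2"
      using less.hyps[OF _ k(1) k_nz] by blast
    have S: "S \<subseteq> {p \<in> prime_reps. gdvd p n}"
      using IH(3) gdvd_mult_left[OF _ prime_reps_gauss[OF p(1)]] unfolding k(2) by blast
    have pn: "gdvd p n" using k gdvdI by blast
    show ?thesis
    proof (cases "p \<in> S")
      case True
      then have "\<Prod>S = p * \<Prod>(S - {p})" using IH(2) by (simp add: prod.remove)
      then have "n = u * \<Prod>(S - {p}) * (p * m)^2"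
        unfolding k(2) IH(6) by (simp add: power2_eq_square mult_ac)
      then show ?thesis
        using IH S p(1) gprimeD(2)[OF prime_repsD[OF p(1)]] prime_reps_gauss[OF p(1)] gauss_ints_mult
        by (intro exI[of _ u] exI[of _ "S - {p}"] exI[of _ "p * m"]) auto
    next
      case False
      then have "n = u * \<Prod>(insert p S) * m^2"
        unfolding k(2) IH(6) using IH(2) by (simp add: mult_ac)
      then show ?thesis
        using IH S p(1) pn by (intro exI[of _ u] exI[of _ "insert p S"] exI[of _ m]) auto
    qed
  qed
qed

text \<open>The lattice \<open>p\<int>[i]\<close> contains \<open>N(p)/g\<close> and some \<open>h + gi\<close>, where \<open>g = gcd (Re p) (Im p)\<close>, so every class
  meets the box \<open>[0, N(p)/g) \<times> [0, g)\<close>.\<close>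
lemma gauss_residue_box:
  assumes "p \<in> gauss_ints" "p \<noteq> 0"
  obtains B where "finite B" "real (card B) \<le> gnorm p"
    "\<And>z. z \<in> gauss_ints \<Longrightarrow> \<exists>w\<in>B. gdvd p (z - w)"
proof -
  obtain a b :: int where p: "p = Complex (of_int a) (of_int b)" using assms(1) gauss_intsE by blast
  define g where "g = gcd a b"
  have "a \<noteq> 0 \<or> b \<noteq> 0" using assms(2) p by (auto simp: complex_eq_iff)
  then have g0: "g > 0" unfolding g_def by auto
  obtain a' b' where ab: "a = g * a'" "b = g * b'" unfolding g_def by (meson dvdE gcd_dvd1 gcd_dvd2)
  obtain u v where uv: "u * a + v * b = g" unfolding g_def using bezout_int by blast
  define M where "M = g * (a'^2 + b'^2)"
  have MN: "gnorm p = of_int (M * g)" unfolding p gnorm_def M_def ab by (simp add: power2_eq_square algebra_simps)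
  have M0: "M > 0" using gnorm_pos[OF assms(2)] g0 unfolding MN by (simp add: zero_less_mult_iff)
  \<comment> \<open>Here \<open>p * Complex v u = Complex h g\<close> and
    \<open>p * Complex a' (- b') = Complex M 0\<close>. Subtracting \<open>k\<close> times the first
    brings the imaginary part below \<open>g\<close>; subtracting \<open>l\<close> times the second
    then brings the real part below \<open>M\<close> and leaves the imaginary part alone.\<close>
  define h where "h = a * v - b * u"
  define B where "B = (\<lambda>(x, y). Complex (of_int x) (of_int y)) ` ({0..<M} \<times> {0..<g})"
  have "card B \<le> card ({0..<M} \<times> {0..<g})" unfolding B_def by (intro card_image_le) auto
  also have "\<dots> = nat (M * g)" using M0 g0 by (simp add: nat_mult_distrib)
  finally have "real (card B) \<le> real (nat (M * g))" by simp
  then have "real (card B) \<le> gnorm p" unfolding MN using M0 g0 by simp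
  moreover have "\<exists>w\<in>B. gdvd p (z - w)" if "z \<in> gauss_ints" for z
  proof -
    obtain x y :: int where z: "z = Complex (of_int x) (of_int y)" using gauss_intsE[OF \<open>z \<in> gauss_ints\<close>] .
    define k where "k = y div g"
    define x' where "x' = x - k * h"
    define l where "l = x' div M"
    have "x' - l * M = x' mod M" "y - k * g = y mod g"
      unfolding l_def k_def by (simp_all add: minus_div_mult_eq_mod)
    then have "Complex (of_int (x' - l * M)) (of_int (y - k * g)) \<in> B"
      unfolding B_def using M0 g0 by force
    moreover have "z - Complex (of_int (x' - l * M)) (of_int (y - k * g)) =
      p * (of_int k * Complex (of_int v) (of_int u) + of_int l * Complex (of_int a') (of_int (- b')))"
    proof -
      have "x - (x' - l * M) = a * (k * v + l * a') - b * (k * u - l * b')"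
        unfolding x'_def h_def M_def ab by (simp add: algebra_simps power2_eq_square)
      moreover have "y - (y - k * g) = a * (k * u - l * b') + b * (k * v + l * a')"
      proof -
        have "a * b' = a' * b" unfolding ab by simp
        moreover have "k * g = k * (u * a + v * b)" using uv by simp
        ultimately show ?thesis by (simp add: algebra_simps)
      qed
      ultimately show ?thesis unfolding z p complex_eq_iff
        by (simp flip: of_int_diff of_int_mult of_int_add)
    qed
    ultimately show ?thesis
      by (intro bexI gdvdI[where k = "of_int k * Complex (of_int v) (of_int u) + of_int l * Complex (of_int a') (of_int (- b'))"])
        (auto intro!: gauss_ints_closed gauss_ints_Complex simp del: of_int_minus)
  qed
  ultimately show ?thesis using that[of B] unfolding B_def by auto
qed

text \<open>Reduced residue systems are arbitrary sets of representatives, so their finiteness has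
  to come from incongruence. The bound by the norm later compares the sieve weights with
  \<open>1 / gnorm p\<close>.\<close>

lemma incongruent_finite_card_le:
  assumes "p \<in> gauss_ints" "p \<noteq> 0" "S \<subseteq> gauss_ints"
    "\<And>r s. r \<in> S \<Longrightarrow> s \<in> S \<Longrightarrow> gdvd p (r - s) \<Longrightarrow> r = s"
  shows "finite S" "real (card S) \<le> gnorm p"
proof -
  obtain B where B: "finite B" "real (card B) \<le> gnorm p" "\<And>z. z \<in> gauss_ints \<Longrightarrow> \<exists>w\<in>B. gdvd p (z - w)"
    using gauss_residue_box[OF assms(1,2)] by blast
  then obtain f where f: "\<And>z. z \<in> gauss_ints \<Longrightarrow> f z \<in> B \<and> gdvd p (z - f z)" by metis
  have inj: "inj_on f S"
  proof (rule inj_onI)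
    fix r s assume rs: "r \<in> S" "s \<in> S" "f r = f s"
    have "gdvd p ((r - f r) - (s - f s))" using f rs assms(3) gdvd_diff by blast
    then show "r = s" using assms(4) rs by simp
  qed
  have sub: "f ` S \<subseteq> B" using f assms(3) by auto
  show "finite S" using inj sub B(1) finite_imageD finite_subset by blast
  have "card S \<le> card B" using card_inj_on_le[OF inj sub B(1)] .
  then show "real (card S) \<le> gnorm p" using B(2) by linarith
qed

lemma reduced_residue_system_eq:
  assumes "reduced_residue_system p S" "r \<in> S" "s \<in> S" "gdvd p (r - s)"
  shows "r = s"
proof -
  have "r \<in> gauss_ints" "gcoprime r p" using assms unfolding reduced_residue_system_def by auto
  then have "\<exists>!t. t \<in> S \<and> gdvd p (r - t)" using assms unfolding reduced_residue_system_def by blast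
  moreover have "gdvd p (r - r)" by simp
  ultimately show ?thesis using assms by blast
qed

lemma reduced_residue_system_exists: "\<exists>S. reduced_residue_system p S"
proof -
  define f where "f z = (SOME w. w \<in> gauss_ints \<and> gdvd p (z - w))" for z
  have f: "f z \<in> gauss_ints \<and> gdvd p (z - f z)" if "z \<in> gauss_ints" for z
    unfolding f_def by (rule someI[of _ z]) (use that in simp)
  have sym: "gdvd p (w - z)" if "gdvd p (z - w)" for z w
    using gdvd_diff[OF gdvd_0 that] by simp
  \<comment> \<open>Congruent arguments put the same predicate under \<open>SOME\<close> and so
    receive the same representative.\<close>
  have ff: "f z = f w" if "gdvd p (z - w)" for z w
  proof -
    have "gdvd p (z - x) \<longleftrightarrow> gdvd p (w - x)" for x
      using gdvd_add[OF that, of "w - x"] gdvd_add[OF sym[OF that], of "z - x"] by auto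
    then show ?thesis unfolding f_def by simp
  qed
  have cop: "gcoprime w p" if "gcoprime z p" "gdvd p (z - w)" for z w
    unfolding gcoprime_def
  proof (intro ballI impI)
    fix d assume d: "d \<in> gauss_ints" "gdvd d w \<and> gdvd d p"
    have "gdvd d ((z - w) + w)" using d that by (intro gdvd_add) (auto intro: gdvd_trans)
    then show "gunit d" using that d unfolding gcoprime_def by simp
  qed
  have "reduced_residue_system p (f ` {b \<in> gauss_ints. gcoprime b p})"
    unfolding reduced_residue_system_def
  proof (intro conjI ballI impI)
    show "f ` {b \<in> gauss_ints. gcoprime b p} \<subseteq> gauss_ints" using f by auto
  next
    fix s assume "s \<in> f ` {b \<in> gauss_ints. gcoprime b p}"
    then show "gcoprime s p" using f cop by blast
  next
    fix b assume b: "b \<in> gauss_ints" "gcoprime b p"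
    show "\<exists>!s. s \<in> f ` {b \<in> gauss_ints. gcoprime b p} \<and> gdvd p (b - s)"
    proof (rule ex1I[of _ "f b"])
      show "f b \<in> f ` {b \<in> gauss_ints. gcoprime b p} \<and> gdvd p (b - f b)" using f b by auto
      fix s assume "s \<in> f ` {b \<in> gauss_ints. gcoprime b p} \<and> gdvd p (b - s)"
      then obtain z where z: "z \<in> gauss_ints" "s = f z" "gdvd p (b - f z)" by auto
      have "gdvd p ((b - f z) - (z - f z))" using z f gdvd_diff by blast
      then show "s = f b" using ff[of b z] z by simp
    qed
  qed
  then show ?thesis by blast
qed

section \<open>Counting Gaussian integers and primes\<close>

lemma gauss_disc_finite_card:
  assumes "r \<ge> 0"
  shows "finite {z \<in> gauss_ints. cmod (z - c) \<le> r}"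
    and "real (card {z \<in> gauss_ints. cmod (z - c) \<le> r}) \<le> (2 * r + 1)^2"
proof -
  define I where "I t = {\<lceil>t - r\<rceil>..\<lfloor>t + r\<rfloor>}" for t
  define B where "B = (\<lambda>(x, y). Complex (of_int x) (of_int y)) ` (I (Re c) \<times> I (Im c))"
  have cI: "real (card (I t)) \<le> 2 * r + 1" for t
    unfolding I_def using assms by simp linarith
  have sub: "{z \<in> gauss_ints. cmod (z - c) \<le> r} \<subseteq> B"
  proof
    fix z assume "z \<in> {z \<in> gauss_ints. cmod (z - c) \<le> r}"
    then have z: "z \<in> gauss_ints" "cmod (z - c) \<le> r" by auto
    obtain x y :: int where xy: "z = Complex (of_int x) (of_int y)" using gauss_intsE[OF z(1)] .
    have "\<bar>x - Re c\<bar> \<le> r" "\<bar>y - Im c\<bar> \<le> r"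
      using z(2) abs_Re_le_cmod[of "z - c"] abs_Im_le_cmod[of "z - c"] xy by auto
    then have "x \<in> I (Re c)" "y \<in> I (Im c)" unfolding I_def by (auto simp: ceiling_le_iff le_floor_iff)
    then show "z \<in> B" unfolding B_def xy by force
  qed
  have fB: "finite B" unfolding B_def I_def by auto
  then show "finite {z \<in> gauss_ints. cmod (z - c) \<le> r}" using sub finite_subset by blast
  have "card {z \<in> gauss_ints. cmod (z - c) \<le> r} \<le> card B" using sub fB by (rule card_mono[rotated])
  also have "\<dots> \<le> card (I (Re c) \<times> I (Im c))" unfolding B_def by (intro card_image_le) (auto simp: I_def)
  finally have "real (card {z \<in> gauss_ints. cmod (z - c) \<le> r}) \<le> real (card (I (Re c))) * real (card (I (Im c)))"
    by (simp add: card_cartesian_product flip: of_nat_mult)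
  also have "\<dots> \<le> (2 * r + 1) * (2 * r + 1)" using cI assms by (intro mult_mono) auto
  finally show "real (card {z \<in> gauss_ints. cmod (z - c) \<le> r}) \<le> (2 * r + 1)^2" by (simp add: power2_eq_square)
qed

lemma finite_gauss_box:
  assumes "X \<ge> 0"
  shows "finite {n \<in> gauss_ints. \<bar>Re n\<bar> \<le> X \<and> \<bar>Im n\<bar> \<le> X}"
proof (rule finite_subset[OF _ gauss_disc_finite_card(1)[of "2 * X" 0]])
  have "cmod x \<le> 2 * X" if "\<bar>Re x\<bar> \<le> X" "\<bar>Im x\<bar> \<le> X" for x
    using cmod_le[of x] that by linarith
  then show "{n \<in> gauss_ints. \<bar>Re n\<bar> \<le> X \<and> \<bar>Im n\<bar> \<le> X} \<subseteq> {z \<in> gauss_ints. cmod (z - 0) \<le> 2 * X}"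
    by auto
qed (use assms in auto)

definition nonzero_disc :: "real \<Rightarrow> complex set" where
  "nonzero_disc X = {n \<in> gauss_ints. n \<noteq> 0 \<and> gnorm n \<le> X}"

lemma gnorm_le_iff: "X \<ge> 0 \<Longrightarrow> gnorm z \<le> X \<longleftrightarrow> cmod z \<le> sqrt X"
  unfolding gnorm_eq by (metis norm_ge_zero real_le_rsqrt real_sqrt_le_iff real_sqrt_unique sqrt_le_D)

lemma finite_gnorm_le: "finite {n \<in> gauss_ints. gnorm n \<le> X}"
proof (cases "X \<ge> 0")
  case True
  then show ?thesis using gauss_disc_finite_card(1)[of "sqrt X" 0] gnorm_le_iff by simp
next
  case False
  then have "{n \<in> gauss_ints. gnorm n \<le> X} = {}" using gnorm_nonneg order_trans by blast
  then show ?thesis by (metis finite.emptyI)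
qed

lemma finite_nonzero_disc: "finite (nonzero_disc X)"
  by (rule finite_subset[OF _ finite_gnorm_le[of X]]) (auto simp: nonzero_disc_def)

lemma card_gnorm_le:
  assumes "X \<ge> 1"
  shows "real (card {n \<in> gauss_ints. gnorm n \<le> X}) \<le> 9 * X"
proof -
  have "{n \<in> gauss_ints. gnorm n \<le> X} = {z \<in> gauss_ints. cmod (z - 0) \<le> sqrt X}"
    using gnorm_le_iff[of X] assms by auto
  then have "real (card {n \<in> gauss_ints. gnorm n \<le> X}) \<le> (2 * sqrt X + 1)^2"
    using gauss_disc_finite_card(2)[of "sqrt X" 0] assms by simp
  also have "\<dots> \<le> (3 * sqrt X)^2" using assms by (intro power_mono) auto
  also have "\<dots> = 9 * X" using assms by simp
  finally show ?thesis .
qed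

lemma card_nonzero_disc_le:
  assumes "X \<ge> 0"
  shows "real (card (nonzero_disc X)) \<le> 9 * X"
proof (cases "X \<ge> 1")
  case True
  have "card (nonzero_disc X) \<le> card {n \<in> gauss_ints. gnorm n \<le> X}"
    by (intro card_mono finite_gnorm_le) (auto simp: nonzero_disc_def)
  then show ?thesis using card_gnorm_le[OF True] by linarith
next
  case False
  then have "nonzero_disc X = {}" using gnorm_ge_1 by (force simp: nonzero_disc_def)
  then show ?thesis using assms by simp
qed

text \<open>The points of a quadrant square of side \<open>sqrt (X / 2)\<close>, without the origin,
  number at least \<open>X / 2 - 1\<close>, and the point \<open>1\<close> guarantees at least one;
  \<open>X / 4\<close> is the mean of these two lower bounds.\<close>

lemma card_nonzero_disc_ge:
  assumes "X \<ge> 1"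
  shows "real (card (nonzero_disc X)) \<ge> X / 4"
proof -
  define K where "K = \<lfloor>sqrt (X / 2)\<rfloor>"
  have K0: "K \<ge> 0" unfolding K_def using assms by simp
  have Ks: "real_of_int K \<le> sqrt (X / 2)" "sqrt (X / 2) \<le> real_of_int K + 1" unfolding K_def by linarith+
  have inj: "inj_on (\<lambda>(x, y). Complex (real_of_int x) (real_of_int y)) ({0..K} \<times> {0..K} - {(0, 0)})"
    by (auto simp: inj_on_def)
  have sub: "(\<lambda>(x, y). Complex (real_of_int x) (real_of_int y)) ` ({0..K} \<times> {0..K} - {(0, 0)}) \<subseteq> nonzero_disc X"
  proof (rule image_subsetI)
    fix z :: "int \<times> int" assume z: "z \<in> {0..K} \<times> {0..K} - {(0, 0)}"
    obtain x y where zxy: "z = (x, y)" by (cases z)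
    then have xy: "x \<in> {0..K}" "y \<in> {0..K}" "(x, y) \<noteq> (0, 0)" using z by auto
    have "real_of_int x ^ 2 \<le> sqrt (X / 2) ^ 2" "real_of_int y ^ 2 \<le> sqrt (X / 2) ^ 2"
      using xy Ks(1) by (auto intro!: power_mono)
    then show "(case z of (x, y) \<Rightarrow> Complex (real_of_int x) (real_of_int y)) \<in> nonzero_disc X"
      using xy assms zxy by (auto simp: nonzero_disc_def gauss_ints_Complex gnorm_def complex_eq_iff)
  qed
  have "card ({0..K} \<times> {0..K} - {(0, 0)}) \<le> card (nonzero_disc X)"
    by (rule card_inj_on_le[OF inj sub finite_nonzero_disc])
  moreover have "card ({0..K} \<times> {0..K} - {(0, 0)}) = nat (K + 1) * nat (K + 1) - 1"
    using K0 by (subst card_Diff_subset) (auto simp: card_cartesian_product)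
  ultimately have "real (card (nonzero_disc X)) \<ge> real (nat (K + 1) * nat (K + 1)) - 1" by linarith
  also have "real (nat (K + 1) * nat (K + 1)) = (real_of_int K + 1)^2" using K0 by (simp add: power2_eq_square)
  finally have a: "real (card (nonzero_disc X)) \<ge> (real_of_int K + 1)^2 - 1" .
  have "sqrt (X / 2) ^ 2 \<le> (real_of_int K + 1)^2" using Ks(2) assms by (intro power_mono) auto
  then have b: "real (card (nonzero_disc X)) \<ge> X / 2 - 1" using a assms by simp
  have "1 \<in> nonzero_disc X" using assms by (auto simp: nonzero_disc_def gauss_ints_closed)
  then have "card (nonzero_disc X) > 0" using finite_nonzero_disc[of X] by (auto simp: card_gt_0_iff)
  then show ?thesis using b by linarith
qed

text \<open>Dyadic shells replace partial summation: at most \<open>9 * 2^(j+1)\<close> points have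
  norm in \<open>[2^j, 2^(j+1))\<close>.\<close>

lemma dyadic_sum_le:
  fixes f :: "real \<Rightarrow> real"
  assumes "\<And>k x. x \<ge> 2^k \<Longrightarrow> f x \<le> F k" "\<And>k. F k \<ge> 0"
  shows "(\<Sum>n\<in>{n \<in> gauss_ints. n \<noteq> 0 \<and> gnorm n < 2^k}. f (gnorm n)) \<le> (\<Sum>j<k. 18 * 2^j * F j)"
proof (induction k)
  case 0
  have "{n \<in> gauss_ints. n \<noteq> 0 \<and> gnorm n < 2^0} = {}" using gnorm_ge_1 by force
  then show ?case by (metis sum.empty lessThan_0 order_refl)
next
  case (Suc k)
  define E where "E k = {n \<in> gauss_ints. n \<noteq> 0 \<and> gnorm n < 2^k}" for k :: nat
  have fin: "finite (E k)" for k
    by (rule finite_subset[OF _ finite_nonzero_disc[of "2^k"]]) (auto simp: E_def nonzero_disc_def)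
  have "sum (\<lambda>n. f (gnorm n)) (E (Suc k)) = (\<Sum>n\<in>E k. f (gnorm n)) + (\<Sum>n\<in>E (Suc k) - E k. f (gnorm n))"
  proof -
    have "E k \<subseteq> E (Suc k)" unfolding E_def by (auto intro: less_le_trans)
    then show ?thesis using sum.subset_diff[OF _ fin] by (simp add: add.commute)
  qed
  also have "(\<Sum>n\<in>E (Suc k) - E k. f (gnorm n)) \<le> (\<Sum>n\<in>E (Suc k) - E k. F k)"
    by (intro sum_mono assms(1)) (auto simp: E_def)
  also have "\<dots> \<le> 18 * 2^k * F k"
  proof -
    have "card (E (Suc k) - E k) \<le> card (nonzero_disc (2^Suc k))"
      by (intro card_mono finite_nonzero_disc) (auto simp: E_def nonzero_disc_def)
    also have "real \<dots> \<le> 9 * 2^Suc k" by (intro card_nonzero_disc_le) auto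
    finally have "real (card (E (Suc k) - E k)) * F k \<le> (9 * 2^Suc k) * F k"
      using assms(2) by (intro mult_right_mono) auto
    then show ?thesis by simp
  qed
  finally show ?case using Suc.IH unfolding E_def by simp
qed

lemma ln2_ge_half: "ln (2::real) \<ge> 1/2"
proof -
  have "exp (1/2::real)^2 = exp 1" by (simp flip: exp_of_nat_mult)
  then have "exp (1/2::real)^2 \<le> 2^2" using exp_le by simp
  then have "exp (1/2::real) \<le> 2" by (rule power2_le_imp_le) simp
  then show ?thesis using ln_ge_iff[of 2 "1/2"] by simp
qed

lemma sum_inverse_gnorm_le:
  assumes "A \<ge> 0"
  shows "(\<Sum>n\<in>nonzero_disc (exp A). 1 / gnorm n) \<le> 18 * (2 * A + 1)"
proof -
  define k where "k = nat \<lfloor>A / ln 2\<rfloor> + 1"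
  have l2: "ln (2::real) \<ge> 1/2" by (rule ln2_ge_half)
  have "A / ln 2 < real k" unfolding k_def using assms by (simp add: of_nat_nat floor_less_iff) linarith
  then have "A < ln 2 * real k" using l2 by (simp add: field_simps)
  then have "exp A < 2^k" using l2 by (metis exp_less_cancel_iff exp_ln exp_of_nat2_mult zero_less_numeral)
  then have sub: "nonzero_disc (exp A) \<subseteq> {n \<in> gauss_ints. n \<noteq> 0 \<and> gnorm n < 2^k}"
    by (auto simp: nonzero_disc_def)
  have fin: "finite {n \<in> gauss_ints. n \<noteq> 0 \<and> gnorm n < 2^k}"
    by (rule finite_subset[OF _ finite_nonzero_disc[of "2^k"]]) (auto simp: nonzero_disc_def)
  have "(\<Sum>n\<in>nonzero_disc (exp A). 1 / gnorm n) \<le> (\<Sum>n\<in>{n \<in> gauss_ints. n \<noteq> 0 \<and> gnorm n < 2^k}. 1 / gnorm n)"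
    using sub fin gnorm_nonneg by (intro sum_mono2) auto
  also have "\<dots> \<le> (\<Sum>j<k. 18 * 2^j * (1 / 2^j))"
  proof (rule dyadic_sum_le)
    fix k and x :: real assume x: "x \<ge> 2^k"
    then have "x > 0" by (rule less_le_trans[rotated]) simp
    then show "1 / x \<le> 1 / 2^k" using x by (intro divide_left_mono) auto
  qed auto
  also have "\<dots> = 18 * real k" by simp
  also have "real k \<le> A / ln 2 + 1" unfolding k_def using assms by (simp add: of_nat_nat)
  also have "A / ln 2 \<le> A / (1/2)" using l2 assms by (intro divide_left_mono) auto
  finally show ?thesis by simp
qed

lemma sum_inverse_gnorm_square_le: "(\<Sum>n\<in>nonzero_disc X. 1 / (gnorm n)^2) \<le> 36"
proof -
  obtain k where k: "X < 2^k" using real_arch_pow[of 2 X] by auto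
  have fin: "finite {n \<in> gauss_ints. n \<noteq> 0 \<and> gnorm n < 2^k}"
    by (rule finite_subset[OF _ finite_nonzero_disc[of "2^k"]]) (auto simp: nonzero_disc_def)
  have "(\<Sum>n\<in>nonzero_disc X. 1 / (gnorm n)^2) \<le> (\<Sum>n\<in>{n \<in> gauss_ints. n \<noteq> 0 \<and> gnorm n < 2^k}. 1 / (gnorm n)^2)"
    using fin k by (intro sum_mono2) (auto simp: nonzero_disc_def)
  also have "\<dots> \<le> (\<Sum>j<k. 18 * 2^j * (1 / (2^j)^2))"
  proof (rule dyadic_sum_le)
    fix k and x :: real assume x: "x \<ge> 2^k"
    then have "x > 0" by (rule less_le_trans[rotated]) simp
    then show "1 / x^2 \<le> 1 / (2^k)^2" using x by (intro divide_left_mono power_mono) auto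
  qed auto
  also have "\<dots> = 18 * (\<Sum>j<k. (1/2)^j)"
    by (simp add: sum_distrib_left power2_eq_square power_one_over field_simps)
  also have "\<dots> = 36 * (1 - (1/2)^k)" by (subst sum_gp_strict) simp
  finally show ?thesis by (smt (verit) zero_le_power divide_nonneg_nonneg)
qed

lemma ln_le_harmonic: "ln (real X + 1) \<le> (\<Sum>x = 1..X. 1 / real x)"
proof (induction X)
  case (Suc X)
  have "ln (real (Suc X) + 1) - ln (real X + 1) = ln ((real X + 2) / (real X + 1))"
    by (subst ln_div) auto
  also have "(real X + 2) / (real X + 1) = 1 + 1 / (real X + 1)" by (simp add: field_simps)
  also have "ln \<dots> \<le> 1 / (real X + 1)" by (rule ln_add_one_self_le_self) auto
  finally show ?case using Suc by (simp add: add.commute)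
qed auto

text \<open>Only the points with \<open>1 <= Im <= Re\<close> are kept. The column with real part
  \<open>x\<close> has \<open>x\<close> of them, of norm at most \<open>2 * x^2\<close>, so it
  contributes at least \<open>1 / (2 * x)\<close>, and half a harmonic sum remains.\<close>

lemma sum_inverse_gnorm_ge:
  assumes "D > 0"
  shows "(\<Sum>n\<in>nonzero_disc D. 1 / gnorm n) \<ge> ln (D / 2) / 4"
proof -
  define X where "X = nat \<lfloor>sqrt (D / 2)\<rfloor>"
  have X: "real X \<le> sqrt (D / 2)" "sqrt (D / 2) \<le> real X + 1" unfolding X_def using assms by auto
  define f where "f = (\<lambda>(x, y). Complex (real x) (real y))"
  have inj: "inj_on f (SIGMA x:{1..X}. {1..x})" unfolding f_def by (auto simp: inj_on_def)
  have g: "gnorm (f (x, y)) \<le> 2 * (real x)^2" if "y \<le> x" for x y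
    using that unfolding f_def gnorm_def by (simp add: power_mono)
  have sub: "f ` (SIGMA x:{1..X}. {1..x}) \<subseteq> nonzero_disc D"
  proof clarify
    fix x y assume xy: "x \<in> {1..X}" "y \<in> {1..x}"
    have "(real x)^2 \<le> (sqrt (D / 2))^2" using xy X(1) by (intro power_mono) auto
    then have "gnorm (f (x, y)) \<le> D" using g[of y x] xy assms by auto
    moreover have "f (x, y) \<in> gauss_ints" "f (x, y) \<noteq> 0"
      using xy by (auto simp: f_def gauss_ints_def complex_eq_iff)
    ultimately show "f (x, y) \<in> nonzero_disc D" unfolding nonzero_disc_def by auto
  qed
  have "ln (D / 2) / 4 = ln (sqrt (D / 2)) / 2" using assms by (simp add: ln_sqrt)
  also have "\<dots> \<le> ln (real X + 1) / 2" using X(2) assms by (simp add: real_sqrt_gt_0_iff)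
  also have "\<dots> \<le> (\<Sum>x = 1..X. 1 / real x) / 2" using ln_le_harmonic[of X] by simp
  also have "\<dots> = (\<Sum>x = 1..X. \<Sum>y = 1..x. 1 / (2 * (real x)^2))"
    by (auto simp: sum_divide_distrib power2_eq_square intro!: sum.cong)
  also have "\<dots> \<le> (\<Sum>x = 1..X. \<Sum>y = 1..x. 1 / gnorm (f (x, y)))"
    by (intro sum_mono divide_left_mono g mult_pos_pos gnorm_pos) (auto simp: f_def complex_eq_iff)
  also have "\<dots> = (\<Sum>z\<in>(SIGMA x:{1..X}. {1..x}). 1 / gnorm (f z))"
    by (subst sum.Sigma) auto
  also have "\<dots> = (\<Sum>n\<in>f ` (SIGMA x:{1..X}. {1..x}). 1 / gnorm n)"
    using inj by (simp add: sum.reindex)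
  also have "\<dots> \<le> (\<Sum>n\<in>nonzero_disc D. 1 / gnorm n)"
    using sub gnorm_nonneg finite_nonzero_disc by (intro sum_mono2) auto
  finally show ?thesis .
qed

section \<open>Chebyshev and Mertens type estimates for primes\<close>

lemma finite_prime_reps_le: "finite {p \<in> prime_reps. gnorm p \<le> y}"
  by (rule finite_subset[OF _ finite_gnorm_le[of y]]) (auto simp: prime_reps_gauss)

lemma finite_prime_reps_gdvd:
  assumes "n \<noteq> 0"
  shows "finite {p \<in> prime_reps. gdvd p n}"
  by (rule finite_subset[OF _ finite_prime_reps_le[of "gnorm n"]]) (auto simp: gdvd_imp_gnorm_le assms)

lemma sum_ln_prime_divisors_le:
  assumes "n \<in> gauss_ints" "n \<noteq> 0" "S \<subseteq> {p \<in> prime_reps. gdvd p n}"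
  shows "(\<Sum>p\<in>S. ln (gnorm p)) \<le> ln (gnorm n)"
proof -
  have fin: "finite S" using assms finite_prime_reps_gdvd finite_subset by blast
  have pos: "gnorm p > 0" if "p \<in> S" for p using that assms(3) prime_reps_ge_2[of p] by force
  have "(\<Sum>p\<in>S. ln (gnorm p)) = ln (gnorm (\<Prod>S))"
    unfolding gnorm_prod using ln_prod[of S gnorm] fin pos by (metis less_numeral_extra(3))
  also have "\<dots> \<le> ln (gnorm n)"
  proof -
    have "gdvd (\<Prod>S) n" using assms fin by (intro prod_prime_reps_gdvd) auto
    then have "gnorm (\<Prod>S) \<le> gnorm n" using gdvd_imp_gnorm_le assms(2) by blast
    moreover have "gnorm (\<Prod>S) > 0" unfolding gnorm_prod using pos by (intro prod_pos) auto
    ultimately show ?thesis by simp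
  qed
  finally show ?thesis .
qed

text \<open>Pairs with \<open>gdvd p n\<close> and \<open>gnorm n <= y\<close> are counted twice
  with weight \<open>ln (gnorm p)\<close>: each \<open>p\<close> has at least
  \<open>y / (4 * gnorm p)\<close> multiples, while the distinct primes dividing one
  \<open>n\<close> contribute at most \<open>ln y\<close>. There are at most \<open>9 * y\<close>
  such \<open>n\<close>, whence \<open>36 = 4 * 9\<close>.\<close>

lemma sum_ln_gnorm_div_le:
  assumes "y \<ge> 1"
  shows "(\<Sum>p\<in>{p \<in> prime_reps. gnorm p \<le> y}. ln (gnorm p) / gnorm p) \<le> 36 * ln y"
proof -
  define P where "P = {p \<in> prime_reps. gnorm p \<le> y}"
  have fP: "finite P" unfolding P_def by (rule finite_prime_reps_le)
  have cnt: "real (card {n \<in> nonzero_disc y. gdvd p n}) \<ge> y / (4 * gnorm p)" if p: "p \<in> P" for p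
  proof -
    have p': "p \<in> gauss_ints" "p \<noteq> 0" "gnorm p > 0" "gnorm p \<le> y"
      using p gprimeD[OF prime_repsD] gnorm_pos unfolding P_def by auto
    have "inj_on (\<lambda>m. p * m) (nonzero_disc (y / gnorm p))" using p' by (auto simp: inj_on_def)
    moreover have "(\<lambda>m. p * m) ` nonzero_disc (y / gnorm p) \<subseteq> {n \<in> nonzero_disc y. gdvd p n}"
      using p' by (auto simp: nonzero_disc_def gnorm_mult field_simps gauss_ints_mult gdvd_def)
    ultimately have "card (nonzero_disc (y / gnorm p)) \<le> card {n \<in> nonzero_disc y. gdvd p n}"
      by (rule card_inj_on_le) (simp add: finite_nonzero_disc)
    moreover have "real (card (nonzero_disc (y / gnorm p))) \<ge> (y / gnorm p) / 4"
      using p' by (intro card_nonzero_disc_ge) (auto simp: field_simps)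
    ultimately show ?thesis by (simp add: field_simps)
  qed
  have lnpos: "ln (gnorm p) \<ge> 0" if "p \<in> P" for p using that prime_reps_ge_2[of p] by (auto simp: P_def)
  have "y / 4 * (\<Sum>p\<in>P. ln (gnorm p) / gnorm p) = (\<Sum>p\<in>P. ln (gnorm p) * (y / (4 * gnorm p)))"
    by (simp add: sum_distrib_left field_simps)
  also have "\<dots> \<le> (\<Sum>p\<in>P. ln (gnorm p) * real (card {n \<in> nonzero_disc y. gdvd p n}))"
    using cnt lnpos by (intro sum_mono mult_left_mono) auto
  also have "\<dots> = (\<Sum>p\<in>P. \<Sum>n\<in>nonzero_disc y. if gdvd p n then ln (gnorm p) else 0)"
    by (simp add: sum.inter_filter[symmetric] finite_nonzero_disc mult.commute)
  also have "\<dots> = (\<Sum>n\<in>nonzero_disc y. \<Sum>p\<in>P. if gdvd p n then ln (gnorm p) else 0)"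
    by (rule sum.swap)
  also have "\<dots> = (\<Sum>n\<in>nonzero_disc y. \<Sum>p\<in>{p \<in> P. gdvd p n}. ln (gnorm p))"
    by (simp add: sum.inter_filter[symmetric] fP)
  also have "\<dots> \<le> (\<Sum>n\<in>nonzero_disc y. ln y)"
  proof (rule sum_mono)
    fix n assume "n \<in> nonzero_disc y"
    then have n: "n \<in> gauss_ints" "n \<noteq> 0" "gnorm n \<le> y" by (auto simp: nonzero_disc_def)
    have "(\<Sum>p\<in>{p \<in> P. gdvd p n}. ln (gnorm p)) \<le> ln (gnorm n)"
      using n by (intro sum_ln_prime_divisors_le) (auto simp: P_def)
    also have "\<dots> \<le> ln y" using n gnorm_pos[OF n(2)] by simp
    finally show "(\<Sum>p\<in>{p \<in> P. gdvd p n}. ln (gnorm p)) \<le> ln y" .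
  qed
  also have "\<dots> \<le> 9 * y * ln y"
    using card_nonzero_disc_le[of y] assms by (simp add: mult_right_mono)
  finally have "y / 4 * (\<Sum>p\<in>P. ln (gnorm p) / gnorm p) \<le> y / 4 * (36 * ln y)" by simp
  then show ?thesis using assms unfolding P_def by (simp add: mult_le_cancel_left)
qed

text \<open>Markov's inequality: in the expansion of the product over subsets \<open>S\<close>, the average of \<open>ln N(\<Prod>S)\<close>
  is at most \<open>A\<close>, so the subsets with \<open>N(\<Prod>S) \<le> exp (2A)\<close> carry at least half of the total.\<close>
lemma prod_one_plus_inverse_gnorm_le:
  assumes P: "finite P" "P \<subseteq> prime_reps" and A: "A > 0" "(\<Sum>p\<in>P. ln (gnorm p) / gnorm p) \<le> A"
  shows "(\<Prod>p\<in>P. 1 + 1 / gnorm p) \<le> 36 * (4 * A + 1)"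
proof -
  define w where "w S = (\<Prod>p\<in>S. 1 / gnorm p)" for S
  define l where "l S = (\<Sum>p\<in>S. ln (gnorm p))" for S
  define T where "T = sum w (Pow P)"
  have ge2: "gnorm p \<ge> 2" if "p \<in> P" for p using that P(2) prime_reps_ge_2 by blast
  have w0: "w S \<ge> 0" for S unfolding w_def using gnorm_nonneg by (intro prod_nonneg) auto
  have l0: "l S \<ge> 0" if "S \<in> Pow P" for S unfolding l_def using that ge2 by (intro sum_nonneg) force
  have T: "(\<Prod>p\<in>P. 1 + 1 / gnorm p) = T"
    unfolding T_def w_def using prod_add[OF P(1), of "\<lambda>p. 1 / gnorm p" "\<lambda>_. 1"] by (simp add: add.commute)
  have mom: "(\<Sum>S\<in>Pow P. w S * l S) \<le> A * T"
  proof -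
    have "(\<Sum>S\<in>Pow P. w S * l S) = (\<Sum>S\<in>Pow P. \<Sum>p\<in>P. if p \<in> S then w S * ln (gnorm p) else 0)"
    proof (rule sum.cong)
      fix S assume S: "S \<in> Pow P"
      have "{p \<in> P. p \<in> S} = S" using S by auto
      then show "w S * l S = (\<Sum>p\<in>P. if p \<in> S then w S * ln (gnorm p) else 0)"
        unfolding l_def using P(1) by (simp add: sum.inter_filter[symmetric] sum_distrib_left)
    qed simp
    also have "\<dots> = (\<Sum>p\<in>P. \<Sum>S\<in>Pow P. if p \<in> S then w S * ln (gnorm p) else 0)" by (rule sum.swap)
    also have "\<dots> = (\<Sum>p\<in>P. \<Sum>S\<in>{S \<in> Pow P. p \<in> S}. w S * ln (gnorm p))"
      using P(1) by (simp only: sum.inter_filter finite_Pow_iff)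
    also have "\<dots> \<le> (\<Sum>p\<in>P. ln (gnorm p) / gnorm p * T)"
    proof (rule sum_mono)
      fix p assume p: "p \<in> P"
      \<comment> \<open>Deleting \<open>p\<close> from \<open>S\<close> takes out the factor
        \<open>1 / gnorm p\<close>; the sets that remain are distinct subsets of \<open>P\<close>,
        so their weights add up to at most \<open>T\<close>.\<close>
      have inj: "inj_on (\<lambda>S. S - {p}) {S \<in> Pow P. p \<in> S}" by (auto simp: inj_on_def)
      have "(\<Sum>S\<in>{S \<in> Pow P. p \<in> S}. w S * ln (gnorm p)) =
        (\<Sum>S\<in>{S \<in> Pow P. p \<in> S}. ln (gnorm p) / gnorm p * w (S - {p}))"
      proof (rule sum.cong)
        fix S assume "S \<in> {S \<in> Pow P. p \<in> S}"
        then have "finite S" "p \<in> S" using P(1) finite_subset by auto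
        then have "w S = 1 / gnorm p * w (S - {p})" unfolding w_def by (simp add: prod.remove)
        then show "w S * ln (gnorm p) = ln (gnorm p) / gnorm p * w (S - {p})" by simp
      qed simp
      also have "\<dots> = ln (gnorm p) / gnorm p * (\<Sum>S\<in>(\<lambda>S. S - {p}) ` {S \<in> Pow P. p \<in> S}. w S)"
        using inj by (simp add: sum.reindex sum_distrib_left)
      also have "\<dots> \<le> ln (gnorm p) / gnorm p * T"
        unfolding T_def using P(1) ge2[OF p] w0 by (intro mult_left_mono sum_mono2) auto
      finally show "(\<Sum>S\<in>{S \<in> Pow P. p \<in> S}. w S * ln (gnorm p)) \<le> ln (gnorm p) / gnorm p * T" .
    qed
    also have "\<dots> = (\<Sum>p\<in>P. ln (gnorm p) / gnorm p) * T" by (simp add: sum_distrib_right)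
    also have "\<dots> \<le> A * T" using A(2) w0 unfolding T_def by (intro mult_right_mono sum_nonneg) auto
    finally show ?thesis .
  qed
  define B where "B = {S \<in> Pow P. l S \<le> 2 * A}"
  have fB: "finite B" unfolding B_def using P(1) by auto
  have "2 * A * sum w (Pow P - B) = (\<Sum>S\<in>Pow P - B. w S * (2 * A))"
    by (simp add: sum_distrib_left mult.commute)
  also have "\<dots> \<le> (\<Sum>S\<in>Pow P - B. w S * l S)"
    using w0 unfolding B_def by (intro sum_mono mult_left_mono) auto
  also have "\<dots> \<le> (\<Sum>S\<in>Pow P. w S * l S)"
    using P(1) w0 l0 by (intro sum_mono2) auto
  also note mom
  finally have "2 * sum w (Pow P - B) \<le> T" using A(1) by (simp add: mult.assoc mult.left_commute)
  moreover have "T = sum w (Pow P - B) + sum w B"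
    unfolding T_def using P(1) by (intro sum.subset_diff) (auto simp: B_def)
  ultimately have "T \<le> 2 * sum w B" by simp
  also have "sum w B \<le> (\<Sum>n\<in>nonzero_disc (exp (2 * A)). 1 / gnorm n)"
  proof -
    have inj: "inj_on (\<lambda>S. \<Prod>S) B"
      by (rule inj_on_subset[OF prod_prime_reps_inj]) (use P finite_subset in \<open>auto simp: B_def\<close>)
    have "sum w B = (\<Sum>S\<in>B. 1 / gnorm (\<Prod>S))"
      unfolding w_def gnorm_prod by (simp add: prod_dividef)
    also have "\<dots> = (\<Sum>n\<in>(\<lambda>S. \<Prod>S) ` B. 1 / gnorm n)" using inj by (simp add: sum.reindex)
    also have "\<dots> \<le> (\<Sum>n\<in>nonzero_disc (exp (2 * A)). 1 / gnorm n)"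
    proof (rule sum_mono2[OF finite_nonzero_disc])
      show "(\<lambda>S. \<Prod>S) ` B \<subseteq> nonzero_disc (exp (2 * A))"
      proof clarify
        fix S assume S: "S \<in> B"
        then have S': "S \<subseteq> P" "finite S" "l S \<le> 2 * A" using P(1) finite_subset by (auto simp: B_def)
        have pos: "gnorm p > 0" if "p \<in> S" for p using ge2[of p] that S' by force
        then have gpos: "gnorm (\<Prod>S) > 0" unfolding gnorm_prod by (intro prod_pos) auto
        have "l S = ln (gnorm (\<Prod>S))"
          unfolding l_def gnorm_prod using ln_prod[of S gnorm] S' pos by (metis less_numeral_extra(3))
        then have "gnorm (\<Prod>S) \<le> exp (2 * A)" using S' gpos by (metis exp_le_cancel_iff exp_ln)
        moreover have "\<Prod>S \<in> gauss_ints" using S' P prime_reps_gauss by (intro gauss_ints_prod) auto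
        moreover have "\<Prod>S \<noteq> 0" using gpos gnorm_0_iff less_irrefl by metis
        ultimately show "\<Prod>S \<in> nonzero_disc (exp (2 * A))" by (simp add: nonzero_disc_def)
      qed
    qed (use gnorm_nonneg in auto)
    finally show ?thesis .
  qed
  also have "\<dots> \<le> 18 * (2 * (2 * A) + 1)" using A(1) by (intro sum_inverse_gnorm_le) auto
  finally show ?thesis unfolding T by simp
qed

lemma ln_ln_ge_half:
  assumes "Y \<ge> (16::real)"
  shows "ln Y \<ge> 2" "ln (ln Y) \<ge> 1/2"
proof -
  have "ln (16::real) = 4 * ln 2" using ln_realpow[of 2 4] by simp
  then have "ln (16::real) \<ge> 2" using ln2_ge_half by simp
  then show L: "ln Y \<ge> 2" using assms ln_le_cancel_iff[of 16 Y] by linarith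
  then have "ln (ln Y) \<ge> ln 2" by simp
  then show "ln (ln Y) \<ge> 1/2" using ln2_ge_half by linarith
qed

text \<open>The product takes the place of \<open>N(q) / \<phi>(q)\<close>. With
  \<open>L = ln Y\<close>, primes of norm at most \<open>L^2\<close> are estimated as if all of them
  divided \<open>q\<close>. There are at most \<open>4 * L\<close> larger ones, and each contributes
  at most \<open>2 / L\<close> to the logarithmic sum, which is therefore
  \<open>O(ln L)\<close>.\<close>

lemma prod_prime_divisors_le:
  assumes q: "q \<in> gauss_ints" "q \<noteq> 0" "gnorm q \<le> Y^2" and Y: "Y \<ge> 16"
  shows "(\<Prod>p\<in>{p \<in> prime_reps. gdvd p q}. 1 + 1 / gnorm p) \<le> 13000 * ln (ln Y)"
proof -
  define P where "P = {p \<in> prime_reps. gdvd p q}"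
  have fP: "finite P" unfolding P_def using finite_prime_reps_gdvd q by blast
  define L where "L = ln Y"
  have L: "L \<ge> 2" and lnL: "ln L \<ge> 1/2" using ln_ln_ge_half[OF Y] unfolding L_def by auto
  have "(\<Sum>p\<in>P. ln (gnorm p)) \<le> ln (gnorm q)" using q by (intro sum_ln_prime_divisors_le) (auto simp: P_def)
  also have "\<dots> \<le> ln (Y^2)" using q gnorm_pos by (subst ln_le_cancel_iff) (use Y in auto)
  also have "\<dots> = 2 * L" unfolding L_def using Y by (simp add: ln_realpow)
  finally have lnq: "(\<Sum>p\<in>P. ln (gnorm p)) \<le> 2 * L" .
  have ln2: "ln (gnorm p) \<ge> 1/2" if "p \<in> P" for p
  proof -
    have "gnorm p \<ge> 2" using prime_reps_ge_2 that unfolding P_def by blast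
    then have "ln 2 \<le> ln (gnorm p)" by simp
    then show ?thesis using ln2_ge_half by linarith
  qed
  have "(\<Sum>p\<in>P. 1/2) \<le> (\<Sum>p\<in>P. ln (gnorm p))" using ln2 by (intro sum_mono)
  then have card: "real (card P) \<le> 4 * L" using lnq by simp
  have split: "(\<Sum>p\<in>P. ln (gnorm p) / gnorm p) = (\<Sum>p\<in>{p \<in> P. gnorm p \<le> L^2}. ln (gnorm p) / gnorm p)
      + (\<Sum>p\<in>{p \<in> P. \<not> gnorm p \<le> L^2}. ln (gnorm p) / gnorm p)"
    using fP by (subst sum.union_disjoint[symmetric]) (auto intro!: sum.cong)
  have s1: "(\<Sum>p\<in>{p \<in> P. gnorm p \<le> L^2}. ln (gnorm p) / gnorm p) \<le> 72 * ln L"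
  proof -
    have "(\<Sum>p\<in>{p \<in> P. gnorm p \<le> L^2}. ln (gnorm p) / gnorm p) \<le> (\<Sum>p\<in>{p \<in> prime_reps. gnorm p \<le> L^2}. ln (gnorm p) / gnorm p)"
      using finite_prime_reps_le prime_reps_ge_2 by (intro sum_mono2) (force simp: P_def intro!: divide_nonneg_nonneg ln_ge_zero gnorm_nonneg)+
    also have "\<dots> \<le> 36 * ln (L^2)" using L by (intro sum_ln_gnorm_div_le) auto
    also have "\<dots> = 72 * ln L" using L by (simp add: ln_realpow)
    finally show ?thesis .
  qed
  have s2: "(\<Sum>p\<in>{p \<in> P. \<not> gnorm p \<le> L^2}. ln (gnorm p) / gnorm p) \<le> 8"
  proof -
    have "(\<Sum>p\<in>{p \<in> P. \<not> gnorm p \<le> L^2}. ln (gnorm p) / gnorm p) \<le> (\<Sum>p\<in>{p \<in> P. \<not> gnorm p \<le> L^2}. 2 / L)"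
    proof (rule sum_mono)
      fix p assume p: "p \<in> {p \<in> P. \<not> gnorm p \<le> L^2}"
      define r where "r = sqrt (gnorm p)"
      have r: "gnorm p = r^2" "r \<ge> L"
        using p L gnorm_nonneg[of p] real_le_rsqrt[of L "gnorm p"] unfolding r_def by auto
      have "ln r \<le> r" using ln_bound[of r] r L by auto
      then have "ln (gnorm p) \<le> 2 * r" unfolding r(1) using r L by (simp add: ln_realpow)
      then have "ln (gnorm p) / gnorm p \<le> (2 * r) / r^2" unfolding r(1) using r L by (intro divide_right_mono) auto
      also have "\<dots> = 2 / r" using r L by (simp add: power2_eq_square)
      also have "\<dots> \<le> 2 / L" using r L by (intro divide_left_mono) auto
      finally show "ln (gnorm p) / gnorm p \<le> 2 / L" .
    qed
    also have "\<dots> = real (card {p \<in> P. \<not> gnorm p \<le> L^2}) * (2 / L)" by simp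
    also have "\<dots> \<le> (4 * L) * (2 / L)"
    proof (intro mult_right_mono)
      have "card {p \<in> P. \<not> gnorm p \<le> L^2} \<le> card P" using fP by (intro card_mono) auto
      then show "real (card {p \<in> P. \<not> gnorm p \<le> L^2}) \<le> 4 * L" using card by linarith
    qed (use L in auto)
    finally show ?thesis using L by simp
  qed
  \<comment> \<open>\<open>72 * ln L + 8 <= 88 * ln L\<close>, because
    \<open>ln L >= 1/2\<close>.\<close>
  have "(\<Prod>p\<in>P. 1 + 1 / gnorm p) \<le> 36 * (4 * (88 * ln L) + 1)"
    using fP lnL split s1 s2 by (intro prod_one_plus_inverse_gnorm_le) (auto simp: P_def)
  also have "\<dots> \<le> 13000 * ln L" using lnL by simp
  finally show ?thesis unfolding P_def L_def .
qed

section \<open>The large sieve\<close>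

lemma ee_cis: "ee x = cis (2 * pi * x)"
  unfolding ee_def cis_conv_exp by (simp add: mult_ac)

lemma ee_add: "ee (x + y) = ee x * ee y"
  by (simp add: ee_cis cis_mult distrib_left)

lemma ee_0 [simp]: "ee 0 = 1"
  by (simp add: ee_cis)

lemma norm_ee [simp]: "cmod (ee x) = 1"
  by (simp add: ee_cis)

lemma cnj_ee: "cnj (ee x) = ee (- x)"
  by (simp add: ee_cis cis_cnj)

lemma ee_int: "k \<in> \<int> \<Longrightarrow> ee k = 1"
  by (simp add: ee_cis cis_multiple_2pi)

lemma ee_nat_mult: "ee (real h * u) = ee u ^ h"
  by (simp add: ee_cis DeMoivre mult_ac)

lemma ee_sum: "finite S \<Longrightarrow> ee (sum f S) = (\<Prod>x\<in>S. ee (f x))"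
  by (induction S rule: finite_induct) (auto simp: ee_add)

lemma gauss_ints_Re_Im: "z \<in> gauss_ints \<Longrightarrow> Re z \<in> \<int>" "z \<in> gauss_ints \<Longrightarrow> Im z \<in> \<int>"
  by (auto simp: gauss_ints_def)

lemma ee_Re_gauss: "z \<in> gauss_ints \<Longrightarrow> ee (Re z) = 1"
  by (simp add: ee_int gauss_ints_Re_Im)

text \<open>The chord has length \<open>2 * sin (pi * |u|)\<close>, and the cubic Maclaurin bound
  gives \<open>sin x >= x / 3\<close> on \<open>[0, 2]\<close>.\<close>

lemma norm_ee_minus_1_ge:
  assumes "\<bar>u\<bar> \<le> 1/2"
  shows "cmod (ee u - 1) \<ge> \<bar>u\<bar>"
proof -
  define x where "x = pi * \<bar>u\<bar>"
  have "pi * \<bar>u\<bar> \<le> pi * (1/2)" using assms by (intro mult_left_mono) auto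
  then have "x \<le> 2" unfolding x_def using pi_half_less_two by linarith
  moreover have "0 \<le> x" unfolding x_def by simp
  ultimately have x: "0 \<le> x" "x \<le> 2" by auto
  have "\<bar>sin x - x\<bar> \<le> x^3 / 6"
    using Maclaurin_sin_bound[of x 3] x(1) by (simp add: eval_nat_numeral sin_coeff_def)
  also have "x^3 \<le> 4 * x"
    using x mult_mono[of x 2 x 2] mult_right_mono[of "x * x" 4 x] by (simp add: power3_eq_cube)
  finally have s: "sin x \<ge> x / 3" by linarith
  have "(cmod (ee u - 1))^2 = (2 * sin x)^2"
  proof -
    have "(cmod (ee u - 1))^2 = 2 - 2 * cos (2 * (pi * u))"
      using sin_cos_squared_add[of "2 * pi * u"]
      by (simp add: ee_cis cmod_power2 power2_diff algebra_simps)
    also have "\<dots> = (2 * sin (pi * u))^2" by (subst cos_double_sin) (simp add: power_mult_distrib)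
    also have "\<dots> = (2 * sin x)^2" unfolding x_def by (cases "u \<ge> 0") (auto simp: power_mult_distrib)
    finally show ?thesis .
  qed
  then have "cmod (ee u - 1) = 2 * sin x" by (rule power2_eq_imp_eq) (use s x in auto)
  moreover have "\<bar>u\<bar> * 2 \<le> x" unfolding x_def using pi_ge_two mult_right_mono[of 2 pi "\<bar>u\<bar>"] by (simp add: mult.commute)
  ultimately show ?thesis using s by linarith
qed

definition dirichlet_kernel_sq :: "nat \<Rightarrow> real \<Rightarrow> real" where
  "dirichlet_kernel_sq H u = (cmod (\<Sum>h<H. ee (real h * u)))^2"

lemma dirichlet_kernel_sq_diff_int:
  assumes "k \<in> \<int>"
  shows "dirichlet_kernel_sq H (u - k) = dirichlet_kernel_sq H u"
proof -
  have "ee (real h * (u - k)) = ee (real h * u)" for h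
  proof -
    have "real h * (u - k) = real h * u + (- (real h * k))" by (simp add: algebra_simps)
    moreover have "ee (- (real h * k)) = 1" using assms by (intro ee_int) auto
    ultimately show ?thesis by (simp only: ee_add) simp
  qed
  then show ?thesis unfolding dirichlet_kernel_sq_def by simp
qed

lemma dirichlet_kernel_sq_uminus: "dirichlet_kernel_sq H (- u) = dirichlet_kernel_sq H u"
proof -
  have "(\<Sum>h<H. ee (real h * (- u))) = cnj (\<Sum>h<H. ee (real h * u))" by (simp add: cnj_ee)
  then show ?thesis unfolding dirichlet_kernel_sq_def by (metis complex_mod_cnj)
qed

text \<open>The geometric series gives \<open>|S| * |u| <= 2\<close> and the trivial bound is
  \<open>|S| <= H\<close>. The floor makes the majorant constant on intervals of length
  \<open>1 / H\<close>, as is needed for counting points cell by cell; it costs a factor 3 on top of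
  the constant 5.\<close>

lemma dirichlet_kernel_sq_le:
  assumes "\<bar>u\<bar> \<le> 1/2" "H \<ge> 1"
  shows "dirichlet_kernel_sq H u \<le> 15 * real H ^ 2 / (1 + (real_of_int \<lfloor>real H * u\<rfloor>)^2)"
proof -
  define S where "S = (\<Sum>h<H. ee (real h * u))"
  have "cmod S \<le> (\<Sum>h<H. cmod (ee (real h * u)))" unfolding S_def by (rule norm_sum)
  then have S1: "cmod S \<le> real H" by simp
  have "S * (ee u - 1) = ee u ^ H - 1"
    unfolding S_def ee_nat_mult by (simp add: power_diff_1_eq mult.commute)
  then have "cmod S * cmod (ee u - 1) = cmod (ee u ^ H - 1)" by (simp flip: norm_mult)
  also have "\<dots> \<le> 2" using norm_triangle_ineq4[of "ee u ^ H" 1] by (simp add: norm_power)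
  finally have "cmod S * cmod (ee u - 1) \<le> 2" .
  then have "cmod S * \<bar>u\<bar> \<le> 2"
    using mult_left_mono[OF norm_ee_minus_1_ge[OF assms(1)], of "cmod S"] by simp
  then have "(cmod S * \<bar>u\<bar>)^2 \<le> 2^2" by (intro power_mono) auto
  then have a: "(cmod S)^2 * u^2 \<le> 4" by (simp add: power_mult_distrib)
  have b: "(cmod S)^2 \<le> real H ^ 2" using S1 by (intro power_mono) auto
  define t where "t = real H * u"
  have "(cmod S)^2 * (1 + t^2) = (cmod S)^2 + real H ^ 2 * ((cmod S)^2 * u^2)"
    unfolding t_def by (simp add: power_mult_distrib algebra_simps)
  also have "\<dots> \<le> real H ^ 2 + real H ^ 2 * 4" using a b by (intro add_mono mult_left_mono) auto
  finally have c: "(cmod S)^2 * (1 + t^2) \<le> 5 * real H ^ 2" by simp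
  have fl: "1 + (real_of_int \<lfloor>t\<rfloor>)^2 \<le> 3 * (1 + t^2)"
  proof -
    define f where "f = real_of_int \<lfloor>t\<rfloor>"
    have "\<bar>f\<bar> \<le> \<bar>t\<bar> + 1" unfolding f_def by linarith
    then have "\<bar>f\<bar>^2 \<le> (\<bar>t\<bar> + 1)^2" by (intro power_mono) auto
    also have "\<dots> \<le> 2 * t^2 + 2" using zero_le_power2[of "\<bar>t\<bar> - 1"] by (simp add: power2_eq_square algebra_simps)
    finally have "f^2 \<le> 2 * t^2 + 2" by simp
    moreover have "t^2 \<ge> 0" by simp
    ultimately have "1 + f^2 \<le> 3 + 3 * t^2" by linarith
    also have "3 + 3 * t^2 = 3 * (1 + t^2)" by simp
    finally have "1 + f^2 \<le> 3 * (1 + t^2)" .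
    then show ?thesis unfolding f_def .
  qed
  have "(cmod S)^2 * (1 + (real_of_int \<lfloor>t\<rfloor>)^2) \<le> (cmod S)^2 * (3 * (1 + t^2))"
    using fl by (intro mult_left_mono) auto
  also have "\<dots> = 3 * ((cmod S)^2 * (1 + t^2))" by (rule mult.left_commute)
  also have "\<dots> \<le> 15 * real H ^ 2" using c by linarith
  finally have "(cmod S)^2 * (1 + (real_of_int \<lfloor>t\<rfloor>)^2) \<le> 15 * real H ^ 2" .
  moreover have "1 + (real_of_int \<lfloor>t\<rfloor>)^2 > 0" by (simp add: add_pos_nonneg)
  ultimately show ?thesis unfolding dirichlet_kernel_sq_def S_def[symmetric] t_def[symmetric]
    by (simp add: pos_le_divide_eq)
qed

lemma sum_inverse_squares_le: "(\<Sum>i = -int L..int L. 1 / (1 + (real_of_int i)^2)) \<le> 5"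
proof -
  \<comment> \<open>The induction needs a telescoping bound, sharp at \<open>L = 0\<close>: the two
    new terms add up to at most \<open>8 / ((2 * L + 1) * (2 * L + 3))\<close>, which is
    \<open>4 / (2 * L + 1) - 4 / (2 * L + 3)\<close>.\<close>
  have "(\<Sum>i = -int L..int L. 1 / (1 + (real_of_int i)^2)) \<le> 5 - 4 / (2 * real L + 1)"
  proof (induction L)
    case (Suc L)
    have "{-int (Suc L)..int (Suc L)} = {-int L..int L} \<union> {-int (Suc L), int (Suc L)}" by auto
    then have "(\<Sum>i = -int (Suc L)..int (Suc L). 1 / (1 + (real_of_int i)^2)) =
      (\<Sum>i = -int L..int L. 1 / (1 + (real_of_int i)^2)) + 2 / (1 + (real L + 1)^2)"
      by (simp add: sum.union_disjoint power2_eq_square algebra_simps)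
    also have "\<dots> \<le> 5 - 4 / (2 * real L + 1) + 2 / (1 + (real L + 1)^2)" using Suc by simp
    also have "2 / (1 + (real L + 1)^2) = 8 / (4 * (1 + (real L + 1)^2))"
    proof -
      have "2 / X = 8 / (4 * X)" for X :: real by simp
      then show ?thesis .
    qed
    also have "\<dots> \<le> 8 / ((2 * real L + 1) * (2 * real L + 3))"
      by (intro divide_left_mono mult_pos_pos) (auto simp: power2_eq_square algebra_simps add_pos_nonneg)
    also have "5 - 4 / (2 * real L + 1) + 8 / ((2 * real L + 1) * (2 * real L + 3)) = 5 - 4 / (2 * real L + 3)"
      by (simp add: divide_simps) (simp add: algebra_simps)
    finally show ?case by (simp add: algebra_simps)
  qed auto
  moreover have "4 / (2 * real L + 1) \<ge> 0" by simp
  ultimately show ?thesis by linarith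
qed

text \<open>The differences, reduced modulo Gaussian integers into the unit square about 0, are
  sorted into cells of side \<open>1 / H\<close>. By \<open>count\<close> a cell holds at most
  \<open>K\<close> points, and the weights that bound the kernels on the cells have double sum at
  most 25; \<open>5625 = 15^2 * 25\<close>.\<close>

lemma sum_kernel_le:
  assumes J: "finite J" and H: "H \<ge> 1"
    and count: "\<And>\<beta>. real (card {j \<in> J. \<exists>g\<in>gauss_ints. cmod (\<alpha> j - \<beta> - g) \<le> 1 / real H}) \<le> K"
  shows "(\<Sum>k\<in>J. dirichlet_kernel_sq H (Re (\<gamma> - \<alpha> k)) * dirichlet_kernel_sq H (Im (\<gamma> - \<alpha> k))) \<le> 5625 * K * real H ^ 4"
proof -
  have "\<exists>g. g \<in> gauss_ints \<and> \<bar>Re (\<gamma> - \<alpha> k - g)\<bar> \<le> 1/2 \<and> \<bar>Im (\<gamma> - \<alpha> k - g)\<bar> \<le> 1/2" for k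
    using gauss_int_approx by metis
  then obtain g where g: "\<And>k. g k \<in> gauss_ints" "\<And>k. \<bar>Re (\<gamma> - \<alpha> k - g k)\<bar> \<le> 1/2"
    "\<And>k. \<bar>Im (\<gamma> - \<alpha> k - g k)\<bar> \<le> 1/2" by metis
  define c where "c k = (\<lfloor>real H * Re (\<gamma> - \<alpha> k - g k)\<rfloor>, \<lfloor>real H * Im (\<gamma> - \<alpha> k - g k)\<rfloor>)" for k
  define w :: "int \<Rightarrow> real" where "w i = 1 / (1 + (real_of_int i)^2)" for i
  have w0: "w i \<ge> 0" for i unfolding w_def by simp
  have K0: "K \<ge> 0" using count[of 0] by (meson of_nat_0_le_iff order_trans)
  have term_le: "dirichlet_kernel_sq H (Re (\<gamma> - \<alpha> k)) * dirichlet_kernel_sq H (Im (\<gamma> - \<alpha> k))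
      \<le> 225 * real H ^ 4 * (w (fst (c k)) * w (snd (c k)))" for k
  proof -
    have "dirichlet_kernel_sq H (Re (\<gamma> - \<alpha> k)) * dirichlet_kernel_sq H (Im (\<gamma> - \<alpha> k))
      = dirichlet_kernel_sq H (Re (\<gamma> - \<alpha> k - g k)) * dirichlet_kernel_sq H (Im (\<gamma> - \<alpha> k - g k))"
      using dirichlet_kernel_sq_diff_int gauss_ints_Re_Im g(1) by simp
    also have "\<dots> \<le> (15 * real H ^ 2 * w (fst (c k))) * (15 * real H ^ 2 * w (snd (c k)))"
      using dirichlet_kernel_sq_le[OF g(2) H] dirichlet_kernel_sq_le[OF g(3) H] w0
      by (intro mult_mono) (auto simp: w_def c_def dirichlet_kernel_sq_def)
    also have "\<dots> = 225 * real H ^ 4 * (w (fst (c k)) * w (snd (c k)))"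
      by (simp add: power2_eq_square power4_eq_xxxx)
    finally show ?thesis .
  qed
  have cell: "real (card {k \<in> J. c k = z}) \<le> K" for z
  proof -
    obtain p q where z: "z = (p, q)" by (cases z)
    \<comment> \<open>The centre of the cell, carried back to the side of the points
      \<open>\<alpha> k\<close>. Each coordinate is off by at most \<open>1 / (2 * H)\<close>, so
      the cell fits into a disc of radius \<open>1 / H\<close>.\<close>
    define \<beta> where "\<beta> = \<gamma> - Complex ((of_int p + 1/2) / real H) ((of_int q + 1/2) / real H)"
    have "{k \<in> J. c k = z} \<subseteq> {j \<in> J. \<exists>g\<in>gauss_ints. cmod (\<alpha> j - \<beta> - g) \<le> 1 / real H}"
    proof
      fix k assume "k \<in> {k \<in> J. c k = z}"
      then have k: "k \<in> J" "c k = z" by auto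
      have near: "\<bar>(of_int \<lfloor>real H * t\<rfloor> + 1/2) / real H - t\<bar> \<le> 1 / (2 * real H)" for t
      proof -
        have "\<bar>of_int \<lfloor>real H * t\<rfloor> + 1/2 - real H * t\<bar> \<le> 1/2" by linarith
        then have "\<bar>of_int \<lfloor>real H * t\<rfloor> + 1/2 - real H * t\<bar> / real H \<le> 1/2 / real H" using H by (intro divide_right_mono) auto
        moreover have "\<bar>(of_int \<lfloor>real H * t\<rfloor> + 1/2) / real H - t\<bar> = \<bar>of_int \<lfloor>real H * t\<rfloor> + 1/2 - real H * t\<bar> / real H"
        proof -
          have "(of_int \<lfloor>real H * t\<rfloor> + 1/2) / real H - t = (of_int \<lfloor>real H * t\<rfloor> + 1/2 - real H * t) / real H"
            using H by (simp add: diff_divide_distrib)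
          then show ?thesis by simp
        qed
        ultimately show ?thesis by simp
      qed
      have pq: "p = \<lfloor>real H * Re (\<gamma> - \<alpha> k - g k)\<rfloor>" "q = \<lfloor>real H * Im (\<gamma> - \<alpha> k - g k)\<rfloor>"
        using k(2) unfolding z c_def by auto
      have "cmod (\<alpha> k - \<beta> - (- g k)) \<le> \<bar>Re (\<alpha> k - \<beta> - (- g k))\<bar> + \<bar>Im (\<alpha> k - \<beta> - (- g k))\<bar>"
        by (rule cmod_le)
      also have "\<bar>Re (\<alpha> k - \<beta> - (- g k))\<bar> \<le> 1 / (2 * real H)"
        using near[of "Re (\<gamma> - \<alpha> k - g k)"] unfolding pq \<beta>_def by (simp add: algebra_simps)
      also have "\<bar>Im (\<alpha> k - \<beta> - (- g k))\<bar> \<le> 1 / (2 * real H)"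
        using near[of "Im (\<gamma> - \<alpha> k - g k)"] unfolding pq \<beta>_def by (simp add: algebra_simps)
      finally have "cmod (\<alpha> k - \<beta> - (- g k)) \<le> 1 / real H" by simp
      then have "\<exists>g\<in>gauss_ints. cmod (\<alpha> k - \<beta> - g) \<le> 1 / real H"
        by (rule bexI) (rule gauss_ints_uminus[OF g(1)])
      then show "k \<in> {j \<in> J. \<exists>g\<in>gauss_ints. cmod (\<alpha> j - \<beta> - g) \<le> 1 / real H}" using k(1) by simp
    qed
    then have "card {k \<in> J. c k = z} \<le> card {j \<in> J. \<exists>g\<in>gauss_ints. cmod (\<alpha> j - \<beta> - g) \<le> 1 / real H}"
      using J by (intro card_mono) auto
    then show ?thesis using count[of \<beta>] by linarith
  qed
  have "\<exists>L. c ` J \<subseteq> {-int L..int L} \<times> {-int L..int L}"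
  proof -
    define L where "L = nat (\<Sum>k\<in>J. \<bar>fst (c k)\<bar> + \<bar>snd (c k)\<bar>)"
    have "\<bar>fst (c k)\<bar> + \<bar>snd (c k)\<bar> \<le> int L" if "k \<in> J" for k
    proof -
      have "\<bar>fst (c k)\<bar> + \<bar>snd (c k)\<bar> \<le> (\<Sum>k\<in>J. \<bar>fst (c k)\<bar> + \<bar>snd (c k)\<bar>)"
        using J that by (intro member_le_sum) auto
      then show ?thesis unfolding L_def by linarith
    qed
    note le_L = this
    have "c ` J \<subseteq> {-int L..int L} \<times> {-int L..int L}"
    proof (intro image_subsetI)
      fix k assume "k \<in> J"
      then have "\<bar>fst (c k)\<bar> \<le> int L" "\<bar>snd (c k)\<bar> \<le> int L" using le_L[of k] by linarith+
      then show "c k \<in> {-int L..int L} \<times> {-int L..int L}" by (simp add: mem_Times_iff abs_le_iff)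
    qed
    then show ?thesis by blast
  qed
  then obtain L where L: "c ` J \<subseteq> {-int L..int L} \<times> {-int L..int L}" by blast
  have "(\<Sum>k\<in>J. w (fst (c k)) * w (snd (c k))) = (\<Sum>z\<in>c ` J. \<Sum>k\<in>{k \<in> J. c k = z}. w (fst (c k)) * w (snd (c k)))"
    using sum.image_gen[OF J] .
  also have "\<dots> = (\<Sum>z\<in>c ` J. real (card {k \<in> J. c k = z}) * (w (fst z) * w (snd z)))"
    by (intro sum.cong) auto
  also have "\<dots> \<le> (\<Sum>z\<in>c ` J. K * (w (fst z) * w (snd z)))"
    using cell w0 by (intro sum_mono mult_right_mono) auto
  also have "\<dots> \<le> (\<Sum>z\<in>{-int L..int L} \<times> {-int L..int L}. K * (w (fst z) * w (snd z)))"
    using L K0 w0 by (intro sum_mono2) auto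
  also have "\<dots> = K * (sum w {-int L..int L} * sum w {-int L..int L})"
    by (simp only: sum_product sum.cartesian_product sum_distrib_left[of K, symmetric] case_prod_unfold)
  also have "\<dots> \<le> K * (5 * 5)"
    using sum_inverse_squares_le[of L] w0 K0 unfolding w_def[symmetric]
    by (intro mult_left_mono mult_mono sum_nonneg) auto
  finally have W: "(\<Sum>k\<in>J. w (fst (c k)) * w (snd (c k))) \<le> 25 * K" by simp
  have "(\<Sum>k\<in>J. dirichlet_kernel_sq H (Re (\<gamma> - \<alpha> k)) * dirichlet_kernel_sq H (Im (\<gamma> - \<alpha> k)))
     \<le> (\<Sum>k\<in>J. 225 * real H ^ 4 * (w (fst (c k)) * w (snd (c k))))"
    using term_le by (intro sum_mono)
  also have "\<dots> = 225 * real H ^ 4 * (\<Sum>k\<in>J. w (fst (c k)) * w (snd (c k)))" by (simp add: sum_distrib_left)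
  also have "\<dots> \<le> 225 * real H ^ 4 * (25 * K)" using W by (intro mult_left_mono) auto
  also have "\<dots> = 5625 * K * real H ^ 4" by simp
  finally show ?thesis .
qed

text \<open>Every \<open>n\<close> with coordinates at most \<open>M\<close> in absolute value is a difference of two points of
  \<open>[0, 3M]\<^sup>2\<close> in at least \<open>M\<^sup>2\<close> ways; summing over all such differences yields squares of Dirichlet kernels.\<close>
lemma dual_large_sieve:
  assumes J: "finite J" and M: "M \<ge> 1"
    and count: "\<And>\<beta>. real (card {j \<in> J. \<exists>g\<in>gauss_ints. cmod (\<alpha> j - \<beta> - g) \<le> 1 / real (3 * M + 1)}) \<le> K"
  shows "(\<Sum>n\<in>{n \<in> gauss_ints. \<bar>Re n\<bar> \<le> real M \<and> \<bar>Im n\<bar> \<le> real M}. (cmod (\<Sum>j\<in>J. b j * ee (Re (n * \<alpha> j))))^2)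
    \<le> 1440000 * K * real M ^ 2 * (\<Sum>j\<in>J. (cmod (b j))^2)"
proof -
  define H where "H = 3 * M + 1"
  define Box where "Box = {n \<in> gauss_ints. \<bar>Re n\<bar> \<le> real M \<and> \<bar>Im n\<bar> \<le> real M}"
  define G where "G n = (cmod (\<Sum>j\<in>J. b j * ee (Re (n * \<alpha> j))))^2" for n
  define P where "P = (\<lambda>m::nat \<times> nat. Complex (real (fst m)) (real (snd m)))"
  define Q where "Q = {..<H} \<times> {..<H}"
  \<comment> \<open>The middle block of the grid: translates of \<open>Box\<close> by its
    \<open>M^2\<close> points stay inside \<open>Q\<close>.\<close>
  define Q' where "Q' = {M..<2*M} \<times> {M..<2*M}"
  define D where "D j k = dirichlet_kernel_sq H (Re (\<alpha> j - \<alpha> k)) * dirichlet_kernel_sq H (Im (\<alpha> j - \<alpha> k))" for j k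
  have G0: "G n \<ge> 0" for n unfolding G_def by simp
  have K0: "K \<ge> 0" using count[of 0] by (meson of_nat_0_le_iff order_trans)
  have finQ: "finite Q" "finite Q'" unfolding Q_def Q'_def by auto
  have QQ: "Q' \<subseteq> Q" unfolding Q_def Q'_def H_def by auto
  have injP: "inj P" unfolding P_def by (auto simp: inj_on_def prod_eq_iff)
  have shift: "(\<Sum>n\<in>Box. G n) \<le> (\<Sum>m\<in>Q. G (P m - P m'))" if m': "m' \<in> Q'" for m'
  proof -
    have sub: "Box \<subseteq> (\<lambda>m. P m - P m') ` Q"
    proof
      fix n assume n: "n \<in> Box"
      then obtain x y :: int where xy: "n = Complex (of_int x) (of_int y)" using gauss_intsE unfolding Box_def by blast
      then have b: "\<bar>x\<bar> \<le> int M" "\<bar>y\<bar> \<le> int M" using n unfolding Box_def by auto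
      define m where "m = (nat (x + int (fst m')), nat (y + int (snd m')))"
      have "m \<in> Q" using b m' unfolding m_def Q_def Q'_def H_def by auto
      moreover have "n = P m - P m'" using b m' unfolding xy m_def P_def Q'_def by (auto simp: complex_eq_iff)
      ultimately show "n \<in> (\<lambda>m. P m - P m') ` Q" by blast
    qed
    have inj: "inj_on (\<lambda>m. P m - P m') Q" using injP by (auto simp: inj_on_def)
    have "(\<Sum>n\<in>Box. G n) \<le> (\<Sum>n\<in>(\<lambda>m. P m - P m') ` Q. G n)"
      using finQ sub G0 by (intro sum_mono2) auto
    also have "\<dots> = (\<Sum>m\<in>Q. G (P m - P m'))" using inj by (simp add: sum.reindex)
    finally show ?thesis .
  qed
  have "real (card Q') * (\<Sum>n\<in>Box. G n) = (\<Sum>m'\<in>Q'. \<Sum>n\<in>Box. G n)" by simp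
  also have "\<dots> \<le> (\<Sum>m'\<in>Q'. \<Sum>m\<in>Q. G (P m - P m'))" using shift by (intro sum_mono)
  also have "\<dots> \<le> (\<Sum>m'\<in>Q. \<Sum>m\<in>Q. G (P m - P m'))"
    using finQ QQ G0 by (intro sum_mono2) (auto intro: sum_nonneg)
  finally have lower: "real M ^ 2 * (\<Sum>n\<in>Box. G n) \<le> (\<Sum>m'\<in>Q. \<Sum>m\<in>Q. G (P m - P m'))"
    unfolding Q'_def by (simp add: power2_eq_square)
  define A where "A j m = ee (Re (P m * \<alpha> j))" for j m
  define B where "B j k = (\<Sum>m\<in>Q. A j m * cnj (A k m))" for j k
  have BD: "(cmod (B j k))^2 = D j k" for j k
  proof -
    have "B j k = (\<Sum>m\<in>Q. ee (real (fst m) * Re (\<alpha> j - \<alpha> k)) * ee (real (snd m) * (- Im (\<alpha> j - \<alpha> k))))"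
      unfolding B_def A_def cnj_ee ee_add[symmetric] P_def by (simp add: algebra_simps)
    also have "\<dots> = (\<Sum>x<H. ee (real x * Re (\<alpha> j - \<alpha> k))) * (\<Sum>y<H. ee (real y * (- Im (\<alpha> j - \<alpha> k))))"
      unfolding Q_def by (simp add: sum_product sum.cartesian_product case_prod_beta)
    finally have "(cmod (B j k))^2 = dirichlet_kernel_sq H (Re (\<alpha> j - \<alpha> k)) * dirichlet_kernel_sq H (- Im (\<alpha> j - \<alpha> k))"
      unfolding dirichlet_kernel_sq_def by (simp add: norm_mult power_mult_distrib)
    then show ?thesis unfolding D_def dirichlet_kernel_sq_uminus .
  qed
  have Dsym: "D j k = D k j" for j k
    unfolding D_def using dirichlet_kernel_sq_uminus[of H "Re (\<alpha> j - \<alpha> k)"] dirichlet_kernel_sq_uminus[of H "Im (\<alpha> j - \<alpha> k)"]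
    by simp
  have D0: "D j k \<ge> 0" for j k unfolding BD[symmetric] by simp
  \<comment> \<open>Opening the square separates \<open>m\<close> from \<open>m'\<close>: their
    double sum is \<open>B j k * cnj (B j k)\<close>, so a quadratic form in \<open>b\<close> with
    nonnegative coefficients \<open>D j k\<close> remains.\<close>
  have expand: "complex_of_real (\<Sum>m'\<in>Q. \<Sum>m\<in>Q. G (P m - P m')) = (\<Sum>j\<in>J. \<Sum>k\<in>J. b j * cnj (b k) * of_real (D j k))"
  proof -
    have "complex_of_real (G (P m - P m')) = (\<Sum>j\<in>J. \<Sum>k\<in>J. b j * cnj (b k) * ((A j m * cnj (A k m)) * cnj (A j m' * cnj (A k m'))))" for m m'
    proof -
      have *: "ee (Re ((P m - P m') * \<alpha> j)) = A j m * cnj (A j m')" for j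
        unfolding A_def cnj_ee ee_add[symmetric] by (simp add: algebra_simps)
      have "complex_of_real (G (P m - P m')) = (\<Sum>j\<in>J. b j * (A j m * cnj (A j m'))) * cnj (\<Sum>k\<in>J. b k * (A k m * cnj (A k m')))"
        unfolding G_def * by (rule complex_norm_square)
      also have "\<dots> = (\<Sum>j\<in>J. \<Sum>k\<in>J. b j * cnj (b k) * ((A j m * cnj (A k m)) * cnj (A j m' * cnj (A k m'))))"
        by (simp add: sum_product mult_ac)
      finally show ?thesis .
    qed
    then have "complex_of_real (\<Sum>m'\<in>Q. \<Sum>m\<in>Q. G (P m - P m')) =
      (\<Sum>m'\<in>Q. \<Sum>m\<in>Q. \<Sum>j\<in>J. \<Sum>k\<in>J. b j * cnj (b k) * ((A j m * cnj (A k m)) * cnj (A j m' * cnj (A k m'))))"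
      by simp
    also have "\<dots> = (\<Sum>m'\<in>Q. \<Sum>j\<in>J. \<Sum>m\<in>Q. \<Sum>k\<in>J. b j * cnj (b k) * ((A j m * cnj (A k m)) * cnj (A j m' * cnj (A k m'))))"
      by (intro sum.cong sum.swap refl)
    also have "\<dots> = (\<Sum>j\<in>J. \<Sum>m'\<in>Q. \<Sum>m\<in>Q. \<Sum>k\<in>J. b j * cnj (b k) * ((A j m * cnj (A k m)) * cnj (A j m' * cnj (A k m'))))"
      by (rule sum.swap)
    also have "\<dots> = (\<Sum>j\<in>J. \<Sum>m'\<in>Q. \<Sum>k\<in>J. \<Sum>m\<in>Q. b j * cnj (b k) * ((A j m * cnj (A k m)) * cnj (A j m' * cnj (A k m'))))"
      by (intro sum.cong sum.swap refl)
    also have "\<dots> = (\<Sum>j\<in>J. \<Sum>k\<in>J. \<Sum>m'\<in>Q. \<Sum>m\<in>Q. b j * cnj (b k) * ((A j m * cnj (A k m)) * cnj (A j m' * cnj (A k m'))))"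
      by (intro sum.cong sum.swap refl)
    also have "\<dots> = (\<Sum>j\<in>J. \<Sum>k\<in>J. b j * cnj (b k) * (B j k * cnj (B j k)))"
    proof (intro sum.cong refl)
      fix j k
      show "(\<Sum>m'\<in>Q. \<Sum>m\<in>Q. b j * cnj (b k) * ((A j m * cnj (A k m)) * cnj (A j m' * cnj (A k m')))) = b j * cnj (b k) * (B j k * cnj (B j k))"
      proof -
        have "B j k * cnj (B j k) = (\<Sum>m\<in>Q. \<Sum>m'\<in>Q. (A j m * cnj (A k m)) * cnj (A j m' * cnj (A k m')))"
          by (simp only: B_def cnj_sum sum_product)
        also have "\<dots> = (\<Sum>m'\<in>Q. \<Sum>m\<in>Q. (A j m * cnj (A k m)) * cnj (A j m' * cnj (A k m')))"
          by (rule sum.swap)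
        finally show ?thesis by (simp only: sum_distrib_left)
      qed
    qed
    also have "\<dots> = (\<Sum>j\<in>J. \<Sum>k\<in>J. b j * cnj (b k) * of_real (D j k))"
      unfolding BD[symmetric] complex_norm_square[symmetric] by simp
    finally show ?thesis .
  qed
  have "(\<Sum>m'\<in>Q. \<Sum>m\<in>Q. G (P m - P m')) \<le> cmod (\<Sum>j\<in>J. \<Sum>k\<in>J. b j * cnj (b k) * of_real (D j k))"
    unfolding expand[symmetric] norm_of_real by (rule abs_ge_self)
  also have "\<dots> \<le> (\<Sum>j\<in>J. \<Sum>k\<in>J. cmod (b j) * cmod (b k) * D j k)"
  proof -
    have "cmod (\<Sum>k\<in>J. b j * cnj (b k) * of_real (D j k)) \<le> (\<Sum>k\<in>J. cmod (b j) * cmod (b k) * D j k)" for j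
      by (rule order_trans[OF norm_sum]) (simp add: norm_mult D0)
    then show ?thesis by (rule order_trans[OF norm_sum sum_mono])
  qed
  \<comment> \<open>Schur's test: by the inequality of arithmetic and geometric means and the
    symmetry of \<open>D\<close>, the form is controlled by the row sums of
    \<open>D\<close>.\<close>
  also have "\<dots> \<le> (\<Sum>j\<in>J. \<Sum>k\<in>J. (cmod (b j))^2 / 2 * D j k + (cmod (b k))^2 / 2 * D j k)"
  proof (intro sum_mono)
    fix j k
    have "cmod (b j) * cmod (b k) \<le> (cmod (b j))^2 / 2 + (cmod (b k))^2 / 2"
      using sum_squares_bound[of "cmod (b j)" "cmod (b k)"] by simp
    then have "cmod (b j) * cmod (b k) * D j k \<le> ((cmod (b j))^2 / 2 + (cmod (b k))^2 / 2) * D j k"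
      using D0 by (rule mult_right_mono)
    then show "cmod (b j) * cmod (b k) * D j k \<le> (cmod (b j))^2 / 2 * D j k + (cmod (b k))^2 / 2 * D j k"
      by (simp add: distrib_right)
  qed
  also have "\<dots> = (\<Sum>j\<in>J. (cmod (b j))^2 * (\<Sum>k\<in>J. D j k))"
  proof -
    have "(\<Sum>j\<in>J. \<Sum>k\<in>J. (cmod (b k))^2 / 2 * D j k) = (\<Sum>j\<in>J. \<Sum>k\<in>J. (cmod (b j))^2 / 2 * D j k)"
      by (subst sum.swap) (simp add: Dsym)
    then show ?thesis by (simp add: sum.distrib sum_distrib_left)
  qed
  also have "\<dots> \<le> (\<Sum>j\<in>J. (cmod (b j))^2 * (5625 * K * real H ^ 4))"
    unfolding D_def using count by (intro sum_mono mult_left_mono sum_kernel_le) (auto simp: J H_def)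
  also have "\<dots> = (\<Sum>j\<in>J. (cmod (b j))^2) * (5625 * K * real H ^ 4)" by (simp add: sum_distrib_right)
  \<comment> \<open>\<open>3 * M + 1 <= 4 * M\<close>, and
    \<open>5625 * 4^4 = 1440000\<close>.\<close>
  also have "\<dots> \<le> (\<Sum>j\<in>J. (cmod (b j))^2) * (5625 * K * (4 * real M) ^ 4)"
    using K0 M by (intro mult_left_mono power_mono sum_nonneg) (auto simp: H_def)
  finally have "(\<Sum>m'\<in>Q. \<Sum>m\<in>Q. G (P m - P m')) \<le> real M ^ 2 * (1440000 * K * real M ^ 2 * (\<Sum>j\<in>J. (cmod (b j))^2))"
    by (simp add: power_mult_distrib power4_eq_xxxx power2_eq_square mult_ac)
  with lower have "real M ^ 2 * (\<Sum>n\<in>Box. G n) \<le> real M ^ 2 * (1440000 * K * real M ^ 2 * (\<Sum>j\<in>J. (cmod (b j))^2))"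
    by linarith
  then show ?thesis using M unfolding Box_def G_def by (simp add: mult_le_cancel_left)
qed

text \<open>Duality: if the conjugates of the values \<open>T j\<close> serve as coefficients of the
  dual sum \<open>U\<close>, then \<open>X\<close> is the sum of \<open>a n * U n\<close>, while the
  dual inequality bounds the mean square of \<open>U\<close> by \<open>c * X\<close>. Cauchy-Schwarz
  yields \<open>X <= c * Z\<close>. The disc lies in a box with \<open>M <= 2 * sqrt N\<close>,
  whence \<open>5760000 = 4 * 1440000\<close>.\<close>

lemma large_sieve:
  assumes J: "finite J" and N: "N \<ge> 1"
    and count: "\<And>\<beta>. real (card {j \<in> J. \<exists>g\<in>gauss_ints. cmod (\<alpha> j - \<beta> - g) \<le> 1 / sqrt N}) \<le> K"
  shows "(\<Sum>j\<in>J. (cmod (\<Sum>n\<in>{n \<in> gauss_ints. gnorm n \<le> N}. a n * ee (Re (n * \<alpha> j))))^2)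
    \<le> 5760000 * K * N * (\<Sum>n\<in>{n \<in> gauss_ints. gnorm n \<le> N}. (cmod (a n))^2)"
proof -
  define E where "E = {n \<in> gauss_ints. gnorm n \<le> N}"
  have finE: "finite E" unfolding E_def by (rule finite_gnorm_le)
  define T where "T j = (\<Sum>n\<in>E. a n * ee (Re (n * \<alpha> j)))" for j
  define X where "X = (\<Sum>j\<in>J. (cmod (T j))^2)"
  define Z where "Z = (\<Sum>n\<in>E. (cmod (a n))^2)"
  define M where "M = nat \<lceil>sqrt N\<rceil>"
  have sN: "sqrt N \<ge> 1" using N by simp
  have M: "M \<ge> 1" "sqrt N \<le> real M" "real M \<le> 2 * sqrt N" unfolding M_def using sN by linarith+
  have M2: "real M ^ 2 \<le> 4 * N"
  proof -
    have "real M ^ 2 \<le> (2 * sqrt N)^2" using M by (intro power_mono) auto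
    then show ?thesis using N by (simp add: power_mult_distrib)
  qed
  have K0: "K \<ge> 0" using count[of 0] by (meson of_nat_0_le_iff order_trans)
  have count': "real (card {j \<in> J. \<exists>g\<in>gauss_ints. cmod (\<alpha> j - \<beta> - g) \<le> 1 / real (3 * M + 1)}) \<le> K" for \<beta>
  proof -
    have "1 / real (3 * M + 1) \<le> 1 / sqrt N" using M sN by (intro divide_left_mono) auto
    then have "card {j \<in> J. \<exists>g\<in>gauss_ints. cmod (\<alpha> j - \<beta> - g) \<le> 1 / real (3 * M + 1)}
      \<le> card {j \<in> J. \<exists>g\<in>gauss_ints. cmod (\<alpha> j - \<beta> - g) \<le> 1 / sqrt N}"
      using J by (intro card_mono) (auto intro: order_trans)
    then show ?thesis using count[of \<beta>] by linarith
  qed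
  have EB: "E \<subseteq> {n \<in> gauss_ints. \<bar>Re n\<bar> \<le> real M \<and> \<bar>Im n\<bar> \<le> real M}"
  proof clarify
    fix n assume "n \<in> E"
    then have "n \<in> gauss_ints" "cmod n \<le> sqrt N" using gnorm_le_iff[of N n] N by (auto simp: E_def)
    then show "n \<in> gauss_ints \<and> \<bar>Re n\<bar> \<le> real M \<and> \<bar>Im n\<bar> \<le> real M"
      using abs_Re_le_cmod[of n] abs_Im_le_cmod[of n] M(2) by linarith
  qed
  have finB: "finite {n \<in> gauss_ints. \<bar>Re n\<bar> \<le> real M \<and> \<bar>Im n\<bar> \<le> real M}"
    by (rule finite_gauss_box) simp
  define U where "U n = (\<Sum>j\<in>J. cnj (T j) * ee (Re (n * \<alpha> j)))" for n
  have "complex_of_real X = (\<Sum>j\<in>J. cnj (T j) * T j)"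
    unfolding X_def of_real_sum complex_norm_square by (simp add: mult.commute)
  also have "\<dots> = (\<Sum>j\<in>J. \<Sum>n\<in>E. a n * (cnj (T j) * ee (Re (n * \<alpha> j))))"
  proof (intro sum.cong refl)
    fix j
    have "cnj (T j) * T j = cnj (T j) * (\<Sum>n\<in>E. a n * ee (Re (n * \<alpha> j)))" unfolding T_def ..
    also have "\<dots> = (\<Sum>n\<in>E. a n * (cnj (T j) * ee (Re (n * \<alpha> j))))"
      unfolding sum_distrib_left by (intro sum.cong refl mult.left_commute)
    finally show "cnj (T j) * T j = (\<Sum>n\<in>E. a n * (cnj (T j) * ee (Re (n * \<alpha> j))))" .
  qed
  also have "\<dots> = (\<Sum>n\<in>E. a n * U n)" unfolding U_def by (subst sum.swap) (simp add: sum_distrib_left)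
  finally have XU: "complex_of_real X = (\<Sum>n\<in>E. a n * U n)" .
  have X0: "X \<ge> 0" unfolding X_def by (intro sum_nonneg) auto
  have "(\<Sum>n\<in>E. (cmod (U n))^2) \<le> (\<Sum>n\<in>{n \<in> gauss_ints. \<bar>Re n\<bar> \<le> real M \<and> \<bar>Im n\<bar> \<le> real M}. (cmod (U n))^2)"
    using finB EB by (intro sum_mono2) auto
  also have "\<dots> \<le> 1440000 * K * real M ^ 2 * (\<Sum>j\<in>J. (cmod (cnj (T j)))^2)"
    unfolding U_def by (rule dual_large_sieve[OF J M(1) count'])
  also have "\<dots> = 1440000 * K * real M ^ 2 * X" unfolding X_def by simp
  also have "\<dots> \<le> 1440000 * K * (4 * N) * X" using M2 K0 X0 by (intro mult_right_mono mult_left_mono) auto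
  finally have UX: "(\<Sum>n\<in>E. (cmod (U n))^2) \<le> 5760000 * K * N * X" by simp
  have "X \<le> 5760000 * K * N * Z"
  proof (cases "J = {}")
    case True
    then show ?thesis using K0 N unfolding X_def Z_def by (simp add: sum_nonneg)
  next
    \<comment> \<open>A point is close to itself, so \<open>K > 0\<close> and division by
      \<open>c\<close> is legitimate.\<close>
    case False
    then obtain j where "j \<in> J" by blast
    then have "j \<in> {i \<in> J. \<exists>g\<in>gauss_ints. cmod (\<alpha> i - \<alpha> j - g) \<le> 1 / sqrt N}"
      using gauss_ints_0 N by force
    then have "card {i \<in> J. \<exists>g\<in>gauss_ints. cmod (\<alpha> i - \<alpha> j - g) \<le> 1 / sqrt N} > 0"
      using J card_gt_0_iff by force
    then have "K > 0" using count[of "\<alpha> j"] by linarith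
    define c where "c = 5760000 * K * N"
    have c: "c > 0" unfolding c_def using \<open>K > 0\<close> N by simp
    have "X = cmod (\<Sum>n\<in>E. a n * U n)" using X0 by (simp flip: XU)
    also have "\<dots> \<le> (\<Sum>n\<in>E. cmod (a n) * cmod (U n))" by (rule order_trans[OF norm_sum]) (simp add: norm_mult)
    \<comment> \<open>Cauchy-Schwarz as a weighted mean inequality; with weight \<open>c\<close> the
      second part is at most \<open>X / 2\<close> and is absorbed on the left.\<close>
    also have "\<dots> \<le> (\<Sum>n\<in>E. c / 2 * (cmod (a n))^2 + (cmod (U n))^2 / (2 * c))"
    proof (rule sum_mono)
      fix n
      have "0 \<le> (c * cmod (a n) - cmod (U n))^2 / (2 * c)" using c by simp
      also have "\<dots> = c / 2 * (cmod (a n))^2 + (cmod (U n))^2 / (2 * c) - cmod (a n) * cmod (U n)"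
        using c by (simp add: power2_eq_square field_simps)
      finally show "cmod (a n) * cmod (U n) \<le> c / 2 * (cmod (a n))^2 + (cmod (U n))^2 / (2 * c)" by simp
    qed
    also have "\<dots> = c / 2 * Z + (\<Sum>n\<in>E. (cmod (U n))^2) / (2 * c)"
      unfolding Z_def by (simp add: sum.distrib sum_distrib_left sum_divide_distrib)
    also have "\<dots> \<le> c / 2 * Z + c * X / (2 * c)"
      using UX c unfolding c_def[symmetric] by (intro add_left_mono divide_right_mono) auto
    finally show ?thesis using c unfolding c_def[symmetric] by simp
  qed
  then show ?thesis unfolding X_def T_def Z_def E_def .
qed

section \<open>An upper bound sieve\<close>

lemma ee_eq_1_iff: "ee x = 1 \<longleftrightarrow> x \<in> \<int>"
proof
  assume "ee x = 1"
  then have "cos (2 * pi * x) = 1" by (simp add: ee_cis complex_eq_iff)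
  then obtain k :: int where "2 * pi * x = k * 2 * pi" using cos_one_2pi_int by auto
  then have "x = of_int k" by simp
  then show "x \<in> \<int>" by simp
qed (rule ee_int)

lemma reduced_residue_systemD:
  assumes "reduced_residue_system p S" "gprime p"
  shows "S \<subseteq> gauss_ints" "finite S" "real (card S) \<le> gnorm p" "\<And>r. r \<in> S \<Longrightarrow> \<not> gdvd p r"
    "\<And>z. z \<in> gauss_ints \<Longrightarrow> \<not> gdvd p z \<Longrightarrow> \<exists>r\<in>S. gdvd p (z - r)" "card S > 0"
proof -
  show 1: "S \<subseteq> gauss_ints" using assms unfolding reduced_residue_system_def by blast
  show "finite S" "real (card S) \<le> gnorm p"
    using incongruent_finite_card_le[OF gprimeD(1,2)[OF assms(2)] 1] reduced_residue_system_eq[OF assms(1)] by blast+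
  show "\<not> gdvd p r" if "r \<in> S" for r
    using assms that gcoprime_gprime_iff[OF assms(2)] unfolding reduced_residue_system_def by blast
  show ex: "\<exists>r\<in>S. gdvd p (z - r)" if "z \<in> gauss_ints" "\<not> gdvd p z" for z
    using assms that gcoprime_gprime_iff[OF assms(2)] unfolding reduced_residue_system_def by blast
  show "card S > 0"
    using ex[OF gauss_ints_1 gprime_not_gdvd_1[OF assms(2)]] \<open>finite S\<close> by (auto simp: card_gt_0_iff)
qed

text \<open>Adjoining 0 to \<open>R\<close> gives a complete residue system, over which the
  character \<open>\<phi>\<close> sums to 0: translation by some \<open>t\<close> with
  \<open>\<phi> t \<noteq> 1\<close> permutes the classes and multiplies the sum by
  \<open>\<phi> t\<close>.\<close>

lemma ramanujan_sum_prime: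
  assumes p: "gprime p" and R: "reduced_residue_system p R" and x: "x \<in> gauss_ints" "\<not> gdvd p x"
  shows "(\<Sum>r\<in>R. ee (Re (x * r / p))) = -1"
proof -
  note RD = reduced_residue_systemD[OF R p]
  define \<phi> where "\<phi> z = ee (Re (x * z / p))" for z
  define F where "F = insert 0 R"
  have p0: "p \<noteq> 0" using gprimeD(2)[OF p] .
  have F: "F \<subseteq> gauss_ints" "finite F" "0 \<notin> R" using RD(1,2) RD(4)[of 0] gauss_ints_0 by (auto simp: F_def)
  have \<phi>_add: "\<phi> (a + b) = \<phi> a * \<phi> b" for a b
    unfolding \<phi>_def ee_add[symmetric] by (simp add: distrib_left add_divide_distrib)
  have \<phi>_dvd: "\<phi> z = 1" if z: "gdvd p z" for z
  proof -
    obtain k where k: "k \<in> gauss_ints" "z = p * k" using z unfolding gdvd_def by blast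
    have "x * z / p = x * k" using k p0 by simp
    then show ?thesis unfolding \<phi>_def using ee_Re_gauss[OF gauss_ints_mult[OF x(1) k(1)]] by simp
  qed
  have \<phi>_cong: "\<phi> a = \<phi> b" if "gdvd p (a - b)" for a b
    using \<phi>_add[of "a - b" b] \<phi>_dvd[OF that] by simp
  \<comment> \<open>The values at \<open>1\<close> and \<open>\<i>\<close> detect the real and the
    imaginary part of \<open>x / p\<close> modulo 1, so taking real parts in the exponent loses
    nothing.\<close>
  have "\<exists>t\<in>gauss_ints. \<phi> t \<noteq> 1"
  proof (rule ccontr)
    assume "\<not> (\<exists>t\<in>gauss_ints. \<phi> t \<noteq> 1)"
    then have "\<phi> 1 = 1" "\<phi> \<i> = 1" using gauss_ints_1 gauss_ints_i by auto
    then have "Re (x / p) \<in> \<int>" "Re (\<i> * (x / p)) \<in> \<int>" unfolding \<phi>_def ee_eq_1_iff by (simp_all add: mult.commute)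
    then have "Re (x / p) \<in> \<int>" "Im (x / p) \<in> \<int>" by (simp_all only: Re_i_times minus_in_Ints_iff)
    then have "x / p \<in> gauss_ints" by (simp add: gauss_ints_def)
    then have "gdvd p x" using p0 by (intro gdvdI[of "x / p"]) auto
    then show False using x by blast
  qed
  then obtain t where t: "t \<in> gauss_ints" "\<phi> t \<noteq> 1" by blast
  have "\<exists>r. r \<in> F \<and> gdvd p (z - r)" if "z \<in> gauss_ints" for z
    using RD(5)[OF that] unfolding F_def by (cases "gdvd p z") auto
  then obtain f where f: "\<And>z. z \<in> gauss_ints \<Longrightarrow> f z \<in> F \<and> gdvd p (z - f z)" by metis
  have F_eq: "r = s" if rs: "r \<in> F" "s \<in> F" "gdvd p (r - s)" for r s
  proof -
    have "gdvd p (s - r)" using gdvd_diff[OF gdvd_0 rs(3)] by simp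
    then show ?thesis using rs RD(4) reduced_residue_system_eq[OF R] unfolding F_def by auto
  qed
  have inj: "inj_on (\<lambda>r. f (r + t)) F"
  proof (rule inj_onI)
    fix r s assume rs: "r \<in> F" "s \<in> F" "f (r + t) = f (s + t)"
    have "r + t \<in> gauss_ints" "s + t \<in> gauss_ints" using rs F t gauss_ints_add by auto
    then have "gdvd p ((r + t - f (r + t)) - (s + t - f (s + t)))" using f gdvd_diff by blast
    then show "r = s" using rs F_eq by simp
  qed
  have "(\<lambda>r. f (r + t)) ` F \<subseteq> F" using f F t gauss_ints_add by blast
  then have img: "(\<lambda>r. f (r + t)) ` F = F" using inj F(2) by (simp add: endo_inj_surj)
  have "sum \<phi> F = sum \<phi> ((\<lambda>r. f (r + t)) ` F)" by (simp only: img)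
  also have "\<dots> = (\<Sum>r\<in>F. \<phi> (f (r + t)))" using inj by (simp add: sum.reindex)
  also have "\<dots> = (\<Sum>r\<in>F. \<phi> r * \<phi> t)"
  proof (rule sum.cong)
    fix r assume "r \<in> F"
    then have "r + t \<in> gauss_ints" using F t gauss_ints_add by blast
    then show "\<phi> (f (r + t)) = \<phi> r * \<phi> t" using \<phi>_cong f \<phi>_add by metis
  qed simp
  also have "\<dots> = sum \<phi> F * \<phi> t" by (simp add: sum_distrib_right)
  finally have "sum \<phi> F = 0" using t(2) by (simp add: mult_cancel_left1)
  then have "\<phi> 0 + sum \<phi> R = 0" unfolding F_def using F(3) RD(2) by simp
  then show ?thesis unfolding \<phi>_def by (simp add: eq_neg_iff_add_eq_0 add.commute)
qed

text \<open>The sum of \<open>1 / N(d)\<close> over squarefree \<open>d\<close> of norm at most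
  \<open>D\<close> with all prime factors in \<open>P\<close>, each \<open>d\<close> encoded by its
  set of primes. It is a lower bound for the denominator of Selberg's sieve, the sum of
  \<open>1 / \<phi>(d)\<close>.\<close>

definition smooth_density :: "complex set \<Rightarrow> real \<Rightarrow> real" where
  "smooth_density P D = (\<Sum>S\<in>{S \<in> Pow P. gnorm (\<Prod>S) \<le> D}. 1 / gnorm (\<Prod>S))"

lemma sum_fractions_gauss:
  assumes "finite S" "S \<subseteq> prime_reps" "\<And>p. p \<in> S \<Longrightarrow> a p \<in> gauss_ints"
  shows "(\<Sum>p\<in>S. a p / p) * \<Prod>S = (\<Sum>p\<in>S. a p * \<Prod>(S - {p}))"
    and "(\<Sum>p\<in>S. a p / p) * \<Prod>S \<in> gauss_ints"
proof -
  show *: "(\<Sum>p\<in>S. a p / p) * \<Prod>S = (\<Sum>p\<in>S. a p * \<Prod>(S - {p}))"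
    unfolding sum_distrib_right
  proof (rule sum.cong)
    fix p assume p: "p \<in> S"
    then have "p \<noteq> 0" using assms(2) gprimeD(2) prime_repsD by blast
    then show "a p / p * \<Prod>S = a p * \<Prod>(S - {p})" using p assms(1) by (simp add: prod.remove)
  qed simp
  have "\<Prod>(S - {p}) \<in> gauss_ints" for p using assms(2) prime_reps_gauss by (intro gauss_ints_prod) auto
  then show "(\<Sum>p\<in>S. a p / p) * \<Prod>S \<in> gauss_ints" unfolding *
    using assms(3) by (intro gauss_ints_sum gauss_ints_mult) auto
qed

text \<open>Uniqueness of partial fractions modulo Gaussian integers: after multiplication by
  \<open>\<Prod>U\<close> every term except the one for \<open>p\<close> is divisible by
  \<open>p\<close>, and in that term \<open>p\<close> can divide only the factor
  \<open>d p\<close>.\<close>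

lemma fraction_sum_gauss_imp_gdvd:
  assumes U: "finite U" "U \<subseteq> prime_reps" and d: "\<And>p. p \<in> U \<Longrightarrow> d p \<in> gauss_ints"
    and q: "q \<in> gauss_ints" and z: "q * (\<Sum>p\<in>U. d p / p) \<in> gauss_ints" and p: "p \<in> U" "\<not> gdvd p q"
  shows "gdvd p (d p)"
proof -
  have gp: "gprime p" using p U prime_repsD by blast
  have P: "\<Prod>(U - X) \<in> gauss_ints" for X using U prime_reps_gauss by (intro gauss_ints_prod) auto
  define z where "z = q * (\<Sum>p\<in>U. d p / p)"
  have "z * \<Prod>U = q * (\<Sum>r\<in>U. d r * \<Prod>(U - {r}))"
    unfolding z_def mult.assoc using sum_fractions_gauss(1)[of U d] U d by simp
  also have "(\<Sum>r\<in>U. d r * \<Prod>(U - {r})) = d p * \<Prod>(U - {p}) + (\<Sum>r\<in>U - {p}. d r * \<Prod>(U - {r}))"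
    using p U by (subst sum.remove[of _ p]) auto
  finally have eq: "q * (d p * \<Prod>(U - {p})) = z * \<Prod>U - q * (\<Sum>r\<in>U - {p}. d r * \<Prod>(U - {r}))"
    by (simp add: algebra_simps)
  have "gdvd p (z * \<Prod>U)"
  proof -
    have "\<Prod>U = p * \<Prod>(U - {p})" using p U by (simp add: prod.remove)
    then have "gdvd p (\<Prod>U)" using P gdvdI by blast
    then show ?thesis using assms(5) z_def gdvd_mult_left by blast
  qed
  moreover have "gdvd p (q * (\<Sum>r\<in>U - {p}. d r * \<Prod>(U - {r})))"
  proof -
    have "(\<Sum>r\<in>U - {p}. d r * \<Prod>(U - {r})) = p * (\<Sum>r\<in>U - {p}. d r * \<Prod>(U - {r} - {p}))"
      unfolding sum_distrib_left
    proof (rule sum.cong)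
      fix r assume "r \<in> U - {p}"
      then have "\<Prod>(U - {r}) = p * \<Prod>(U - {r} - {p})" using p U by (intro prod.remove) auto
      then show "d r * \<Prod>(U - {r}) = p * (d r * \<Prod>(U - {r} - {p}))" by simp
    qed simp
    moreover have "(\<Sum>r\<in>U - {p}. d r * \<Prod>(U - {r} - {p})) \<in> gauss_ints"
      using d P[of "{_, p}"] by (intro gauss_ints_sum gauss_ints_mult) (auto simp: Diff_insert2[symmetric])
    ultimately have "gdvd p (\<Sum>r\<in>U - {p}. d r * \<Prod>(U - {r}))" by (rule gdvdI[rotated])
    then show ?thesis using q by (rule gdvd_mult_left)
  qed
  ultimately have "gdvd p (q * (d p * \<Prod>(U - {p})))" unfolding eq by (rule gdvd_diff)
  then have "gdvd p (d p) \<or> gdvd p (\<Prod>(U - {p}))"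
    using gprime_gdvd_mult[OF gp] q d p P gauss_ints_mult by metis
  moreover have "\<not> gdvd p (\<Prod>(U - {p}))"
  proof
    assume "gdvd p (\<Prod>(U - {p}))"
    then obtain r where "r \<in> U - {p}" "gdvd p r"
      using gprime_gdvd_prod[OF gp, of "U - {p}" "\<lambda>x. x"] U prime_reps_gauss by auto
    then show False using prime_reps_gdvd_imp_eq[of p r] U p by auto
  qed
  ultimately show ?thesis by blast
qed

text \<open>Selberg's sieve in large sieve form: the exponential sum \<open>F\<close> with coefficients \<open>\<mu>(d)/\<phi>(d)\<close> at
  the fractions of denominator \<open>d\<close> is constant on the sifted set, because there all the Ramanujan sums equal
  \<open>\<mu>(d)\<close>, while the dual large sieve bounds its mean square. A fraction with squarefree denominator \<open>\<Prod>S\<close> is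
  encoded by its partial fraction decomposition.\<close>
lemma sieve_bound:
  assumes q: "q\<^sub>0 \<in> gauss_ints" "q\<^sub>1 \<in> gauss_ints" and D: "1 \<le> D" "D \<le> \<rho>"
    and P: "P = {p \<in> prime_reps. gnorm p \<le> D \<and> \<not> gdvd p q\<^sub>1}"
    and A: "A \<subseteq> {s \<in> gauss_ints. cmod s \<le> \<rho>}" "\<And>s p. s \<in> A \<Longrightarrow> p \<in> P \<Longrightarrow> \<not> gdvd p (q\<^sub>0 + s * q\<^sub>1)"
  shows "real (card A) * smooth_density P D \<le> 5760000 * \<rho>^2"
proof -
  obtain R where R: "\<And>p. reduced_residue_system p (R p)" using reduced_residue_system_exists by metis
  have Prep: "p \<in> prime_reps" if "p \<in> P" for p using that P by blast
  note RD = reduced_residue_systemD[OF R prime_repsD[OF Prep]]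
  have finP: "finite P" unfolding P by (rule finite_subset[OF _ finite_prime_reps_le[of D]]) auto
  define \<S> where "\<S> = {S \<in> Pow P. gnorm (\<Prod>S) \<le> D}"
  have fin\<S>: "finite \<S>" unfolding \<S>_def using finP by auto
  have \<S>: "finite S" "S \<subseteq> P" "S \<subseteq> prime_reps" "gnorm (\<Prod>S) \<le> D" if "S \<in> \<S>" for S
    using that finP finite_subset Prep by (auto simp: \<S>_def)
  define J where "J = (SIGMA S:\<S>. PiE S R)"
  have finPi: "finite (PiE S R)" if "S \<in> \<S>" for S
    using \<S>[OF that] RD(2) by (intro finite_PiE) blast+
  then have finJ: "finite J" unfolding J_def by (intro finite_SigmaI fin\<S>)
  define \<theta> :: "complex set \<times> (complex \<Rightarrow> complex) \<Rightarrow> complex" where "\<theta> = (\<lambda>(S, a). \<Sum>p\<in>S. a p / p)"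
  define \<alpha> where "\<alpha> j = q\<^sub>1 * \<theta> j" for j
  define w where "w S = (\<Prod>p\<in>S. - 1 / complex_of_real (card (R p)))" for S
  define b where "b j = w (fst j) * ee (Re (q\<^sub>0 * \<theta> j))" for j
  define v where "v S = (\<Prod>p\<in>S. 1 / real (card (R p)))" for S
  define L where "L = (\<Sum>S\<in>\<S>. v S)"
  define M where "M = nat \<lceil>\<rho>\<rceil>"
  have M: "M \<ge> 1" "\<rho> \<le> real M" "real M \<le> 2 * \<rho>" unfolding M_def using D by linarith+
  have ge2: "gnorm p \<ge> 2" if "p \<in> P" for p using Prep[OF that] prime_reps_ge_2 by blast
  have prod_nz: "\<Prod>S \<noteq> 0" if "S \<in> \<S>" for S
  proof -
    have "0 \<notin> S" using \<S>[OF that] ge2[of 0] by (auto simp: gnorm_def)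
    then show ?thesis using \<S>(1)[OF that] by simp
  qed
  have prod_G: "\<Prod>S \<in> gauss_ints" if "S \<in> \<S>" for S
    using \<S>[OF that] prime_reps_gauss by (intro gauss_ints_prod) auto
  have aG: "a p \<in> gauss_ints" "\<not> gdvd p (a p)" if "S \<in> \<S>" "a \<in> PiE S R" "p \<in> S" for S a p
    using that \<S>(2)[OF that(1)] RD(1,4) PiE_mem by blast+
  \<comment> \<open>The denominators have modulus at most \<open>sqrt D\<close>, so modulo Gaussian
    integers two of the points differ by 0 or by at least \<open>1 / D\<close>. Difference 0 forces
    equal partial fractions; the factor \<open>q\<^sub>1\<close> is harmless because no prime of
    \<open>P\<close> divides it.\<close>
  have far: "j = j'" if j: "j \<in> J" "j' \<in> J" and g: "g \<in> gauss_ints" "cmod (\<alpha> j - \<alpha> j' - g) < 1 / D" for j j' g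
  proof -
    obtain S a S' a' where jj: "j = (S, a)" "j' = (S', a')" by (cases j, cases j')
    have S: "S \<in> \<S>" "a \<in> PiE S R" "S' \<in> \<S>" "a' \<in> PiE S' R" using j unfolding jj J_def by auto
    define z where "z = \<alpha> j - \<alpha> j' - g"
    have "z * (\<Prod>S * \<Prod>S') = q\<^sub>1 * ((\<Sum>p\<in>S. a p / p) * \<Prod>S) * \<Prod>S' - q\<^sub>1 * ((\<Sum>p\<in>S'. a' p / p) * \<Prod>S') * \<Prod>S - g * (\<Prod>S * \<Prod>S')"
      unfolding z_def \<alpha>_def \<theta>_def jj by (simp add: algebra_simps)
    moreover have "\<dots> \<in> gauss_ints"
      using S \<S> aG q g prod_G by (intro gauss_ints_diff gauss_ints_mult sum_fractions_gauss(2)) auto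
    ultimately have zG: "z * (\<Prod>S * \<Prod>S') \<in> gauss_ints" by simp
    have "z = 0"
    proof (rule ccontr)
      assume "z \<noteq> 0"
      then have "cmod (z * (\<Prod>S * \<Prod>S')) \<ge> 1" using zG prod_nz S by (intro norm_ge_1) auto
      moreover have "cmod (z * (\<Prod>S * \<Prod>S')) = cmod z * (cmod (\<Prod>S) * cmod (\<Prod>S'))" by (simp only: norm_mult)
      moreover have "cmod z * (cmod (\<Prod>S) * cmod (\<Prod>S')) \<le> cmod z * (sqrt D * sqrt D)"
        using \<S>(4)[OF S(1)] \<S>(4)[OF S(3)] gnorm_le_iff[of D] D by (intro mult_left_mono mult_mono) auto
      moreover have "cmod z * (sqrt D * sqrt D) < 1" using g(2) D unfolding z_def by (simp add: field_simps)
      ultimately show False by linarith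
    qed
    define U where "U = S \<union> S'"
    define d where "d p = (if p \<in> S then a p else 0) - (if p \<in> S' then a' p else 0)" for p
    have U: "finite U" "U \<subseteq> prime_reps" using \<S> S by (auto simp: U_def)
    have "(\<Sum>p\<in>U. d p / p) = (\<Sum>p\<in>U. (if p \<in> S then a p / p else 0)) - (\<Sum>p\<in>U. (if p \<in> S' then a' p / p else 0))"
      unfolding d_def sum_subtractf[symmetric] by (intro sum.cong) (auto simp: diff_divide_distrib)
    also have "(\<Sum>p\<in>U. (if p \<in> S then a p / p else 0)) = (\<Sum>p\<in>S. a p / p)"
      using U by (intro sum.mono_neutral_cong_right) (auto simp: U_def)
    also have "(\<Sum>p\<in>U. (if p \<in> S' then a' p / p else 0)) = (\<Sum>p\<in>S'. a' p / p)"
      using U by (intro sum.mono_neutral_cong_right) (auto simp: U_def)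
    finally have "(\<Sum>p\<in>U. d p / p) = \<theta> j - \<theta> j'" unfolding \<theta>_def jj by simp
    then have "q\<^sub>1 * (\<Sum>p\<in>U. d p / p) = g"
      using \<open>z = 0\<close> unfolding z_def \<alpha>_def by (simp only: right_diff_distrib) simp
    then have qG: "q\<^sub>1 * (\<Sum>p\<in>U. d p / p) \<in> gauss_ints" using g by simp
    have dG: "d p \<in> gauss_ints" for p
      using aG[OF S(1,2)] aG[OF S(3,4)] by (auto simp: d_def intro!: gauss_ints_closed)
    have dvd: "gdvd p (d p)" if "p \<in> U" for p
      using fraction_sum_gauss_imp_gdvd[OF U dG q(2) qG that] that S \<S>(2) P unfolding U_def by blast
    have iff: "p \<in> S \<longleftrightarrow> p \<in> S'" for p
    proof (rule ccontr)
      assume "(p \<in> S) \<noteq> (p \<in> S')"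
      then consider "p \<in> S" "p \<notin> S'" | "p \<in> S'" "p \<notin> S" by blast
      then show False
      proof cases
        case 1
        then show False using dvd[of p] aG(2)[OF S(1,2)] unfolding d_def U_def by auto
      next
        case 2
        then have "gdvd p (0 - a' p)" using dvd[of p] unfolding d_def U_def by auto
        then have "gdvd p (0 - (0 - a' p))" by (rule gdvd_diff[OF gdvd_0])
        then show False using 2 aG(2)[OF S(3,4)] by auto
      qed
    qed
    then have SS: "S = S'" by blast
    have "a = a'"
    proof (rule PiE_ext[OF S(2)])
      show "a' \<in> PiE S R" using S(4) SS by simp
      fix p assume p: "p \<in> S"
      then have "gdvd p (a p - a' p)" using dvd[of p] SS unfolding d_def U_def by auto
      moreover have "a p \<in> R p" "a' p \<in> R p" using S SS p PiE_mem by blast+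
      ultimately show "a p = a' p" using reduced_residue_system_eq[OF R] by blast
    qed
    then show ?thesis using SS jj by simp
  qed
  have count: "real (card {j \<in> J. \<exists>g\<in>gauss_ints. cmod (\<alpha> j - \<beta> - g) \<le> 1 / real (3 * M + 1)}) \<le> 1" for \<beta>
  proof -
    have "j = j'" if j: "j \<in> J" "g \<in> gauss_ints" "cmod (\<alpha> j - \<beta> - g) \<le> 1 / real (3 * M + 1)"
      "j' \<in> J" "g' \<in> gauss_ints" "cmod (\<alpha> j' - \<beta> - g') \<le> 1 / real (3 * M + 1)" for j j' g g'
    proof (rule far[OF j(1,4) gauss_ints_diff[OF j(2,5)]])
      have "\<alpha> j - \<alpha> j' - (g - g') = (\<alpha> j - \<beta> - g) - (\<alpha> j' - \<beta> - g')" by simp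
      then have "cmod (\<alpha> j - \<alpha> j' - (g - g')) \<le> cmod (\<alpha> j - \<beta> - g) + cmod (\<alpha> j' - \<beta> - g')"
        by (simp only: norm_triangle_ineq4)
      also have "\<dots> \<le> 2 / real (3 * M + 1)" using j by simp
      \<comment> \<open>Here \<open>D \<le> \<rho> \<le> M\<close> enters: at scale
        \<open>1 / (3 * M + 1)\<close> the points are separated, so the counting constant is
        1.\<close>
      also have "\<dots> < 1 / D" using M D by (simp add: divide_simps)
      finally show "cmod (\<alpha> j - \<alpha> j' - (g - g')) < 1 / D" .
    qed
    then have "\<forall>j\<in>{j \<in> J. \<exists>g\<in>gauss_ints. cmod (\<alpha> j - \<beta> - g) \<le> 1 / real (3 * M + 1)}.
      \<forall>j'\<in>{j \<in> J. \<exists>g\<in>gauss_ints. cmod (\<alpha> j - \<beta> - g) \<le> 1 / real (3 * M + 1)}. j = j'"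
      by blast
    then have "card {j \<in> J. \<exists>g\<in>gauss_ints. cmod (\<alpha> j - \<beta> - g) \<le> 1 / real (3 * M + 1)} \<le> Suc 0"
      using finJ by (subst card_le_Suc0_iff_eq) auto
    then show ?thesis by simp
  qed
  have cR: "real (card (R p)) > 0" if "p \<in> P" for p using RD(6)[OF that] by simp
  have v_pos: "v S > 0" if "S \<in> \<S>" for S
    unfolding v_def using \<S>(2)[OF that] cR by (intro prod_pos) auto
  have w_norm: "cmod (w S) = v S" if "S \<in> \<S>" for S
    unfolding w_def v_def by (simp add: prod_norm[symmetric] norm_divide)
  \<comment> \<open>The number of numerators belonging to \<open>S\<close> is the inverse of
    \<open>v S\<close> and cancels one of the two factors \<open>v S\<close>.\<close>
  have sumb: "(\<Sum>j\<in>J. (cmod (b j))^2) = L"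
  proof -
    have "(\<Sum>j\<in>J. (cmod (b j))^2) = (\<Sum>S\<in>\<S>. \<Sum>a\<in>PiE S R. (cmod (b (S, a)))^2)"
      unfolding J_def by (subst sum.Sigma) (use fin\<S> finPi in \<open>simp_all add: case_prod_unfold del: times_complex.sel\<close>)
    also have "\<dots> = (\<Sum>S\<in>\<S>. v S)"
    proof (rule sum.cong)
      fix S assume S: "S \<in> \<S>"
      have "(\<Sum>a\<in>PiE S R. (cmod (b (S, a)))^2) = real (card (PiE S R)) * (v S)^2"
        unfolding b_def by (simp add: norm_mult w_norm[OF S])
      also have "real (card (PiE S R)) = (\<Prod>p\<in>S. real (card (R p)))"
        using \<S>(1)[OF S] by (simp add: card_PiE)
      also have "\<dots> * (v S)^2 = (\<Prod>p\<in>S. real (card (R p)) * (1 / real (card (R p)))^2)"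
        unfolding v_def by (simp add: prod.distrib prod_power_distrib)
      also have "\<dots> = v S"
        unfolding v_def using \<S>(2)[OF S] RD(6) by (intro prod.cong) (auto simp: power2_eq_square)
      finally show "(\<Sum>a\<in>PiE S R. (cmod (b (S, a)))^2) = v S" .
    qed simp
    finally show ?thesis unfolding L_def .
  qed
  \<comment> \<open>The sum over numerators factors over the primes of \<open>S\<close> into
    Ramanujan sums, all equal to \<open>-1\<close> on the sifted set; together with the signs in
    \<open>w\<close> every term becomes the positive number \<open>v S\<close>.\<close>
  have const: "(\<Sum>j\<in>J. b j * ee (Re (s * \<alpha> j))) = of_real L" if s: "s \<in> A" for s
  proof -
    define x where "x = q\<^sub>0 + s * q\<^sub>1"
    have xG: "x \<in> gauss_ints" using s A q unfolding x_def by (auto intro!: gauss_ints_closed)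
    have "(\<Sum>j\<in>J. b j * ee (Re (s * \<alpha> j))) = (\<Sum>j\<in>J. w (fst j) * ee (Re (x * \<theta> j)))"
    proof (rule sum.cong)
      fix j
      have "x * \<theta> j = q\<^sub>0 * \<theta> j + s * \<alpha> j" unfolding x_def \<alpha>_def by (simp add: algebra_simps)
      then have "ee (Re (x * \<theta> j)) = ee (Re (q\<^sub>0 * \<theta> j)) * ee (Re (s * \<alpha> j))"
        by (simp only: plus_complex.sel ee_add)
      then show "b j * ee (Re (s * \<alpha> j)) = w (fst j) * ee (Re (x * \<theta> j))" unfolding b_def by simp
    qed simp
    also have "\<dots> = (\<Sum>S\<in>\<S>. \<Sum>a\<in>PiE S R. w S * ee (Re (x * \<theta> (S, a))))"
      unfolding J_def by (subst sum.Sigma) (use fin\<S> finPi in \<open>simp_all add: case_prod_unfold del: times_complex.sel\<close>)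
    also have "\<dots> = (\<Sum>S\<in>\<S>. of_real (v S))"
    proof (rule sum.cong)
      fix S assume S: "S \<in> \<S>"
      have "(\<Sum>a\<in>PiE S R. w S * ee (Re (x * \<theta> (S, a)))) =
          (\<Sum>a\<in>PiE S R. \<Prod>p\<in>S. - 1 / complex_of_real (card (R p)) * ee (Re (x * a p / p)))"
      proof (rule sum.cong)
        fix a
        have "Re (x * \<theta> (S, a)) = (\<Sum>p\<in>S. Re (x * a p / p))"
          unfolding \<theta>_def by (simp add: sum_distrib_left)
        then show "w S * ee (Re (x * \<theta> (S, a))) = (\<Prod>p\<in>S. - 1 / complex_of_real (card (R p)) * ee (Re (x * a p / p)))"
          unfolding w_def by (simp only: ee_sum[OF \<S>(1)[OF S]] prod.distrib)
      qed simp
      also have "\<dots> = (\<Prod>p\<in>S. \<Sum>r\<in>R p. - 1 / complex_of_real (card (R p)) * ee (Re (x * r / p)))"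
        using \<S>(1,2)[OF S] RD(2) by (intro prod_sum_PiE[symmetric]) auto
      also have "\<dots> = (\<Prod>p\<in>S. complex_of_real (1 / real (card (R p))))"
      proof (rule prod.cong)
        fix p assume "p \<in> S"
        then have p: "p \<in> P" using \<S>(2)[OF S] by blast
        have "(\<Sum>r\<in>R p. ee (Re (x * r / p))) = -1"
          using ramanujan_sum_prime[OF prime_repsD[OF Prep[OF p]] R xG] A(2)[OF s p] unfolding x_def by blast
        then show "(\<Sum>r\<in>R p. - 1 / complex_of_real (card (R p)) * ee (Re (x * r / p))) = complex_of_real (1 / real (card (R p)))"
          by (simp add: sum_distrib_left[symmetric] sum_negf sum_divide_distrib[symmetric])
      qed simp
      finally show "(\<Sum>a\<in>PiE S R. w S * ee (Re (x * \<theta> (S, a)))) = of_real (v S)"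
        unfolding v_def by simp
    qed simp
    finally show ?thesis unfolding L_def by simp
  qed
  have AB: "A \<subseteq> {n \<in> gauss_ints. \<bar>Re n\<bar> \<le> real M \<and> \<bar>Im n\<bar> \<le> real M}"
  proof
    fix s assume "s \<in> A"
    then have "s \<in> gauss_ints" "cmod s \<le> \<rho>" using A(1) by auto
    then show "s \<in> {n \<in> gauss_ints. \<bar>Re n\<bar> \<le> real M \<and> \<bar>Im n\<bar> \<le> real M}"
      using abs_Re_le_cmod[of s] abs_Im_le_cmod[of s] M(2) by simp
  qed
  have finB: "finite {n \<in> gauss_ints. \<bar>Re n\<bar> \<le> real M \<and> \<bar>Im n\<bar> \<le> real M}"
    by (rule finite_gauss_box) simp
  have L1: "L \<ge> smooth_density P D"
    unfolding L_def smooth_density_def \<S>_def[symmetric]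
  proof (rule sum_mono)
    fix S assume S: "S \<in> \<S>"
    have "1 / gnorm (\<Prod>S) = (\<Prod>p\<in>S. 1 / gnorm p)" unfolding gnorm_prod by (simp add: prod_dividef)
    also have "\<dots> \<le> v S" unfolding v_def
    proof (rule prod_mono)
      fix p assume "p \<in> S"
      then have p: "p \<in> P" using \<S>(2)[OF S] by blast
      then show "0 \<le> 1 / gnorm p \<and> 1 / gnorm p \<le> 1 / real (card (R p))"
        using RD(3)[OF p] cR[OF p] gnorm_nonneg by (auto intro!: divide_left_mono)
    qed
    finally show "1 / gnorm (\<Prod>S) \<le> v S" .
  qed
  have "{} \<in> \<S>" unfolding \<S>_def using D by simp
  then have "L > 0" unfolding L_def using v_pos fin\<S> by (intro sum_pos) auto
  \<comment> \<open>Every element of \<open>A\<close> contributes \<open>L^2\<close> to the mean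
    square, whose total is at most a multiple of \<open>\<rho>^2 * L\<close>; one factor
    \<open>L\<close> cancels.\<close>
  have "real (card A) * L^2 = (\<Sum>s\<in>A. (cmod (\<Sum>j\<in>J. b j * ee (Re (s * \<alpha> j))))^2)"
    using const by simp
  also have "\<dots> \<le> (\<Sum>s\<in>{n \<in> gauss_ints. \<bar>Re n\<bar> \<le> real M \<and> \<bar>Im n\<bar> \<le> real M}. (cmod (\<Sum>j\<in>J. b j * ee (Re (s * \<alpha> j))))^2)"
    using AB finB by (intro sum_mono2) auto
  also have "\<dots> \<le> 1440000 * 1 * real M ^ 2 * (\<Sum>j\<in>J. (cmod (b j))^2)"
    by (rule dual_large_sieve[OF finJ M(1) count])
  also have "\<dots> = 1440000 * real M ^ 2 * L" unfolding sumb by simp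
  also have "\<dots> \<le> 1440000 * (2 * \<rho>)^2 * L"
    using M \<open>L > 0\<close> by (intro mult_right_mono mult_left_mono power_mono) auto
  finally have "(real (card A) * L) * L \<le> (5760000 * \<rho>^2) * L" by (simp add: power2_eq_square)
  then have "real (card A) * L \<le> 5760000 * \<rho>^2" using \<open>L > 0\<close> by simp
  moreover have "real (card A) * smooth_density P D \<le> real (card A) * L" using L1 by (intro mult_left_mono) auto
  ultimately show ?thesis by linarith
qed

text \<open>Each \<open>n\<close> of norm at most \<open>D\<close> is a unit times a squarefree
  number times a square. Units and squares cost the factor \<open>144 = 4 * 36\<close>; separating
  the primes of the squarefree part according to whether they divide \<open>q\<close> produces the
  other two factors.\<close>

lemma smooth_density_ge:
  assumes q: "q \<noteq> 0" and D: "D > 0" and P: "P = {p \<in> prime_reps. gnorm p \<le> D \<and> \<not> gdvd p q}"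
  shows "ln (D / 2) / 4 \<le> 144 * smooth_density P D * (\<Prod>p\<in>{p \<in> prime_reps. gdvd p q}. 1 + 1 / gnorm p)"
proof -
  define P\<^sub>0 where "P\<^sub>0 = {p \<in> prime_reps. gnorm p \<le> D}"
  define P\<^sub>2 where "P\<^sub>2 = {p \<in> P\<^sub>0. gdvd p q}"
  define Dq where "Dq = {p \<in> prime_reps. gdvd p q}"
  have P0: "P \<union> P\<^sub>2 = P\<^sub>0" "P \<inter> P\<^sub>2 = {}" by (auto simp: P\<^sub>0_def P\<^sub>2_def P)
  have "finite P\<^sub>0" unfolding P\<^sub>0_def by (rule finite_prime_reps_le)
  moreover from this have "finite P\<^sub>2" "finite P" unfolding P0(1)[symmetric] by auto
  moreover have "finite Dq" unfolding Dq_def by (rule finite_prime_reps_gdvd[OF q])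
  ultimately have fin: "finite P\<^sub>0" "finite P\<^sub>2" "finite P" "finite Dq" by auto
  define \<T> where "\<T> = {S \<in> Pow P\<^sub>0. gnorm (\<Prod>S) \<le> D}"
  have ge2: "gnorm p \<ge> 2" if "p \<in> P\<^sub>0" for p using that prime_reps_ge_2 by (auto simp: P\<^sub>0_def)
  have gprod: "gnorm (\<Prod>S) \<ge> 1" if "S \<subseteq> P\<^sub>0" for S
    unfolding gnorm_prod using that ge2 by (intro prod_ge_1) force
  have fin\<T>: "finite \<T>" unfolding \<T>_def using fin by auto
  define X where "X = {1, -1, \<i>, -\<i>} \<times> \<T> \<times> nonzero_disc D"
  define f where "f = (\<lambda>(u :: complex, S :: complex set, m). u * \<Prod>S * m^2)"
  have finX: "finite X" unfolding X_def using fin\<T> finite_nonzero_disc by auto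
  have sub: "nonzero_disc D \<subseteq> f ` X"
  proof
    fix n assume "n \<in> nonzero_disc D"
    then have n: "n \<in> gauss_ints" "n \<noteq> 0" "gnorm n \<le> D" by (auto simp: nonzero_disc_def)
    obtain u S m where d: "gunit u" "finite S" "S \<subseteq> {p \<in> prime_reps. gdvd p n}" "m \<in> gauss_ints" "m \<noteq> 0"
      "n = u * \<Prod>S * m^2"
      using squarefree_decomposition[OF n(1,2)] by blast
    have S: "S \<subseteq> P\<^sub>0" using d(3) gdvd_imp_gnorm_le n unfolding P\<^sub>0_def by fastforce
    have N: "gnorm n = gnorm (\<Prod>S) * (gnorm m)^2"
      unfolding d(6) using d(1) by (simp add: gnorm_mult power2_eq_square gunit_iff)
    have m1: "gnorm m \<ge> 1" using gnorm_ge_1 d by blast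
    have m2: "(gnorm m)^2 \<ge> gnorm m" using m1 by (simp add: power2_eq_square)
    have "1 * (gnorm m)^2 \<le> gnorm n" unfolding N using gprod[OF S] by (intro mult_right_mono) auto
    then have mD: "gnorm m \<le> D" using m2 n by linarith
    have "gnorm (\<Prod>S) * 1 \<le> gnorm n" unfolding N using m1 m2 gnorm_nonneg by (intro mult_left_mono) auto
    then have "S \<in> \<T>" using S n unfolding \<T>_def by auto
    then have "(u, S, m) \<in> X" unfolding X_def using gunit_cases[OF d(1)] mD d by (auto simp: nonzero_disc_def)
    then show "n \<in> f ` X" using d(6) unfolding f_def by force
  qed
  have "ln (D / 2) / 4 \<le> (\<Sum>n\<in>nonzero_disc D. 1 / gnorm n)" by (rule sum_inverse_gnorm_ge[OF D])
  also have "\<dots> \<le> (\<Sum>n\<in>f ` X. 1 / gnorm n)" using finX sub gnorm_nonneg by (intro sum_mono2) auto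
  also have "\<dots> \<le> (\<Sum>x\<in>X. 1 / gnorm (f x))"
    using sum_image_le[OF finX, of "\<lambda>n. 1 / gnorm n" f] gnorm_nonneg by simp
  also have "\<dots> = (\<Sum>x\<in>X. 1 / gnorm (\<Prod>(fst (snd x))) * (1 / (gnorm (snd (snd x)))^2))"
  proof (rule sum.cong)
    fix x assume "x \<in> X"
    then have "gnorm (fst x) = 1" unfolding X_def gnorm_def by auto
    then show "1 / gnorm (f x) = 1 / gnorm (\<Prod>(fst (snd x))) * (1 / (gnorm (snd (snd x)))^2)"
      unfolding f_def by (simp add: case_prod_unfold gnorm_mult power2_eq_square)
  qed simp
  also have "\<dots> = (\<Sum>u\<in>{1, -1, \<i>, -\<i>}. \<Sum>S\<in>\<T>. \<Sum>m\<in>nonzero_disc D. 1 / gnorm (\<Prod>S) * (1 / (gnorm m)^2))"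
    unfolding X_def sum.cartesian_product by (simp add: case_prod_unfold)
  also have "\<dots> = 4 * ((\<Sum>S\<in>\<T>. 1 / gnorm (\<Prod>S)) * (\<Sum>m\<in>nonzero_disc D. 1 / (gnorm m)^2))"
  proof -
    have "card {1, -1, \<i>, -\<i>} = 4" by (auto simp: complex_eq_iff)
    then show ?thesis by (simp only: sum_constant sum_product of_nat_numeral)
  qed
  also have "\<dots> \<le> 4 * ((\<Sum>S\<in>\<T>. 1 / gnorm (\<Prod>S)) * 36)"
    using gnorm_nonneg by (intro mult_left_mono sum_inverse_gnorm_square_le sum_nonneg) auto
  also have "\<dots> = 144 * (\<Sum>S\<in>\<T>. 1 / gnorm (\<Prod>S))" by simp
  also have "(\<Sum>S\<in>\<T>. 1 / gnorm (\<Prod>S)) \<le> smooth_density P D * (\<Sum>S\<in>Pow P\<^sub>2. 1 / gnorm (\<Prod>S))"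
  proof -
    define \<S> where "\<S> = {S \<in> Pow P. gnorm (\<Prod>S) \<le> D}"
    define h where "h S = (S \<inter> P, S \<inter> P\<^sub>2)" for S
    have split: "gnorm (\<Prod>S) = gnorm (\<Prod>(S \<inter> P)) * gnorm (\<Prod>(S \<inter> P\<^sub>2))" if "S \<in> \<T>" for S
    proof -
      have "S = (S \<inter> P) \<union> (S \<inter> P\<^sub>2)" using that P0 by (auto simp: \<T>_def)
      moreover have "\<Prod>((S \<inter> P) \<union> (S \<inter> P\<^sub>2)) = \<Prod>(S \<inter> P) * \<Prod>(S \<inter> P\<^sub>2)"
        using fin P0 by (intro prod.union_disjoint) auto
      ultimately show ?thesis using gnorm_mult by metis
    qed
    have inj: "inj_on h \<T>"
    proof (rule inj_onI)
      fix S T assume "S \<in> \<T>" "T \<in> \<T>" "h S = h T"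
      then have "(S \<inter> P) \<union> (S \<inter> P\<^sub>2) = (T \<inter> P) \<union> (T \<inter> P\<^sub>2)" "S \<subseteq> P \<union> P\<^sub>2" "T \<subseteq> P \<union> P\<^sub>2"
        using P0 by (auto simp: h_def \<T>_def)
      then show "S = T" by blast
    qed
    have "(\<Sum>S\<in>\<T>. 1 / gnorm (\<Prod>S)) = (\<Sum>S\<in>\<T>. 1 / gnorm (\<Prod>(fst (h S))) * (1 / gnorm (\<Prod>(snd (h S)))))"
      using split unfolding h_def by (intro sum.cong) auto
    also have "\<dots> = (\<Sum>z\<in>h ` \<T>. 1 / gnorm (\<Prod>(fst z)) * (1 / gnorm (\<Prod>(snd z))))"
      using inj by (simp add: sum.reindex)
    also have "\<dots> \<le> (\<Sum>z\<in>\<S> \<times> Pow P\<^sub>2. 1 / gnorm (\<Prod>(fst z)) * (1 / gnorm (\<Prod>(snd z))))"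
    proof (rule sum_mono2)
      show "finite (\<S> \<times> Pow P\<^sub>2)" using fin by (auto simp: \<S>_def)
      show "h ` \<T> \<subseteq> \<S> \<times> Pow P\<^sub>2"
      proof (rule image_subsetI)
        fix S assume S: "S \<in> \<T>"
        have "gnorm (\<Prod>(S \<inter> P)) * 1 \<le> gnorm (\<Prod>S)"
          unfolding split[OF S] using gprod[of "S \<inter> P\<^sub>2"] gnorm_nonneg P0 by (intro mult_left_mono) auto
        then show "h S \<in> \<S> \<times> Pow P\<^sub>2" using S by (auto simp: h_def \<S>_def \<T>_def)
      qed
    qed (use gnorm_nonneg in auto)
    also have "\<dots> = (\<Sum>S\<in>\<S>. 1 / gnorm (\<Prod>S)) * (\<Sum>S\<in>Pow P\<^sub>2. 1 / gnorm (\<Prod>S))"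
      unfolding sum_product sum.cartesian_product by (simp only: case_prod_unfold)
    finally show ?thesis unfolding smooth_density_def \<S>_def .
  qed
  also have "(\<Sum>S\<in>Pow P\<^sub>2. 1 / gnorm (\<Prod>S)) = (\<Prod>p\<in>P\<^sub>2. 1 / gnorm p + 1)"
    unfolding prod_add[OF fin(2)] gnorm_prod by (simp add: prod_dividef)
  also have "\<dots> \<le> (\<Prod>p\<in>Dq. 1 / gnorm p + 1)"
    using fin gnorm_nonneg by (intro prod_mono2) (auto simp: Dq_def P\<^sub>2_def P\<^sub>0_def)
  finally show ?thesis
    unfolding smooth_density_def Dq_def by (simp add: mult_left_mono sum_nonneg gnorm_nonneg add.commute mult.assoc)
qed

section \<open>Fractions with prime denominator close to a point\<close>

text \<open>Pigeonhole principle: \<open>(m + 1)^2\<close> multiples of \<open>\<alpha>\<close>,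
  taken modulo Gaussian integers, fall into \<open>m^2\<close> cells of side
  \<open>1 / m\<close>.\<close>

lemma gauss_dirichlet_approximation:
  assumes "m \<ge> 1"
  obtains q c where "q \<in> gauss_ints" "c \<in> gauss_ints" "q \<noteq> 0" "cmod q \<le> 2 * real m" "cmod (c - \<alpha> * q) \<le> 2 / real m"
proof -
  define z where "z = (\<lambda>x :: nat \<times> nat. Complex (real (fst x)) (real (snd x)))"
  define f where "f x = (\<lfloor>real m * frac (Re (\<alpha> * z x))\<rfloor>, \<lfloor>real m * frac (Im (\<alpha> * z x))\<rfloor>)" for x
  define B where "B = {..m} \<times> {..m}"
  have cell: "\<lfloor>real m * frac t\<rfloor> \<in> {0..<int m}" for t
  proof -
    have "real m * frac t < real m * 1" using assms frac_lt_1[of t] by (intro mult_strict_left_mono) auto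
    then show ?thesis using frac_ge_0[of t] by (auto simp: floor_less_iff)
  qed
  have "f ` B \<subseteq> {0..<int m} \<times> {0..<int m}" using cell unfolding f_def by auto
  then have "card (f ` B) \<le> card ({0..<int m} \<times> {0..<int m})" by (intro card_mono) auto
  also have "\<dots> = m * m" by (simp add: card_cartesian_product)
  also have "\<dots> < (m + 1) * (m + 1)" by simp
  also have "\<dots> = card B" unfolding B_def by (simp add: card_cartesian_product)
  finally have "\<not> inj_on f B" by (rule pigeonhole)
  then obtain x y where xy: "x \<in> B" "y \<in> B" "x \<noteq> y" "f x = f y" unfolding inj_on_def by blast
  define q where "q = z x - z y"
  define c where "c = Complex (of_int (\<lfloor>Re (\<alpha> * z x)\<rfloor> - \<lfloor>Re (\<alpha> * z y)\<rfloor>)) (of_int (\<lfloor>Im (\<alpha> * z x)\<rfloor> - \<lfloor>Im (\<alpha> * z y)\<rfloor>))"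
  have near: "\<bar>frac s - frac t\<bar> \<le> 1 / real m" if "\<lfloor>real m * frac s\<rfloor> = \<lfloor>real m * frac t\<rfloor>" for s t
  proof -
    have "\<bar>real m * frac s - real m * frac t\<bar> \<le> 1" using that by linarith
    then have "real m * \<bar>frac s - frac t\<bar> \<le> 1" by (simp add: abs_mult flip: right_diff_distrib)
    then show ?thesis using assms by (simp add: field_simps)
  qed
  have "q \<in> gauss_ints" unfolding q_def z_def gauss_ints_def by auto
  moreover have "c \<in> gauss_ints" unfolding c_def by (rule gauss_ints_Complex)
  moreover have "q \<noteq> 0" using xy(3) unfolding q_def z_def by (auto simp: prod_eq_iff complex_eq_iff)
  moreover have "cmod q \<le> 2 * real m"
  proof -
    have "cmod q \<le> \<bar>Re q\<bar> + \<bar>Im q\<bar>" by (rule cmod_le)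
    moreover have "\<bar>Re q\<bar> \<le> real m" "\<bar>Im q\<bar> \<le> real m" using xy(1,2) unfolding q_def z_def B_def by auto
    ultimately show ?thesis by linarith
  qed
  moreover have "cmod (c - \<alpha> * q) \<le> 2 / real m"
  proof -
    have "\<alpha> * q = \<alpha> * z x - \<alpha> * z y" unfolding q_def by (rule right_diff_distrib)
    then have "Re (c - \<alpha> * q) = frac (Re (\<alpha> * z y)) - frac (Re (\<alpha> * z x))"
      "Im (c - \<alpha> * q) = frac (Im (\<alpha> * z y)) - frac (Im (\<alpha> * z x))"
      unfolding c_def frac_def by (simp_all del: times_complex.sel)
    moreover have "\<bar>frac (Re (\<alpha> * z y)) - frac (Re (\<alpha> * z x))\<bar> \<le> 1 / real m"
      "\<bar>frac (Im (\<alpha> * z y)) - frac (Im (\<alpha> * z x))\<bar> \<le> 1 / real m"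
      using xy(4) unfolding f_def by (intro near; simp)+
    ultimately show ?thesis using cmod_le[of "c - \<alpha> * q"] by simp
  qed
  ultimately show ?thesis by (rule that)
qed

text \<open>Division by a gcd, whose modulus is at least 1, keeps both bounds. The Bezout
  coefficients are retained because they serve as coordinates on the lines.\<close>

lemma gauss_dirichlet_approximation_coprime:
  assumes "m \<ge> 1"
  obtains q c u v where "q \<in> gauss_ints" "c \<in> gauss_ints" "u \<in> gauss_ints" "v \<in> gauss_ints"
    "q * u + c * v = 1" "q \<noteq> 0" "cmod q \<le> 2 * real m" "cmod (c - \<alpha> * q) \<le> 2 / real m"
proof -
  obtain q c where qc: "q \<in> gauss_ints" "c \<in> gauss_ints" "q \<noteq> 0" "cmod q \<le> 2 * real m" "cmod (c - \<alpha> * q) \<le> 2 / real m"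
    using gauss_dirichlet_approximation[OF assms] .
  obtain g u v where g: "g \<in> gauss_ints" "u \<in> gauss_ints" "v \<in> gauss_ints" "g = q * u + c * v" "gdvd g q" "gdvd g c" "g \<noteq> 0"
    using gauss_bezout[OF qc(1,2,3)] .
  obtain q' where q': "q' \<in> gauss_ints" "q = g * q'" using g(5) unfolding gdvd_def by blast
  obtain c' where c': "c' \<in> gauss_ints" "c = g * c'" using g(6) unfolding gdvd_def by blast
  have shrink: "cmod z \<le> cmod (g * z)" for z
    using mult_right_mono[OF norm_ge_1[OF g(1,7)], of "cmod z"] by (simp add: norm_mult)
  have "g * (q' * u + c' * v) = g * 1" using g(4) q' c' by (simp add: distrib_left mult.assoc)
  then have "q' * u + c' * v = 1" using g(7) by simp
  moreover have "cmod q' \<le> 2 * real m" using shrink[of q'] qc(4) q' by simp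
  moreover have "cmod (c' - \<alpha> * q') \<le> 2 / real m"
  proof -
    have "g * (c' - \<alpha> * q') = c - \<alpha> * q" unfolding q' c' by (simp add: algebra_simps)
    then show ?thesis using shrink[of "c' - \<alpha> * q'"] qc(5) by simp
  qed
  moreover have "q' \<noteq> 0" using q' qc by auto
  ultimately show ?thesis using that[of q' c' u v] q' c' g by blast
qed

text \<open>Clearing the denominator turns fractions into lattice points. The numerator is not
  reduced modulo \<open>q\<close>: nearness modulo Gaussian integers is absorbed by a shift of
  \<open>c\<close>.\<close>

definition near_fractions :: "real \<Rightarrow> real \<Rightarrow> complex \<Rightarrow> (complex \<times> complex) set" where
  "near_fractions Q N \<alpha> = {(q, c). gprime q \<and> gnorm q \<le> Q \<and> c \<in> gauss_ints \<and> \<not> gdvd q c \<and>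
     cmod (c - \<alpha> * q) \<le> cmod q / sqrt N}"

lemma near_fractions_subset:
  assumes "N > 0" "0 \<le> Q" "Q \<le> 16 * N"
  shows "near_fractions Q N \<alpha> \<subseteq> (SIGMA q:{q \<in> gauss_ints. gnorm q \<le> Q}. {c \<in> gauss_ints. cmod (c - \<alpha> * q) \<le> 4})"
proof
  fix x assume "x \<in> near_fractions Q N \<alpha>"
  then obtain q c where x: "x = (q, c)" "gprime q" "gnorm q \<le> Q" "c \<in> gauss_ints" "cmod (c - \<alpha> * q) \<le> cmod q / sqrt N"
    unfolding near_fractions_def by blast
  have "cmod q \<le> sqrt Q" using x(3) gnorm_le_iff assms(2) by blast
  also have "\<dots> \<le> sqrt (16 * N)" using assms(3) by simp
  also have "\<dots> = 4 * sqrt N" by (simp add: real_sqrt_mult)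
  finally have "cmod q / sqrt N \<le> 4" using assms(1) by (simp add: field_simps)
  then show "x \<in> (SIGMA q:{q \<in> gauss_ints. gnorm q \<le> Q}. {c \<in> gauss_ints. cmod (c - \<alpha> * q) \<le> 4})"
    using x gprimeD(1) by auto
qed

lemma finite_near_fractions:
  assumes "N > 0" "0 \<le> Q" "Q \<le> 16 * N"
  shows "finite (near_fractions Q N \<alpha>)"
  by (rule finite_subset[OF near_fractions_subset[OF assms]])
    (intro finite_SigmaI finite_gnorm_le gauss_disc_finite_card(1), simp)

text \<open>Solutions lie on few lines: for a coprime pair \<open>(q\<^sub>1, c\<^sub>1)\<close> with \<open>c\<^sub>1/q\<^sub>1\<close> close to \<open>\<alpha>\<close>, the
  determinant \<open>c\<^sub>1 q - q\<^sub>1 c\<close> is small, and on the line where it has a given value \<open>q\<close> runs through a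
  progression modulo \<open>q\<^sub>1\<close>, to which the sieve applies.\<close>
lemma card_near_fractions_le:
  assumes Q: "Q \<ge> 16" and N: "N \<ge> 1" "Q \<le> 16 * N" "16 * N < Q^2"
  shows "real (card (near_fractions Q N \<alpha>)) \<le> 10^17 * (Q^2 / N * ln (ln Q) / ln (Q^2 / (16 * N)))"
proof -
  define W where "W = near_fractions Q N \<alpha>"
  have W: "gprime q" "gnorm q \<le> Q" "c \<in> gauss_ints" "\<not> gdvd q c" "cmod (c - \<alpha> * q) \<le> cmod q / sqrt N"
    if "(q, c) \<in> W" for q c using that unfolding W_def near_fractions_def by auto
  have finW: "finite W" unfolding W_def using assms by (intro finite_near_fractions) auto
  define T where "T = sqrt Q"
  \<comment> \<open>The choice \<open>r = N^(1/4)\<close> balances Dirichlet's theorem: relative to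
    the bounds \<open>T\<close> and \<open>T / sqrt N\<close> of the region,
    \<open>q\<^sub>1\<close> and \<open>c\<^sub>1 - \<alpha> * q\<^sub>1\<close> both come out as
    \<open>O(r / T)\<close>, which is \<open>O(1 / D)\<close>.\<close>
  define r where "r = sqrt (sqrt N)"
  define D where "D = T / r"
  have r: "r \<ge> 1" "r^2 = sqrt N" unfolding r_def using N by simp_all
  have T: "T > 0" "T^2 = Q" unfolding T_def using Q by simp_all
  have D4: "D^4 = Q^2 / N"
  proof -
    have "r^4 = (r^2)^2" "T^4 = (T^2)^2" by simp_all
    then show ?thesis unfolding D_def power_divide T(2) r(2) using N by simp
  qed
  have "D^4 \<ge> 2^4" unfolding D4 using N by (simp add: field_simps)
  moreover have D0: "D > 0" unfolding D_def using T r by simp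
  ultimately have D2: "D \<ge> 2" by (meson power_le_imp_le_base less_imp_le not_le power_strict_mono zero_less_numeral)
  define \<Lambda> where "\<Lambda> = ln (Q^2 / (16 * N))"
  have "Q^2 / (16 * N) = (D / 2)^4" using D4 by (simp add: power_divide)
  then have \<Lambda>: "\<Lambda> = 4 * ln (D / 2)" unfolding \<Lambda>_def using D0 by (simp add: ln_realpow)
  have \<Lambda>0: "\<Lambda> > 0" unfolding \<Lambda>_def using N by (intro ln_gt_zero) (simp add: field_simps)
  define l where "l = ln (ln Q)"
  have l: "l \<ge> 1/2" unfolding l_def using ln_ln_ge_half Q by blast
  define m where "m = nat \<lceil>r\<rceil>"
  have m: "m \<ge> 1" "r \<le> real m" "real m \<le> 2 * r" unfolding m_def using r by linarith+
  obtain q\<^sub>1 c\<^sub>1 u v where q1: "q\<^sub>1 \<in> gauss_ints" "c\<^sub>1 \<in> gauss_ints" "u \<in> gauss_ints" "v \<in> gauss_ints"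
    "q\<^sub>1 * u + c\<^sub>1 * v = 1" "q\<^sub>1 \<noteq> 0" "cmod q\<^sub>1 \<le> 2 * real m" "cmod (c\<^sub>1 - \<alpha> * q\<^sub>1) \<le> 2 / real m"
    using gauss_dirichlet_approximation_coprime[OF m(1)] .
  \<comment> \<open>The size of the short vector relative to the region, that is the least number
    for which both bounds in \<open>\<mu>1\<close> hold.\<close>
  define \<mu> where "\<mu> = max (cmod q\<^sub>1 / T) (cmod (c\<^sub>1 - \<alpha> * q\<^sub>1) * sqrt N / T)"
  have \<mu>0: "\<mu> > 0" unfolding \<mu>_def using q1(6) T by (simp add: less_max_iff_disj)
  have \<mu>1: "cmod q\<^sub>1 \<le> \<mu> * T" "cmod (c\<^sub>1 - \<alpha> * q\<^sub>1) \<le> \<mu> * T / sqrt N"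
    using max.cobounded1[of "cmod q\<^sub>1 / T" "cmod (c\<^sub>1 - \<alpha> * q\<^sub>1) * sqrt N / T"]
      max.cobounded2[of "cmod (c\<^sub>1 - \<alpha> * q\<^sub>1) * sqrt N / T" "cmod q\<^sub>1 / T"] T N
    unfolding \<mu>_def[symmetric] by (simp_all add: field_simps)
  have "\<mu> \<le> 4 / D"
    unfolding \<mu>_def D_def
  proof (rule max.boundedI)
    show "cmod q\<^sub>1 / T \<le> 4 / (T / r)" using q1(7) m(3) T r by (simp add: field_simps)
    have "cmod (c\<^sub>1 - \<alpha> * q\<^sub>1) \<le> 2 / real m" by (rule q1(8))
    also have "\<dots> \<le> 2 / r" using m r by (intro divide_left_mono) auto
    finally have "cmod (c\<^sub>1 - \<alpha> * q\<^sub>1) * sqrt N / T \<le> 2 / r * sqrt N / T"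
      using T N by (intro divide_right_mono mult_right_mono) auto
    also have "\<dots> = 2 * r / T" unfolding r(2)[symmetric] using r(1) by (simp add: power2_eq_square)
    also have "\<dots> \<le> 4 / (T / r)" using T r by (simp add: field_simps)
    finally show "cmod (c\<^sub>1 - \<alpha> * q\<^sub>1) * sqrt N / T \<le> 4 / (T / r)" .
  qed
  \<comment> \<open>Steps along a line have length at most \<open>2 / \<mu>\<close>; the larger
    radius \<open>4 / \<mu>\<close> also satisfies \<open>D \<le> \<rho>\<close>, as the sieve
    demands.\<close>
  define \<rho> where "\<rho> = 4 / \<mu>"
  have D\<rho>: "D \<le> \<rho>" unfolding \<rho>_def using \<open>\<mu> \<le> 4 / D\<close> \<mu>0 D0 by (simp add: field_simps)
  define P where "P = {p \<in> prime_reps. gnorm p \<le> D \<and> \<not> gdvd p q\<^sub>1}"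
  define L where "L = smooth_density P D"
  \<comment> \<open>\<open>ln (D / 2) / 4 = \<Lambda> / 16\<close>, and
    \<open>16 * 144 * 13000 = 29952000\<close>.\<close>
  have L: "\<Lambda> \<le> 29952000 * L * l"
  proof -
    have "gnorm q\<^sub>1 \<le> Q^2"
    proof -
      have "cmod q\<^sub>1 \<le> 4 * r" using q1(7) m(3) by linarith
      then have "gnorm q\<^sub>1 \<le> (4 * r)^2" unfolding gnorm_eq by (intro power_mono) auto
      also have "\<dots> = 16 * sqrt N" unfolding power_mult_distrib r(2) by simp
      also have "\<dots> \<le> 16 * sqrt (Q^2)" using N by (intro mult_left_mono real_sqrt_le_mono) auto
      also have "\<dots> \<le> Q^2" using Q by (simp add: power2_eq_square mult_right_mono)
      finally show ?thesis .
    qed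
    then have "(\<Prod>p\<in>{p \<in> prime_reps. gdvd p q\<^sub>1}. 1 + 1 / gnorm p) \<le> 13000 * l"
      unfolding l_def by (intro prod_prime_divisors_le q1 Q)
    moreover have "L \<ge> 0" unfolding L_def smooth_density_def using gnorm_nonneg by (intro sum_nonneg) auto
    ultimately have "144 * L * (\<Prod>p\<in>{p \<in> prime_reps. gdvd p q\<^sub>1}. 1 + 1 / gnorm p) \<le> 144 * L * (13000 * l)"
      by (intro mult_left_mono) auto
    then have "ln (D / 2) / 4 \<le> 144 * L * (13000 * l)"
      using smooth_density_ge[OF q1(6) D0 P_def] unfolding L_def by linarith
    then show ?thesis unfolding \<Lambda> by simp
  qed
  have L0: "L > 0"
  proof (rule ccontr)
    assume "\<not> L > 0"
    then have "29952000 * L * l \<le> 0" using l by (intro mult_nonpos_nonneg[of "29952000 * L" l]) auto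
    then show False using L \<Lambda>0 by linarith
  qed
  \<comment> \<open>By the Bezout identity a vector parallel to
    \<open>(q\<^sub>1, c\<^sub>1)\<close> is a multiple of it, with a multiplier that is a Gaussian
    integer whenever \<open>x\<close> and \<open>y\<close> are.\<close>
  have param: "x = q\<^sub>1 * (x * u + y * v)" "y = c\<^sub>1 * (x * u + y * v)" if "c\<^sub>1 * x = q\<^sub>1 * y" for x y
  proof -
    have "x = x * (q\<^sub>1 * u + c\<^sub>1 * v)" unfolding q1(5) by simp
    also have "\<dots> = q\<^sub>1 * x * u + (c\<^sub>1 * x) * v" by (simp add: algebra_simps)
    finally show "x = q\<^sub>1 * (x * u + y * v)" unfolding that by (simp add: algebra_simps)
    have "y = y * (q\<^sub>1 * u + c\<^sub>1 * v)" unfolding q1(5) by simp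
    also have "\<dots> = (q\<^sub>1 * y) * u + c\<^sub>1 * y * v" by (simp add: algebra_simps)
    finally show "y = c\<^sub>1 * (x * u + y * v)" unfolding that[symmetric] by (simp add: algebra_simps)
  qed
  define t where "t = (\<lambda>(q, c). c\<^sub>1 * q - q\<^sub>1 * c)"
  define W\<^sub>0 where "W\<^sub>0 = {x \<in> W. t x = 0}"
  \<comment> \<open>A prime \<open>q\<close> of norm at most \<open>D\<close> may be associated to a
    sieving prime and so escape the sieve; these pairs are few and are counted trivially.\<close>
  define W\<^sub>1 where "W\<^sub>1 = {x \<in> W. gnorm (fst x) \<le> D}"
  define W\<^sub>2 where "W\<^sub>2 \<tau> = {x \<in> W. gnorm (fst x) > D \<and> t x = \<tau>}" for \<tau>
  define E where "E = nonzero_disc (4 * \<mu>^2 * (Q^2 / N))"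
  \<comment> \<open>Determinant 0 makes \<open>(q, c)\<close> a multiple \<open>w\<close> of
    \<open>(q\<^sub>1, c\<^sub>1)\<close>. Since \<open>q\<close> is prime and does not divide
    \<open>c\<close>, the common divisor \<open>w\<close> is a unit.\<close>
  have c0: "real (card W\<^sub>0) \<le> 4"
  proof -
    have "W\<^sub>0 \<subseteq> (\<lambda>w. (q\<^sub>1 * w, c\<^sub>1 * w)) ` {1, -1, \<i>, -\<i>}"
    proof
      fix x assume x: "x \<in> W\<^sub>0"
      obtain q c where qc: "x = (q, c)" by (cases x)
      have x': "(q, c) \<in> W" "c\<^sub>1 * q = q\<^sub>1 * c" using x unfolding W\<^sub>0_def t_def qc by auto
      note Wx = W[OF x'(1)]
      define w where "w = q * u + c * v"
      have w: "q = q\<^sub>1 * w" "c = c\<^sub>1 * w" using param[OF x'(2)] unfolding w_def by auto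
      have wG: "w \<in> gauss_ints" unfolding w_def using Wx gprimeD(1) q1 by (auto intro!: gauss_ints_closed)
      have "gdvd w q" "gdvd w c"
        using gdvdI[OF q1(1), of q w] gdvdI[OF q1(2), of c w] w by (simp_all only: mult.commute)
      then have "gunit w" using gprime_gdvd_cases[OF Wx(1) wG] Wx(4) gdvd_trans by blast
      then show "x \<in> (\<lambda>w. (q\<^sub>1 * w, c\<^sub>1 * w)) ` {1, -1, \<i>, -\<i>}" using gunit_cases w qc by blast
    qed
    then have "card W\<^sub>0 \<le> card ((\<lambda>w. (q\<^sub>1 * w, c\<^sub>1 * w)) ` {1, -1, \<i>, -\<i>})" by (intro card_mono) auto
    also have "\<dots> \<le> card {1, -1, \<i>, -\<i>}" by (intro card_image_le) auto
    also have "\<dots> \<le> 4" by (simp add: card_insert_if)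
    finally show ?thesis by simp
  qed
  have c1: "real (card W\<^sub>1) \<le> 729 * D"
  proof -
    define X where "X = {q \<in> gauss_ints. gnorm q \<le> D}"
    define Y where "Y q = {c \<in> gauss_ints. cmod (c - \<alpha> * q) \<le> 4}" for q
    have fin: "finite X" "finite (Y q)" for q
      unfolding X_def Y_def by (intro finite_gnorm_le) (intro gauss_disc_finite_card(1), simp)
    have "near_fractions Q N \<alpha> \<subseteq> (SIGMA q:{q \<in> gauss_ints. gnorm q \<le> Q}. {c \<in> gauss_ints. cmod (c - \<alpha> * q) \<le> 4})"
      using Q N by (intro near_fractions_subset) auto
    then have "W\<^sub>1 \<subseteq> Sigma X Y" unfolding W\<^sub>1_def W_def X_def Y_def by auto
    then have "card W\<^sub>1 \<le> card (Sigma X Y)" using fin by (intro card_mono) auto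
    also have "\<dots> = (\<Sum>q\<in>X. card (Y q))" using fin by simp
    finally have "real (card W\<^sub>1) \<le> (\<Sum>q\<in>X. real (card (Y q)))" by (simp flip: of_nat_sum)
    also have "\<dots> \<le> (\<Sum>q\<in>X. 81)"
      using gauss_disc_finite_card(2)[of 4] unfolding Y_def by (intro sum_mono) (force)
    also have "\<dots> \<le> 81 * (9 * D)" using card_gnorm_le[of D] D2 unfolding X_def by simp
    finally show ?thesis by simp
  qed
  have c2: "real (card (W\<^sub>2 \<tau>)) \<le> 92160000 / (\<mu>^2 * L)" for \<tau>
  proof (cases "W\<^sub>2 \<tau> = {}")
    case True
    then show ?thesis using L0 by simp
  next
    case False
    then obtain q\<^sub>0 c\<^sub>0 where 0: "(q\<^sub>0, c\<^sub>0) \<in> W\<^sub>2 \<tau>" by auto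
    then have 0: "(q\<^sub>0, c\<^sub>0) \<in> W" "c\<^sub>1 * q\<^sub>0 - q\<^sub>1 * c\<^sub>0 = \<tau>" unfolding W\<^sub>2_def t_def by auto
    note W0 = W[OF 0(1)]
    have bnd: "cmod q \<le> T" "cmod (c - \<alpha> * q) \<le> T / sqrt N" if "(q, c) \<in> W" for q c
    proof -
      show *: "cmod q \<le> T" using W(2)[OF that] gnorm_le_iff Q unfolding T_def by auto
      show "cmod (c - \<alpha> * q) \<le> T / sqrt N"
        using W(5)[OF that] divide_right_mono[OF *, of "sqrt N"] N by simp
    qed
    \<comment> \<open>The position on the line, measured from the base point
      \<open>(q\<^sub>0, c\<^sub>0)\<close> in multiples of
      \<open>(q\<^sub>1, c\<^sub>1)\<close>.\<close>
    define h where "h = (\<lambda>(q, c). (q - q\<^sub>0) * u + (c - c\<^sub>0) * v)"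
    have h: "q = q\<^sub>0 + h (q, c) * q\<^sub>1" "c = c\<^sub>0 + h (q, c) * c\<^sub>1" "h (q, c) \<in> gauss_ints" "cmod (h (q, c)) \<le> \<rho>"
      if "(q, c) \<in> W\<^sub>2 \<tau>" for q c
    proof -
      have qc: "(q, c) \<in> W" "c\<^sub>1 * q - q\<^sub>1 * c = \<tau>" using that unfolding W\<^sub>2_def t_def by auto
      define w where "w = (q - q\<^sub>0) * u + (c - c\<^sub>0) * v"
      have "c\<^sub>1 * (q - q\<^sub>0) = q\<^sub>1 * (c - c\<^sub>0)"
        using trans[OF qc(2) 0(2)[symmetric]] by (simp add: algebra_simps)
      then have w: "q - q\<^sub>0 = q\<^sub>1 * w" "c - c\<^sub>0 = c\<^sub>1 * w" unfolding w_def by (rule param)+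
      have hw: "h (q, c) = w" unfolding h_def w_def by simp
      show "q = q\<^sub>0 + h (q, c) * q\<^sub>1" "c = c\<^sub>0 + h (q, c) * c\<^sub>1"
        unfolding hw using w by (simp_all add: algebra_simps)
      show "h (q, c) \<in> gauss_ints"
        unfolding hw w_def using W[OF qc(1)] W0 gprimeD(1) q1 by (auto intro!: gauss_ints_closed)
      have 1: "cmod w * cmod q\<^sub>1 \<le> 2 * T"
      proof -
        have "cmod w * cmod q\<^sub>1 = cmod (q - q\<^sub>0)" unfolding w(1) by (simp add: norm_mult)
        also have "\<dots> \<le> cmod q + cmod q\<^sub>0" by (rule norm_triangle_ineq4)
        finally show ?thesis using bnd(1)[OF qc(1)] bnd(1)[OF 0(1)] by linarith
      qed
      have 2: "cmod w * cmod (c\<^sub>1 - \<alpha> * q\<^sub>1) \<le> 2 * (T / sqrt N)"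
      proof -
        have "w * (c\<^sub>1 - \<alpha> * q\<^sub>1) = (c - c\<^sub>0) - \<alpha> * (q - q\<^sub>0)" unfolding w by (simp add: algebra_simps)
        also have "\<dots> = (c - \<alpha> * q) - (c\<^sub>0 - \<alpha> * q\<^sub>0)" by (simp add: algebra_simps)
        finally have "cmod w * cmod (c\<^sub>1 - \<alpha> * q\<^sub>1) = cmod ((c - \<alpha> * q) - (c\<^sub>0 - \<alpha> * q\<^sub>0))"
          by (simp flip: norm_mult)
        also have "\<dots> \<le> cmod (c - \<alpha> * q) + cmod (c\<^sub>0 - \<alpha> * q\<^sub>0)" by (rule norm_triangle_ineq4)
        finally show ?thesis using bnd(2)[OF qc(1)] bnd(2)[OF 0(1)] by linarith
      qed
      have "cmod w * \<mu> \<le> 2"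
      proof -
        have "cmod w * (cmod q\<^sub>1 / T) \<le> 2" using 1 T by (simp add: field_simps)
        moreover have "cmod w * (cmod (c\<^sub>1 - \<alpha> * q\<^sub>1) * sqrt N / T) \<le> 2" using 2 T N by (simp add: field_simps)
        ultimately show ?thesis unfolding \<mu>_def max_def by simp
      qed
      then show "cmod (h (q, c)) \<le> \<rho>" unfolding hw \<rho>_def using \<mu>0 by (simp add: field_simps)
    qed
    have inj: "inj_on h (W\<^sub>2 \<tau>)"
    proof (rule inj_onI)
      fix x y assume xy: "x \<in> W\<^sub>2 \<tau>" "y \<in> W\<^sub>2 \<tau>" "h x = h y"
      obtain q c q' c' where e: "x = (q, c)" "y = (q', c')" by (cases x, cases y)
      show "x = y" using h(1,2)[of q c] h(1,2)[of q' c'] xy unfolding e by simp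
    qed
    have "real (card (h ` W\<^sub>2 \<tau>)) * smooth_density P D \<le> 5760000 * \<rho>^2"
    proof (rule sieve_bound[OF gprimeD(1)[OF W0(1)] q1(1) _ D\<rho> P_def])
      show "1 \<le> D" using D2 by simp
      show "h ` W\<^sub>2 \<tau> \<subseteq> {s \<in> gauss_ints. cmod s \<le> \<rho>}" using h(3,4) by auto
      fix s p assume s: "s \<in> h ` W\<^sub>2 \<tau>" and p: "p \<in> P"
      then obtain q c where qc: "(q, c) \<in> W\<^sub>2 \<tau>" "s = h (q, c)" by auto
      have q: "gprime q" "gnorm q > D" using qc W unfolding W\<^sub>2_def by auto
      have p': "p \<in> prime_reps" "gnorm p \<le> D" using p unfolding P_def by auto
      \<comment> \<open>A sieving prime dividing the prime \<open>q\<close> would be associated to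
        it, but its norm is at most \<open>D\<close>.\<close>
      have "\<not> gdvd p q"
      proof
        assume "gdvd p q"
        then have "gdvd q p"
          using gprime_gdvd_cases[OF q(1) prime_reps_gauss[OF p'(1)]] gprimeD(3)[OF prime_repsD[OF p'(1)]] by blast
        then have "gnorm q \<le> gnorm p" using gdvd_imp_gnorm_le gprimeD(2)[OF prime_repsD[OF p'(1)]] by blast
        then show False using q p' by linarith
      qed
      then show "\<not> gdvd p (q\<^sub>0 + s * q\<^sub>1)" using h(1)[OF qc(1)] qc(2) by simp
    qed
    moreover have "card (h ` W\<^sub>2 \<tau>) = card (W\<^sub>2 \<tau>)" using inj by (rule card_image)
    moreover have "\<rho>^2 = 16 / \<mu>^2" unfolding \<rho>_def by (simp add: power_divide)
    ultimately have "real (card (W\<^sub>2 \<tau>)) * L \<le> 92160000 / \<mu>^2" unfolding L_def by simp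
    then show ?thesis using L0 \<mu>0 by (simp add: field_simps)
  qed
  have cover: "W \<subseteq> W\<^sub>0 \<union> W\<^sub>1 \<union> (\<Union>\<tau>\<in>E. W\<^sub>2 \<tau>)"
  proof
    fix x assume x: "x \<in> W"
    obtain q c where qc: "x = (q, c)" by (cases x)
    note Wx = W[OF x[unfolded qc]]
    have "t x \<in> E" if "t x \<noteq> 0"
    proof -
      have tx: "t x = q * (c\<^sub>1 - \<alpha> * q\<^sub>1) - q\<^sub>1 * (c - \<alpha> * q)" unfolding t_def qc by (simp add: algebra_simps)
      have q: "cmod q \<le> T" using Wx(2) gnorm_le_iff Q unfolding T_def by auto
      have c: "cmod (c - \<alpha> * q) \<le> T / sqrt N" using Wx(5) divide_right_mono[OF q, of "sqrt N"] N by simp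
      have "cmod (t x) \<le> cmod q * cmod (c\<^sub>1 - \<alpha> * q\<^sub>1) + cmod q\<^sub>1 * cmod (c - \<alpha> * q)"
        unfolding tx norm_mult[symmetric] by (rule norm_triangle_ineq4)
      also have "\<dots> \<le> T * (\<mu> * T / sqrt N) + (\<mu> * T) * (T / sqrt N)"
        using q c \<mu>1 T \<mu>0 by (intro add_mono mult_mono) auto
      also have "\<dots> = 2 * \<mu> * (Q / sqrt N)" unfolding T(2)[symmetric] by (simp add: power2_eq_square)
      finally have "gnorm (t x) \<le> (2 * \<mu> * (Q / sqrt N))^2" unfolding gnorm_eq by (intro power_mono) auto
      also have "\<dots> = 4 * \<mu>^2 * (Q^2 / N)" using N by (simp add: power_mult_distrib power_divide)
      finally have "gnorm (t x) \<le> 4 * \<mu>^2 * (Q^2 / N)" .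
      moreover have "t x \<in> gauss_ints"
        unfolding t_def qc using Wx gprimeD(1) q1 by (auto intro!: gauss_ints_closed)
      ultimately show ?thesis using that unfolding E_def nonzero_disc_def by auto
    qed
    then show "x \<in> W\<^sub>0 \<union> W\<^sub>1 \<union> (\<Union>\<tau>\<in>E. W\<^sub>2 \<tau>)" using x unfolding W\<^sub>0_def W\<^sub>1_def W\<^sub>2_def by auto
  qed
  have finE: "finite E" unfolding E_def by (rule finite_nonzero_disc)
  have fin: "finite W\<^sub>0" "finite W\<^sub>1" "finite (W\<^sub>2 \<tau>)" for \<tau>
    using finW unfolding W\<^sub>0_def W\<^sub>1_def W\<^sub>2_def by auto
  have "card W \<le> card (W\<^sub>0 \<union> W\<^sub>1 \<union> (\<Union>\<tau>\<in>E. W\<^sub>2 \<tau>))" using cover fin finE by (intro card_mono) auto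
  also have "\<dots> \<le> card W\<^sub>0 + card W\<^sub>1 + (\<Sum>\<tau>\<in>E. card (W\<^sub>2 \<tau>))"
    by (intro order_trans[OF card_Un_le] add_mono card_Un_le card_UN_le finE)
  finally have "real (card W) \<le> real (card W\<^sub>0) + real (card W\<^sub>1) + (\<Sum>\<tau>\<in>E. real (card (W\<^sub>2 \<tau>)))"
    by (simp flip: of_nat_sum of_nat_add)
  also have "(\<Sum>\<tau>\<in>E. real (card (W\<^sub>2 \<tau>))) \<le> (\<Sum>\<tau>\<in>E. 92160000 / (\<mu>^2 * L))"
    using c2 by (intro sum_mono)
  also have "\<dots> = real (card E) * (92160000 / (\<mu>^2 * L))" by simp
  also have "\<dots> \<le> (9 * (4 * \<mu>^2 * (Q^2 / N))) * (92160000 / (\<mu>^2 * L))"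
    unfolding E_def using L0 N by (intro mult_right_mono card_nonzero_disc_le) auto
  \<comment> \<open>The number of lines grows like \<open>\<mu>^2\<close> and the bound for each
    line like \<open>1 / \<mu>^2\<close>, so \<open>\<mu>\<close> disappears.\<close>
  also have "\<dots> = 3317760000 * (Q^2 / N) / L" using \<mu>0 by (simp add: field_simps)
  also have "\<dots> \<le> 3317760000 * (Q^2 / N) * (29952000 * l / \<Lambda>)"
  proof -
    have "1 / L \<le> 29952000 * l / \<Lambda>" using L L0 \<Lambda>0 by (simp add: field_simps)
    then have "3317760000 * (Q^2 / N) * (1 / L) \<le> 3317760000 * (Q^2 / N) * (29952000 * l / \<Lambda>)"
      using N by (intro mult_left_mono) auto
    then show ?thesis by simp
  qed
  \<comment> \<open>Since \<open>D >= 2\<close>, these sets have at most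
    \<open>4 + 729 * D <= 731 * D\<close> elements. The main term dominates \<open>D\<close> because
    \<open>D * \<Lambda> <= 2 * D^2 <= D^4 / 2\<close>, where \<open>D^4 = Q^2 / N\<close> and
    \<open>1/2 <= l\<close>.\<close>
  also have "real (card W\<^sub>0) + real (card W\<^sub>1) \<le> 731 * (Q^2 / N * l / \<Lambda>)"
  proof -
    have "\<Lambda> \<le> 2 * D" unfolding \<Lambda> using ln_bound[of "D / 2"] D0 by simp
    have "D * \<Lambda> \<le> D * (2 * D)" using \<open>\<Lambda> \<le> 2 * D\<close> D0 by (intro mult_left_mono) auto
    also have "\<dots> \<le> D * D * (D * D) * (1/2)"
      using D2 mult_mono[of 2 D 2 D] mult_left_mono[of 4 "D * D" "D * D"] by simp
    also have "D * D * (D * D) = D^4" by (simp add: power4_eq_xxxx mult.assoc)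
    also have "D^4 * (1/2) \<le> D^4 * l" using l by (intro mult_left_mono) auto
    finally have "D * \<Lambda> \<le> Q^2 / N * l" unfolding D4 .
    then have "D \<le> Q^2 / N * l / \<Lambda>" using \<Lambda>0 by (simp only: pos_le_divide_eq)
    then show ?thesis using c0 c1 D2 by linarith
  qed
  also have "731 * (Q^2 / N * l / \<Lambda>) + 3317760000 * (Q^2 / N) * (29952000 * l / \<Lambda>) = 99373547520000731 * (Q^2 / N * l / \<Lambda>)"
    by simp
  also have "\<dots> \<le> 10^17 * (Q^2 / N * l / \<Lambda>)"
    using N l \<Lambda>0 by (intro mult_right_mono) auto
  finally show ?thesis unfolding W_def l_def \<Lambda>_def by simp
qed

theorem theorem4:
  shows "\<exists>c1::real. c1 > 0 \<and>
    (\<forall>(Q::nat) (N::nat) (\<delta>::real) (a::complex \<Rightarrow> complex) (R::complex \<Rightarrow> complex set).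
      Q \<ge> 16 \<longrightarrow> 0 < \<delta> \<longrightarrow> \<delta> < 1 \<longrightarrow>
      real N = real Q powr (1 + \<delta>) / 16 \<longrightarrow>
      (\<forall>p. gprime p \<longrightarrow> reduced_residue_system p (R p)) \<longrightarrow>
      (\<Sum>p\<in>{p. gprime p \<and> gnorm p \<le> real Q}.
         \<Sum>r\<in>R p.
           (cmod (\<Sum>n\<in>{n\<in>gauss_ints. gnorm n \<le> real N}. a n * ee (Re (n * r / p))))^2)
      \<le> c1 / (1 - \<delta>) * ((real Q)^2 * ln (ln (real Q)) / ln (real Q)) *
         (\<Sum>n\<in>{n\<in>gauss_ints. gnorm n \<le> real N}. (cmod (a n))^2))"
proof (intro exI[of _ "5760000 * 10^17"] conjI allI impI)
  fix Q N :: nat and \<delta> :: real and a :: "complex \<Rightarrow> complex" and R :: "complex \<Rightarrow> complex set"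
  assume Q: "Q \<ge> 16" and \<delta>: "0 < \<delta>" "\<delta> < 1" and N: "real N = real Q powr (1 + \<delta>) / 16"
    and R: "\<forall>p. gprime p \<longrightarrow> reduced_residue_system p (R p)"
  define Ps where "Ps = {p. gprime p \<and> gnorm p \<le> real Q}"
  define J where "J = Sigma Ps R"
  define \<alpha> where "\<alpha> = (\<lambda>(p :: complex, r :: complex). r / p)"
  have RD: "reduced_residue_system p (R p)" if "p \<in> Ps" for p using that R unfolding Ps_def by blast
  have finPs: "finite Ps"
    by (rule finite_subset[OF _ finite_gnorm_le[of "real Q"]]) (auto simp: Ps_def gprimeD(1))
  have finR: "finite (R p)" if "p \<in> Ps" for p
    using reduced_residue_systemD(2)[OF RD[OF that]] that by (simp add: Ps_def)
  have finJ: "finite J" unfolding J_def using finPs finR by auto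
  \<comment> \<open>For \<open>0 < \<delta> < 1\<close> the number
    \<open>16 * N = Q powr (1 + \<delta>)\<close> lies between \<open>Q\<close> and
    \<open>Q^2\<close>, which is the range required for counting near fractions.\<close>
  have "real Q powr 1 \<le> real Q powr (1 + \<delta>)" using Q \<delta> by (intro powr_mono) auto
  then have QN: "real Q \<le> 16 * real N" unfolding N using Q by simp
  then have N1: "real N \<ge> 1" using Q by simp
  have "real Q powr (1 + \<delta>) < real Q powr 2" using Q \<delta> by (intro powr_less_mono) auto
  then have NQ: "16 * real N < real Q ^ 2" unfolding N using Q by (simp add: powr_realpow)
  have "(real Q)^2 / (16 * real N) = real Q powr (1 - \<delta>)"
  proof -
    have "(real Q)^2 = real Q powr 2" using Q by (simp add: powr_realpow)
    then show ?thesis unfolding N using powr_diff[of "real Q" 2 "1 + \<delta>"] by simp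
  qed
  then have ln: "ln ((real Q)^2 / (16 * real N)) = (1 - \<delta>) * ln (real Q)" using Q by (simp add: ln_powr)
  define K where "K = 10^17 * ((real Q)^2 / real N * ln (ln (real Q)) / ((1 - \<delta>) * ln (real Q)))"
  have count: "real (card {j \<in> J. \<exists>g\<in>gauss_ints. cmod (\<alpha> j - \<beta> - g) \<le> 1 / sqrt (real N)}) \<le> K" for \<beta>
  proof -
    define X where "X = {j \<in> J. \<exists>g\<in>gauss_ints. cmod (\<alpha> j - \<beta> - g) \<le> 1 / sqrt (real N)}"
    have "\<forall>j\<in>X. \<exists>g. g \<in> gauss_ints \<and> cmod (\<alpha> j - \<beta> - g) \<le> 1 / sqrt (real N)" unfolding X_def by blast
    then obtain g where g: "\<And>j. j \<in> X \<Longrightarrow> g j \<in> gauss_ints \<and> cmod (\<alpha> j - \<beta> - g j) \<le> 1 / sqrt (real N)"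
      by metis
    \<comment> \<open>Shifting the numerator by \<open>g j * p\<close> turns nearness modulo
      Gaussian integers into nearness. No two pairs are merged, because the numerators for one
      \<open>p\<close> are incongruent modulo \<open>p\<close>.\<close>
    define f where "f = (\<lambda>j. (fst j, snd j - g j * fst j))"
    have X: "gprime (fst j)" "gnorm (fst j) \<le> real Q" "snd j \<in> R (fst j)" "snd j \<in> gauss_ints" "\<not> gdvd (fst j) (snd j)"
      if "j \<in> X" for j
    proof -
      have j: "fst j \<in> Ps" "snd j \<in> R (fst j)" using that unfolding X_def J_def by auto
      then show "gprime (fst j)" "gnorm (fst j) \<le> real Q" "snd j \<in> R (fst j)" by (auto simp: Ps_def)
      then show "snd j \<in> gauss_ints" "\<not> gdvd (fst j) (snd j)"
        using reduced_residue_systemD(1,4)[OF RD[OF j(1)]] by auto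
    qed
    have "inj_on f X"
    proof (rule inj_onI)
      fix i j assume ij: "i \<in> X" "j \<in> X" "f i = f j"
      then have e: "fst i = fst j" "snd i - snd j = fst i * (g i - g j)" unfolding f_def by (auto simp: algebra_simps)
      have "g i - g j \<in> gauss_ints" using g[OF ij(1)] g[OF ij(2)] gauss_ints_diff by blast
      then have "gdvd (fst i) (snd i - snd j)" using e(2) by (rule gdvdI)
      then have "snd i = snd j"
        using reduced_residue_system_eq[of "fst i" "R (fst i)"] R X ij e(1) by metis
      then show "i = j" using e(1) by (simp add: prod_eq_iff)
    qed
    moreover have "f ` X \<subseteq> near_fractions (real Q) (real N) \<beta>"
    proof
      fix y assume "y \<in> f ` X"
      then obtain j where j: "j \<in> X" "y = f j" by auto
      obtain p r where pr: "j = (p, r)" by (cases j)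
      have p: "gprime p" "gnorm p \<le> real Q" "r \<in> gauss_ints" "\<not> gdvd p r" using X[OF j(1)] pr by auto
      have gj: "g j \<in> gauss_ints" "cmod (r / p - \<beta> - g j) \<le> 1 / sqrt (real N)" using g[OF j(1)] pr unfolding \<alpha>_def by auto
      have "r - g j * p - \<beta> * p = p * (r / p - \<beta> - g j)" using gprimeD(2)[OF p(1)] by (simp add: algebra_simps)
      then have "cmod (r - g j * p - \<beta> * p) = cmod p * cmod (r / p - \<beta> - g j)" by (simp add: norm_mult)
      also have "\<dots> \<le> cmod p * (1 / sqrt (real N))" using gj(2) by (intro mult_left_mono) auto
      finally have "cmod (r - g j * p - \<beta> * p) \<le> cmod p / sqrt (real N)" by simp
      moreover have "\<not> gdvd p (r - g j * p)"
      proof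
        assume "gdvd p (r - g j * p)"
        moreover have "gdvd p (g j * p)" using gj(1) by (intro gdvd_mult_left) auto
        ultimately have "gdvd p (r - g j * p + g j * p)" by (rule gdvd_add)
        then show False using p(4) by simp
      qed
      moreover have "r - g j * p \<in> gauss_ints" using p gprimeD(1) gj by (auto intro!: gauss_ints_closed)
      ultimately show "y \<in> near_fractions (real Q) (real N) \<beta>"
        unfolding j(2) f_def pr near_fractions_def using p by (simp add: pr)
    qed
    moreover have "finite (near_fractions (real Q) (real N) \<beta>)" using N1 QN by (intro finite_near_fractions) auto
    ultimately have "card X \<le> card (near_fractions (real Q) (real N) \<beta>)" by (rule card_inj_on_le)
    also have "real \<dots> \<le> K"
      using card_near_fractions_le[of "real Q" "real N" \<beta>] Q N1 QN NQ unfolding ln K_def by simp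
    finally show ?thesis unfolding X_def by simp
  qed
  have "(\<Sum>p\<in>Ps. \<Sum>r\<in>R p. (cmod (\<Sum>n\<in>{n\<in>gauss_ints. gnorm n \<le> real N}. a n * ee (Re (n * r / p))))^2)
    = (\<Sum>j\<in>J. (cmod (\<Sum>n\<in>{n\<in>gauss_ints. gnorm n \<le> real N}. a n * ee (Re (n * \<alpha> j))))^2)"
    unfolding J_def \<alpha>_def by (subst sum.Sigma) (use finPs finR in \<open>simp_all add: case_prod_unfold del: times_complex.sel\<close>)
  also have "\<dots> \<le> 5760000 * K * real N * (\<Sum>n\<in>{n\<in>gauss_ints. gnorm n \<le> real N}. (cmod (a n))^2)"
    by (rule large_sieve[OF finJ N1 count])
  \<comment> \<open>The factor \<open>N\<close> of the large sieve cancels the \<open>1 / N\<close>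
    in the count \<open>K\<close>.\<close>
  also have "5760000 * K * real N = 5760000 * 10^17 / (1 - \<delta>) * ((real Q)^2 * ln (ln (real Q)) / ln (real Q))"
    unfolding K_def using N1 \<delta> by simp
  finally show "(\<Sum>p\<in>{p. gprime p \<and> gnorm p \<le> real Q}. \<Sum>r\<in>R p.
        (cmod (\<Sum>n\<in>{n\<in>gauss_ints. gnorm n \<le> real N}. a n * ee (Re (n * r / p))))^2)
      \<le> 5760000 * 10^17 / (1 - \<delta>) * ((real Q)^2 * ln (ln (real Q)) / ln (real Q)) *
         (\<Sum>n\<in>{n\<in>gauss_ints. gnorm n \<le> real N}. (cmod (a n))^2)"
    unfolding Ps_def .
qed simp

end
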